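(* Let $(M,\alpha_1,\alpha_2,\phi,g)$ be a normal metric contact pair manifold with decomposable $\phi$ and Reeb vector fields $Z_1$ and $Z_2$. Let $N$ be a $\phi$-invariant submanifold of $M$ nowhere tangent and nowhere orthogonal to $Z_1$ and $Z_2$ (that is, for every $p\in N$ and each $i=1,2$, the vector $(Z_i)_p$ is neither in $T_pN$ nor orthogonal to $T_pN$). Let $Z_1^T$ denote the component of $Z_1$ tangent to $N$ along $N$. Then $N$ is minimal if and only if the angle between $Z_1^T$ and $Z_1$ (or, equivalently, between $Z_1^T$ and $Z_2$) is constant along the integral curves of $Z_1^T$.
   Context: All objects are smooth. Convention: $d\alpha(X,Y)=\frac12[X\alpha(Y)-Y\alpha(X)-\alpha([X,Y])]$. Contact pair: a contact pair of type $(h,k)$ ($h,k\ge 0$ integers) on a manifold $M$ is a pair $(\alpha_1,\alpha_2)$ of 1-forms such that $\alpha_1\wedge(d\alpha_1)^h\wedge\alpha_2\wedge(d\alpha_2)^k$ is a volume form, $(d\alpha_1)^{h+1}=0$ and $(d\alpha_2)^{k+1}=0$ (so $\dim M=2h+2k+2$). Its Reeb vector fields $Z_1,Z_2$ are the unique vector fields with $\alpha_i(Z_j)=\delta_{ij}$ and $i_{Z_i}d\alpha_j=0$ for $i,j=1,2$. The distribution $\ker\alpha_i\cap\ker d\alpha_i$ is integrable and defines the characteristic foliation $\mathcal{F}_i$ of $\alpha_i$, and $TM=T\mathcal{F}_1\oplus T\mathcal{F}_2$. Metric contact pair (MCP): a 4-tuple $(\alpha_1,\alpha_2,\phi,g)$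 where $(\alpha_1,\alpha_2)$ is a contact pair on $M$ with Reeb vector fields $Z_1,Z_2$, $\phi$ is an endomorphism field of $TM$ with $\phi^2=-\mathrm{Id}+\alpha_1\otimes Z_1+\alpha_2\otimes Z_2$ and $\phi Z_1=\phi Z_2=0$, and $g$ is a Riemannian metric with $g(X,\phi Y)=(d\alpha_1+d\alpha_2)(X,Y)$ and $g(X,Z_i)=\alpha_i(X)$, $i=1,2$. $\phi$ is decomposable if $\phi(T\mathcal{F}_i)\subset T\mathcal{F}_i$ for $i=1,2$. The MCP is normal if the two almost complex structures $J=\phi-\alpha_2\otimes Z_1+\alpha_1\otimes Z_2$ and $T=\phi+\alpha_2\otimes Z_1-\alpha_1\otimes Z_2$ are both integrable. A submanifold $N$ of $M$ is $\phi$-invariant if $\phi_p(T_pN)\subset T_pN$ for all $p\in N$. $N$ is minimal if the trace of its second fundamental form (with respect to $g$) vanishes identically. *)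

theory Defs
  imports "HOL-Analysis.Analysis"
begin

section \<open>Smooth maps between open subsets of Euclidean spaces\<close>

text \<open>Only used for open sets \<open>S\<close>.\<close>

fun Ck_on :: "nat \<Rightarrow> 'a::real_normed_vector set \<Rightarrow> ('a \<Rightarrow> 'b::real_normed_vector) \<Rightarrow> bool" where
  "Ck_on 0 S f \<longleftrightarrow> continuous_on S f"
| "Ck_on (Suc k) S f \<longleftrightarrow> (\<forall>x\<in>S. f differentiable (at x)) \<and>
     (\<forall>v. Ck_on k S (\<lambda>x. frechet_derivative f (at x) v))"

definition smooth_on :: "'a::real_normed_vector set \<Rightarrow> ('a \<Rightarrow> 'b::real_normed_vector) \<Rightarrow> bool" where
  "smooth_on S f \<longleftrightarrow> (\<forall>k. Ck_on k S f)"


section \<open>Manifolds\<close>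

text \<open>A manifold is a Hausdorff, second countable type \<open>'m\<close> with a smooth atlas of charts into a
  Euclidean space \<open>'e\<close>. A chart is a pair of a domain and a coordinate map, whose values outside the
  domain are irrelevant.\<close>

type_synonym ('m, 'e) chart = "'m set \<times> ('m \<Rightarrow> 'e)"

abbreviation cdom :: "('m, 'e) chart \<Rightarrow> 'm set" where "cdom c \<equiv> fst c"
abbreviation cmap :: "('m, 'e) chart \<Rightarrow> 'm \<Rightarrow> 'e" where "cmap c \<equiv> snd c"

definition cimg :: "('m, 'e) chart \<Rightarrow> 'e set" where
  "cimg c = cmap c ` cdom c"

definition cinv :: "('m, 'e) chart \<Rightarrow> 'e \<Rightarrow> 'm" where
  "cinv c = inv_into (cdom c) (cmap c)"

definition is_chart :: "('m::topological_space, 'e::euclidean_space) chart \<Rightarrow> bool" where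
  "is_chart c \<longleftrightarrow> open (cdom c) \<and> open (cimg c) \<and>
     homeomorphism (cdom c) (cimg c) (cmap c) (cinv c)"

definition smooth_transition ::
  "('m, 'e::euclidean_space) chart \<Rightarrow> ('m, 'e) chart \<Rightarrow> bool" where
  "smooth_transition c d \<longleftrightarrow> smooth_on (cmap c ` (cdom c \<inter> cdom d)) (cmap d \<circ> cinv c)"

definition smooth_atlas ::
  "('m::{t2_space, second_countable_topology}, 'e::euclidean_space) chart set \<Rightarrow> bool" where
  "smooth_atlas A \<longleftrightarrow> (\<Union>c\<in>A. cdom c) = UNIV \<and> (\<forall>c\<in>A. is_chart c) \<and>
     (\<forall>c\<in>A. \<forall>d\<in>A. smooth_transition c d)"

text \<open>Membership in the maximal atlas generated by \<open>A\<close>.\<close>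

definition admissible_chart ::
  "('m::topological_space, 'e::euclidean_space) chart set \<Rightarrow> ('m, 'e) chart \<Rightarrow> bool" where
  "admissible_chart A c \<longleftrightarrow> is_chart c \<and>
     (\<forall>d\<in>A. smooth_transition c d \<and> smooth_transition d c)"

text \<open>Every tangent space \<open>T\<^sub>pM\<close> is the vector space \<open>'e\<close>: a vector \<open>v\<close> at \<open>p\<close> stands for the tangent
  vector whose components in the chart \<open>chart_at A p\<close>, chosen once and for all, are \<open>v\<close>. Thus
  vector fields are maps \<open>'m \<Rightarrow> 'e\<close>, one-forms are maps \<open>'m \<Rightarrow> 'e \<Rightarrow> real\<close>, and so on. As the chosen
  chart may jump with \<open>p\<close>, such a map is never differentiated directly; smoothness and derivatives
  always refer to its components in one fixed chart.\<close>

definition chart_at :: "('m, 'e) chart set \<Rightarrow> 'm \<Rightarrow> ('m, 'e) chart" where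
  "chart_at A p = (SOME c. c \<in> A \<and> p \<in> cdom c)"

text \<open>\<open>to_chart A c p v\<close>: the components in the chart \<open>c\<close> of the tangent vector \<open>v\<close> at \<open>p\<close>;
  \<open>of_chart A c p\<close> is its inverse.\<close>

definition to_chart ::
  "('m, 'e::euclidean_space) chart set \<Rightarrow> ('m, 'e) chart \<Rightarrow> 'm \<Rightarrow> 'e \<Rightarrow> 'e" where
  "to_chart A c p v =
     frechet_derivative (cmap c \<circ> cinv (chart_at A p)) (at (cmap (chart_at A p) p)) v"

definition of_chart ::
  "('m, 'e::euclidean_space) chart set \<Rightarrow> ('m, 'e) chart \<Rightarrow> 'm \<Rightarrow> 'e \<Rightarrow> 'e" where
  "of_chart A c p w =
     frechet_derivative (cmap (chart_at A p) \<circ> cinv c) (at (cmap c p)) w"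


section \<open>Tensor fields\<close>

text \<open>Components in a chart \<open>c\<close>, as functions on \<open>cimg c\<close>, of a vector field, a one-form, an
  endomorphism field and a field of bilinear forms.\<close>

definition vec_rep where
  "vec_rep A c X = (\<lambda>u. to_chart A c (cinv c u) (X (cinv c u)))"

definition form_rep where
  "form_rep A c \<alpha> = (\<lambda>u v. \<alpha> (cinv c u) (of_chart A c (cinv c u) v))"

definition endo_rep where
  "endo_rep A c \<phi> = (\<lambda>u v. to_chart A c (cinv c u) (\<phi> (cinv c u) (of_chart A c (cinv c u) v)))"

definition bil_rep where
  "bil_rep A c b = (\<lambda>u v w. b (cinv c u) (of_chart A c (cinv c u) v) (of_chart A c (cinv c u) w))"

definition vector_field ::
  "('m, 'e::euclidean_space) chart set \<Rightarrow> ('m \<Rightarrow> 'e) \<Rightarrow> bool" where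
  "vector_field A X \<longleftrightarrow> (\<forall>c\<in>A. smooth_on (cimg c) (vec_rep A c X))"

definition one_form ::
  "('m, 'e::euclidean_space) chart set \<Rightarrow> ('m \<Rightarrow> 'e \<Rightarrow> real) \<Rightarrow> bool" where
  "one_form A \<alpha> \<longleftrightarrow> (\<forall>p. linear (\<alpha> p)) \<and>
     (\<forall>c\<in>A. \<forall>v. smooth_on (cimg c) (\<lambda>u. form_rep A c \<alpha> u v))"

definition endomorphism_field ::
  "('m, 'e::euclidean_space) chart set \<Rightarrow> ('m \<Rightarrow> 'e \<Rightarrow> 'e) \<Rightarrow> bool" where
  "endomorphism_field A \<phi> \<longleftrightarrow> (\<forall>p. linear (\<phi> p)) \<and>
     (\<forall>c\<in>A. \<forall>v. smooth_on (cimg c) (\<lambda>u. endo_rep A c \<phi> u v))"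

definition riemannian_metric ::
  "('m, 'e::euclidean_space) chart set \<Rightarrow> ('m \<Rightarrow> 'e \<Rightarrow> 'e \<Rightarrow> real) \<Rightarrow> bool" where
  "riemannian_metric A g \<longleftrightarrow>
     (\<forall>p. bilinear (g p) \<and> (\<forall>v w. g p v w = g p w v) \<and> (\<forall>v. v \<noteq> 0 \<longrightarrow> g p v v > 0)) \<and>
     (\<forall>c\<in>A. \<forall>v w. smooth_on (cimg c) (\<lambda>u. bil_rep A c g u v w))"

text \<open>The convention is \<open>d\<alpha>(X,Y) = 1/2 (X(\<alpha> Y) - Y(\<alpha> X) - \<alpha> [X,Y])\<close>. At \<open>p\<close> it is evaluated on the
  fields with constant components \<open>v\<close>, \<open>w\<close> in the chart \<open>chart_at A p\<close>, whose bracket vanishes.\<close>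

definition ext_deriv ::
  "('m, 'e::euclidean_space) chart set \<Rightarrow> ('m \<Rightarrow> 'e \<Rightarrow> real) \<Rightarrow> 'm \<Rightarrow> 'e \<Rightarrow> 'e \<Rightarrow> real" where
  "ext_deriv A \<alpha> p v w =
     (let c = chart_at A p; u = cmap c p in
      (frechet_derivative (\<lambda>x. form_rep A c \<alpha> x w) (at u) v
       - frechet_derivative (\<lambda>x. form_rep A c \<alpha> x v) (at u) w) / 2)"


section \<open>Exterior algebra of a tangent space\<close>

text \<open>An alternating \<open>r\<close>-form is a function of sequences of vectors depending on the entries
  \<open>0, \<dots>, r - 1\<close> only. The factor \<open>1 / (r + s)!\<close> is the normalisation that goes with the factor
  \<open>1/2\<close> in the exterior derivative.\<close>

definition wedge :: "nat \<Rightarrow> nat \<Rightarrow> ((nat \<Rightarrow> 'e) \<Rightarrow> real) \<Rightarrow> ((nat \<Rightarrow> 'e) \<Rightarrow> real) \<Rightarrow> (nat \<Rightarrow> 'e) \<Rightarrow> real" where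
  "wedge r s \<omega> \<eta> v =
     (\<Sum>\<sigma> | \<sigma> permutes {..<r + s}.
        of_int (sign \<sigma>) * \<omega> (\<lambda>i. v (\<sigma> i)) * \<eta> (\<lambda>i. v (\<sigma> (r + i)))) / fact (r + s)"

definition form1 :: "('e \<Rightarrow> real) \<Rightarrow> (nat \<Rightarrow> 'e) \<Rightarrow> real" where
  "form1 a v = a (v 0)"

definition form2 :: "('e \<Rightarrow> 'e \<Rightarrow> real) \<Rightarrow> (nat \<Rightarrow> 'e) \<Rightarrow> real" where
  "form2 b v = b (v 0) (v 1)"

fun wedge_power :: "('e \<Rightarrow> 'e \<Rightarrow> real) \<Rightarrow> nat \<Rightarrow> (nat \<Rightarrow> 'e) \<Rightarrow> real" where
  "wedge_power b 0 = (\<lambda>v. 1)"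
| "wedge_power b (Suc n) = wedge 2 (2 * n) (form2 b) (wedge_power b n)"


section \<open>Metric contact pairs\<close>

text \<open>\<open>\<alpha>1 \<and> (d\<alpha>1)^h \<and> \<alpha>2 \<and> (d\<alpha>2)^k\<close> at \<open>p\<close>, of degree \<open>2 h + 2 k + 2\<close>. In the definition of a
  contact pair, the conjuncts on the dimension and on this form say that it is a volume form,
  i.e. of top degree and nowhere zero.\<close>

definition contact_pair_form where
  "contact_pair_form A h k \<alpha>1 \<alpha>2 p =
     wedge 1 (2 * h + (1 + 2 * k)) (form1 (\<alpha>1 p))
      (wedge (2 * h) (1 + 2 * k) (wedge_power (ext_deriv A \<alpha>1 p) h)
        (wedge 1 (2 * k) (form1 (\<alpha>2 p)) (wedge_power (ext_deriv A \<alpha>2 p) k)))"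

definition contact_pair ::
  "('m, 'e::euclidean_space) chart set \<Rightarrow> nat \<Rightarrow> nat \<Rightarrow>
   ('m \<Rightarrow> 'e \<Rightarrow> real) \<Rightarrow> ('m \<Rightarrow> 'e \<Rightarrow> real) \<Rightarrow> bool" where
  "contact_pair A h k \<alpha>1 \<alpha>2 \<longleftrightarrow> one_form A \<alpha>1 \<and> one_form A \<alpha>2 \<and>
     DIM('e) = 2 * h + 2 * k + 2 \<and> (\<forall>p. \<exists>v. contact_pair_form A h k \<alpha>1 \<alpha>2 p v \<noteq> 0) \<and>
     (\<forall>p v. wedge_power (ext_deriv A \<alpha>1 p) (h + 1) v = 0) \<and>
     (\<forall>p v. wedge_power (ext_deriv A \<alpha>2 p) (k + 1) v = 0)"

definition reeb_fields ::
  "('m, 'e::euclidean_space) chart set \<Rightarrow> ('m \<Rightarrow> 'e \<Rightarrow> real) \<Rightarrow> ('m \<Rightarrow> 'e \<Rightarrow> real) \<Rightarrow>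
   ('m \<Rightarrow> 'e) \<Rightarrow> ('m \<Rightarrow> 'e) \<Rightarrow> bool" where
  "reeb_fields A \<alpha>1 \<alpha>2 Z1 Z2 \<longleftrightarrow> vector_field A Z1 \<and> vector_field A Z2 \<and>
     (\<forall>p. \<alpha>1 p (Z1 p) = 1 \<and> \<alpha>1 p (Z2 p) = 0 \<and> \<alpha>2 p (Z1 p) = 0 \<and> \<alpha>2 p (Z2 p) = 1) \<and>
     (\<forall>p v. ext_deriv A \<alpha>1 p (Z1 p) v = 0 \<and> ext_deriv A \<alpha>2 p (Z1 p) v = 0 \<and>
            ext_deriv A \<alpha>1 p (Z2 p) v = 0 \<and> ext_deriv A \<alpha>2 p (Z2 p) v = 0)"

definition metric_contact_pair ::
  "('m, 'e::euclidean_space) chart set \<Rightarrow> nat \<Rightarrow> nat \<Rightarrow> ('m \<Rightarrow> 'e \<Rightarrow> real) \<Rightarrow> ('m \<Rightarrow> 'e \<Rightarrow> real) \<Rightarrow>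
   ('m \<Rightarrow> 'e) \<Rightarrow> ('m \<Rightarrow> 'e) \<Rightarrow> ('m \<Rightarrow> 'e \<Rightarrow> 'e) \<Rightarrow> ('m \<Rightarrow> 'e \<Rightarrow> 'e \<Rightarrow> real) \<Rightarrow> bool" where
  "metric_contact_pair A h k \<alpha>1 \<alpha>2 Z1 Z2 \<phi> g \<longleftrightarrow>
     contact_pair A h k \<alpha>1 \<alpha>2 \<and> reeb_fields A \<alpha>1 \<alpha>2 Z1 Z2 \<and>
     endomorphism_field A \<phi> \<and>
     (\<forall>p v. \<phi> p (\<phi> p v) = - v + \<alpha>1 p v *\<^sub>R Z1 p + \<alpha>2 p v *\<^sub>R Z2 p) \<and>
     (\<forall>p. \<phi> p (Z1 p) = 0 \<and> \<phi> p (Z2 p) = 0) \<and>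
     riemannian_metric A g \<and>
     (\<forall>p v w. g p v (\<phi> p w) = ext_deriv A \<alpha>1 p v w + ext_deriv A \<alpha>2 p v w) \<and>
     (\<forall>p v. g p v (Z1 p) = \<alpha>1 p v \<and> g p v (Z2 p) = \<alpha>2 p v)"

text \<open>The tangent space at \<open>p\<close> of the characteristic foliation of \<open>\<alpha>\<close>.\<close>

definition char_dist ::
  "('m, 'e::euclidean_space) chart set \<Rightarrow> ('m \<Rightarrow> 'e \<Rightarrow> real) \<Rightarrow> 'm \<Rightarrow> 'e set" where
  "char_dist A \<alpha> p = {v. \<alpha> p v = 0 \<and> (\<forall>w. ext_deriv A \<alpha> p v w = 0)}"

definition decomposable ::
  "('m, 'e::euclidean_space) chart set \<Rightarrow> ('m \<Rightarrow> 'e \<Rightarrow> real) \<Rightarrow> ('m \<Rightarrow> 'e \<Rightarrow> real) \<Rightarrow>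
   ('m \<Rightarrow> 'e \<Rightarrow> 'e) \<Rightarrow> bool" where
  "decomposable A \<alpha>1 \<alpha>2 \<phi> \<longleftrightarrow>
     (\<forall>p. \<phi> p ` char_dist A \<alpha>1 p \<subseteq> char_dist A \<alpha>1 p \<and> \<phi> p ` char_dist A \<alpha>2 p \<subseteq> char_dist A \<alpha>2 p)"

text \<open>\<open>J\<close> is integrable if it is induced by a complex structure, i.e. around every point there are
  coordinates identifying \<open>J\<close> with a constant complex structure \<open>J0\<close> of the vector space \<open>'e\<close>.\<close>

definition integrable_acs ::
  "('m::topological_space, 'e::euclidean_space) chart set \<Rightarrow> ('m \<Rightarrow> 'e \<Rightarrow> 'e) \<Rightarrow> bool" where
  "integrable_acs A J \<longleftrightarrow>
     (\<forall>p. \<exists>c J0. admissible_chart A c \<and> p \<in> cdom c \<and> linear J0 \<and> (\<forall>v. J0 (J0 v) = - v) \<and>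
        (\<forall>q\<in>cdom c. \<forall>v. to_chart A c q (J q v) = J0 (to_chart A c q v)))"

definition normal_pair ::
  "('m::topological_space, 'e::euclidean_space) chart set \<Rightarrow> ('m \<Rightarrow> 'e \<Rightarrow> real) \<Rightarrow>
   ('m \<Rightarrow> 'e \<Rightarrow> real) \<Rightarrow> ('m \<Rightarrow> 'e) \<Rightarrow> ('m \<Rightarrow> 'e) \<Rightarrow> ('m \<Rightarrow> 'e \<Rightarrow> 'e) \<Rightarrow> bool" where
  "normal_pair A \<alpha>1 \<alpha>2 Z1 Z2 \<phi> \<longleftrightarrow>
     integrable_acs A (\<lambda>p v. \<phi> p v - \<alpha>2 p v *\<^sub>R Z1 p + \<alpha>1 p v *\<^sub>R Z2 p) \<and>
     integrable_acs A (\<lambda>p v. \<phi> p v + \<alpha>2 p v *\<^sub>R Z1 p - \<alpha>1 p v *\<^sub>R Z2 p)"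


section \<open>Submanifolds\<close>

text \<open>A submanifold of \<open>M\<close> is a manifold \<open>N\<close> (the type \<open>'n\<close> with the atlas \<open>B\<close>) with an injective
  immersion \<open>\<iota>\<close> into \<open>M\<close>; it need not be embedded.\<close>

definition smooth_map ::
  "('n::topological_space, 'f::euclidean_space) chart set \<Rightarrow>
   ('m::topological_space, 'e::euclidean_space) chart set \<Rightarrow> ('n \<Rightarrow> 'm) \<Rightarrow> bool" where
  "smooth_map B A \<iota> \<longleftrightarrow> continuous_on UNIV \<iota> \<and>
     (\<forall>d\<in>B. \<forall>c\<in>A. smooth_on (cmap d ` (cdom d \<inter> \<iota> -` cdom c)) (cmap c \<circ> \<iota> \<circ> cinv d))"

definition tangent_map ::
  "('n, 'f::euclidean_space) chart set \<Rightarrow> ('m, 'e::euclidean_space) chart set \<Rightarrow>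
   ('n \<Rightarrow> 'm) \<Rightarrow> 'n \<Rightarrow> 'f \<Rightarrow> 'e" where
  "tangent_map B A \<iota> q v =
     frechet_derivative (cmap (chart_at A (\<iota> q)) \<circ> \<iota> \<circ> cinv (chart_at B q))
       (at (cmap (chart_at B q) q)) v"

definition submanifold ::
  "('n::{t2_space, second_countable_topology}, 'f::euclidean_space) chart set \<Rightarrow>
   ('m::{t2_space, second_countable_topology}, 'e::euclidean_space) chart set \<Rightarrow>
   ('n \<Rightarrow> 'm) \<Rightarrow> bool" where
  "submanifold B A \<iota> \<longleftrightarrow> smooth_atlas B \<and> smooth_map B A \<iota> \<and> inj \<iota> \<and>
     (\<forall>q. inj (tangent_map B A \<iota> q))"

definition tangent_space ::
  "('n, 'f::euclidean_space) chart set \<Rightarrow> ('m, 'e::euclidean_space) chart set \<Rightarrow>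
   ('n \<Rightarrow> 'm) \<Rightarrow> 'n \<Rightarrow> 'e set" where
  "tangent_space B A \<iota> q = range (tangent_map B A \<iota> q)"

definition invariant_submanifold ::
  "('n, 'f::euclidean_space) chart set \<Rightarrow> ('m, 'e::euclidean_space) chart set \<Rightarrow>
   ('n \<Rightarrow> 'm) \<Rightarrow> ('m \<Rightarrow> 'e \<Rightarrow> 'e) \<Rightarrow> bool" where
  "invariant_submanifold B A \<iota> \<phi> \<longleftrightarrow>
     (\<forall>q. \<phi> (\<iota> q) ` tangent_space B A \<iota> q \<subseteq> tangent_space B A \<iota> q)"

definition nowhere_tangent where
  "nowhere_tangent B A \<iota> Z \<longleftrightarrow> (\<forall>q. Z (\<iota> q) \<notin> tangent_space B A \<iota> q)"

definition nowhere_orthogonal where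
  "nowhere_orthogonal B A \<iota> g Z \<longleftrightarrow>
     (\<forall>q. \<not> (\<forall>w\<in>tangent_space B A \<iota> q. g (\<iota> q) (Z (\<iota> q)) w = (0::real)))"

text \<open>The orthogonal projection of a vector \<open>x\<close> at \<open>\<iota> q\<close> to the tangent space of \<open>N\<close> at \<open>q\<close>.\<close>

definition tan_part ::
  "('n, 'f::euclidean_space) chart set \<Rightarrow> ('m, 'e::euclidean_space) chart set \<Rightarrow>
   ('n \<Rightarrow> 'm) \<Rightarrow> ('m \<Rightarrow> 'e \<Rightarrow> 'e \<Rightarrow> real) \<Rightarrow> 'n \<Rightarrow> 'e \<Rightarrow> 'e" where
  "tan_part B A \<iota> g q x =
     (THE t. t \<in> tangent_space B A \<iota> q \<and> (\<forall>s\<in>tangent_space B A \<iota> q. g (\<iota> q) (x - t) s = 0))"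

text \<open>The Christoffel symbols at \<open>p\<close> of the Levi-Civita connection in the chart \<open>chart_at A p\<close>:
  the vector \<open>\<Gamma>(v,w)\<close> is the covariant derivative of the field with constant components \<open>w\<close> in the
  direction \<open>v\<close>, given by the Koszul formula (in which all brackets vanish).\<close>

definition christoffel ::
  "('m, 'e::euclidean_space) chart set \<Rightarrow> ('m \<Rightarrow> 'e \<Rightarrow> 'e \<Rightarrow> real) \<Rightarrow> 'm \<Rightarrow> 'e \<Rightarrow> 'e \<Rightarrow> 'e" where
  "christoffel A g p v w =
     (let c = chart_at A p; u = cmap c p;
          D = (\<lambda>x y z. frechet_derivative (\<lambda>u'. bil_rep A c g u' y z) (at u) x)
      in THE t. \<forall>z. g p t z = (D v w z + D w v z - D z v w) / 2)"

text \<open>Covariant derivative at \<open>q\<close> in the direction \<open>v \<in> T\<^sub>qN\<close> of a vector field \<open>Y\<close> along \<open>\<iota>\<close>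
  (so that \<open>Y q\<close> is a tangent vector of \<open>M\<close> at \<open>\<iota> q\<close>), for the Levi-Civita connection of \<open>g\<close>.\<close>

definition cov_deriv_along ::
  "('n, 'f::euclidean_space) chart set \<Rightarrow> ('m, 'e::euclidean_space) chart set \<Rightarrow>
   ('n \<Rightarrow> 'm) \<Rightarrow> ('m \<Rightarrow> 'e \<Rightarrow> 'e \<Rightarrow> real) \<Rightarrow> 'n \<Rightarrow> 'f \<Rightarrow> ('n \<Rightarrow> 'e) \<Rightarrow> 'e" where
  "cov_deriv_along B A \<iota> g q v Y =
     (let c = chart_at A (\<iota> q); d = chart_at B q in
      frechet_derivative (\<lambda>u. to_chart A c (\<iota> (cinv d u)) (Y (cinv d u))) (at (cmap d q)) v
      + christoffel A g (\<iota> q) (tangent_map B A \<iota> q v) (Y q))"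

text \<open>Gauss formula: the second fundamental form on \<open>v, w \<in> T\<^sub>qN\<close> is the normal component of the
  covariant derivative along \<open>v\<close> of a tangent field of \<open>N\<close> extending \<open>w\<close>; here the field with
  constant components in the chart \<open>chart_at B q\<close> is used.\<close>

definition second_fundamental_form ::
  "('n, 'f::euclidean_space) chart set \<Rightarrow> ('m, 'e::euclidean_space) chart set \<Rightarrow>
   ('n \<Rightarrow> 'm) \<Rightarrow> ('m \<Rightarrow> 'e \<Rightarrow> 'e \<Rightarrow> real) \<Rightarrow> 'n \<Rightarrow> 'f \<Rightarrow> 'f \<Rightarrow> 'e" where
  "second_fundamental_form B A \<iota> g q v w =
     (let W = (\<lambda>q'. of_chart B (chart_at B q) q' w);
          y = cov_deriv_along B A \<iota> g q v (\<lambda>q'. tangent_map B A \<iota> q' (W q'))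
      in y - tan_part B A \<iota> g q y)"

text \<open>Orthonormal bases of \<open>T\<^sub>qN\<close> for the induced metric.\<close>

definition orthonormal_basis ::
  "('n, 'f::euclidean_space) chart set \<Rightarrow> ('m, 'e::euclidean_space) chart set \<Rightarrow>
   ('n \<Rightarrow> 'm) \<Rightarrow> ('m \<Rightarrow> 'e \<Rightarrow> 'e \<Rightarrow> real) \<Rightarrow> 'n \<Rightarrow> 'f set \<Rightarrow> bool" where
  "orthonormal_basis B A \<iota> g q E \<longleftrightarrow> finite E \<and> span E = UNIV \<and>
     (\<forall>x\<in>E. \<forall>y\<in>E. g (\<iota> q) (tangent_map B A \<iota> q x) (tangent_map B A \<iota> q y) = (if x = y then 1 else 0))"

definition minimal ::
  "('n, 'f::euclidean_space) chart set \<Rightarrow> ('m, 'e::euclidean_space) chart set \<Rightarrow>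
   ('n \<Rightarrow> 'm) \<Rightarrow> ('m \<Rightarrow> 'e \<Rightarrow> 'e \<Rightarrow> real) \<Rightarrow> bool" where
  "minimal B A \<iota> g \<longleftrightarrow>
     (\<forall>q E. orthonormal_basis B A \<iota> g q E \<longrightarrow> (\<Sum>e\<in>E. second_fundamental_form B A \<iota> g q e e) = 0)"


section \<open>Integral curves and angles\<close>

text \<open>\<open>X\<close> is a field along \<open>\<iota>\<close> with values tangent to \<open>N\<close>; its integral curves are curves in \<open>N\<close>,
  defined on open intervals.\<close>

definition integral_curve ::
  "('n::topological_space, 'f::euclidean_space) chart set \<Rightarrow> ('m, 'e::euclidean_space) chart set \<Rightarrow>
   ('n \<Rightarrow> 'm) \<Rightarrow> ('n \<Rightarrow> 'e) \<Rightarrow> real set \<Rightarrow> (real \<Rightarrow> 'n) \<Rightarrow> bool" where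
  "integral_curve B A \<iota> X I \<gamma> \<longleftrightarrow> open I \<and> is_interval I \<and> continuous_on I \<gamma> \<and>
     (\<forall>t\<in>I. \<exists>v. ((\<lambda>s. cmap (chart_at B (\<gamma> t)) (\<gamma> s)) has_vector_derivative v) (at t) \<and>
                tangent_map B A \<iota> (\<gamma> t) v = X (\<gamma> t))"

definition constant_along ::
  "('n::topological_space, 'f::euclidean_space) chart set \<Rightarrow> ('m, 'e::euclidean_space) chart set \<Rightarrow>
   ('n \<Rightarrow> 'm) \<Rightarrow> ('n \<Rightarrow> 'e) \<Rightarrow> ('n \<Rightarrow> real) \<Rightarrow> bool" where
  "constant_along B A \<iota> X \<theta> \<longleftrightarrow>
     (\<forall>I \<gamma>. integral_curve B A \<iota> X I \<gamma> \<longrightarrow> (\<forall>s\<in>I. \<forall>t\<in>I. \<theta> (\<gamma> s) = \<theta> (\<gamma> t)))"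

definition metric_angle :: "('m \<Rightarrow> 'e \<Rightarrow> 'e \<Rightarrow> real) \<Rightarrow> 'm \<Rightarrow> 'e \<Rightarrow> 'e \<Rightarrow> real" where
  "metric_angle g p v w = arccos (g p v w / (sqrt (g p v v) * sqrt (g p w w)))"

end

(* With a = \<alpha>1(Z1T) and b = \<alpha>2(Z1T), invariance of N gives \<phi>(Z1T) = 0, so Z1T = a Z1 + b Z2 with
   a = a^2 + b^2, 0 < a < 1 and b \<noteq> 0, and \<phi> induces on N an almost contact structure \<psi> with kernel spanned
   by Z1T. The cosines of the two angles are sqrt a and b / sqrt a, and (b / sqrt a)^2 = 1 - a; since b has no
   zeros, either angle is constant along a curve iff a is.

   The fundamental form \<Omega>(X,Y) = g(X, \<phi> Y) = d(\<alpha>1 + \<alpha>2)(X,Y) is closed. As for complex submanifolds of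
   almost Kaehler manifolds, d\<Omega>(E, \<phi> E, n) = 0 together with the derivative of the relation
   \<phi>(TN) \<subseteq> TN gives II(E,E) + II(\<phi> E, \<phi> E) = 0 for E in TN orthogonal to Z1T. Hence the trace of II is
   II(Z1T,Z1T) / a. Combinations of Z1 and Z2 with constant coefficients are geodesic, so
   g(II(Z1T,Z1T), n) = (Z1T a) \<alpha>1(n) + (Z1T b) \<alpha>2(n) = (Z1T a) \<alpha>1(n) a / (2 b^2) for normal n, and N is minimal
   iff Z1T a = 0, i.e. iff a is constant along the integral curves of Z1T. These exist through every point
   because Z1T is continuously differentiable in charts of N, as the solution of the normal equations. *)

theory Submission
  imports Defs
begin

text \<open>The chart chosen by \<open>chart_at\<close> may jump from point to point, so everything
  is moved to components in one fixed pair of charts before it is differentiated. The second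
  fundamental form at \<open>q\<close> is defined in the very charts chosen there and can be
  computed in them directly. Closedness of \<Omega>, however, differentiates
  \<open>ext_deriv\<close> across neighbouring points, and this is the reason for
  \<open>ext_deriv_chart\<close>: d does not depend on the chart. Fields on N such as Z1T are known
  only as solutions of linear equations with an injective coefficient map. One derivative of them is
  enough, so the calculus is that of C^1 maps. The connection is only ever tested against a normal
  vector n, which kills the derivatives of such implicitly defined fields, because they enter
  through tangent vectors. The factor a / (2 b^2) has two sources: a = a^2 + b^2, differentiated
  along Z1T, expresses Z1T b by Z1T a, and a \<alpha>1(n) + b \<alpha>2(n) = g(Z1T, n) = 0 expresses
  \<alpha>2(n) by \<alpha>1(n).\<close>

subsection \<open>Continuously differentiable maps\<close>

text \<open>Continuity of the derivative is asked for one direction at a time. On Euclidean spaces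
  this is the usual C^1 notion, and it can be checked without a topology on the space of linear
  maps.\<close>

definition C1_on :: "'a::real_normed_vector set \<Rightarrow> ('a \<Rightarrow> 'b::real_normed_vector) \<Rightarrow> bool" where
  "C1_on S f \<longleftrightarrow> (\<exists>f'. (\<forall>x\<in>S. (f has_derivative f' x) (at x)) \<and> (\<forall>h. continuous_on S (\<lambda>x. f' x h)))"

lemma C1_onI:
  assumes "\<And>x. x \<in> S \<Longrightarrow> (f has_derivative f' x) (at x)" "\<And>h. continuous_on S (\<lambda>x. f' x h)"
  shows "C1_on S f"
  unfolding C1_on_def using assms by blast

lemma C1_onE:
  assumes "C1_on S f"
  obtains f' where "\<And>x. x \<in> S \<Longrightarrow> (f has_derivative f' x) (at x)" "\<And>h. continuous_on S (\<lambda>x. f' x h)"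
  using assms unfolding C1_on_def by blast

lemma C1_on_continuous: "C1_on S f \<Longrightarrow> continuous_on S f"
  unfolding C1_on_def continuous_on_eq_continuous_within
  by (metis has_derivative_continuous has_derivative_at_withinI)

lemma C1_on_differentiable: "C1_on S f \<Longrightarrow> x \<in> S \<Longrightarrow> f differentiable (at x)"
  unfolding C1_on_def differentiable_def by blast

lemma C1_on_cong:
  assumes "open S" "C1_on S f" "\<And>x. x \<in> S \<Longrightarrow> f x = g x"
  shows "C1_on S g"
proof -
  obtain f' where f': "\<And>x. x \<in> S \<Longrightarrow> (f has_derivative f' x) (at x)" "\<And>h. continuous_on S (\<lambda>x. f' x h)"
    using assms(2) by (rule C1_onE) blast
  have "(g has_derivative f' x) (at x)" if "x \<in> S" for x
    using has_derivative_transform_within_open[OF f'(1)[OF that] assms(1) that] assms(3) by blast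
  with f'(2) show ?thesis by (intro C1_onI)
qed

lemma smooth_on_differentiable: "smooth_on S f \<Longrightarrow> x \<in> S \<Longrightarrow> f differentiable (at x)"
  unfolding smooth_on_def by (metis Ck_on.simps(2))

lemma smooth_on_has_derivative:
  "smooth_on S f \<Longrightarrow> x \<in> S \<Longrightarrow> (f has_derivative frechet_derivative f (at x)) (at x)"
  using smooth_on_differentiable frechet_derivative_works by blast

lemma smooth_on_frechet_derivative:
  "smooth_on S f \<Longrightarrow> smooth_on S (\<lambda>x. frechet_derivative f (at x) v)"
  unfolding smooth_on_def by (metis Ck_on.simps(2))

lemma smooth_on_continuous: "smooth_on S f \<Longrightarrow> continuous_on S f"
  unfolding smooth_on_def by (metis Ck_on.simps(1))

lemma smooth_on_C1: "smooth_on S f \<Longrightarrow> C1_on S f"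
  by (rule C1_onI[OF smooth_on_has_derivative])
     (auto intro: smooth_on_continuous smooth_on_frechet_derivative)

lemma C1_on_const: "C1_on S (\<lambda>x. c)"
  by (rule C1_onI[where f' = "\<lambda>x h. 0"]) auto

lemma C1_on_add:
  assumes "C1_on S f" "C1_on S g"
  shows "C1_on S (\<lambda>x. f x + g x)"
proof -
  obtain f' g' where
    "\<And>x. x \<in> S \<Longrightarrow> (f has_derivative f' x) (at x)" "\<And>h. continuous_on S (\<lambda>x. f' x h)"
    "\<And>x. x \<in> S \<Longrightarrow> (g has_derivative g' x) (at x)" "\<And>h. continuous_on S (\<lambda>x. g' x h)"
    using assms unfolding C1_on_def by blast
  then show ?thesis
    by (intro C1_onI[where f' = "\<lambda>x h. f' x h + g' x h"])
       (auto intro!: derivative_intros continuous_intros)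
qed

lemma C1_on_sum:
  assumes "finite I" "\<And>i. i \<in> I \<Longrightarrow> C1_on S (f i)"
  shows "C1_on S (\<lambda>x. \<Sum>i\<in>I. f i x)"
  using assms by (induction I) (auto simp: C1_on_const intro: C1_on_add)

lemma C1_on_scaleR:
  assumes "C1_on S f" "C1_on S g"
  shows "C1_on S (\<lambda>x. f x *\<^sub>R g x)"
proof -
  obtain f' g' where
    f: "\<And>x. x \<in> S \<Longrightarrow> (f has_derivative f' x) (at x)" "\<And>h. continuous_on S (\<lambda>x. f' x h)" and
    g: "\<And>x. x \<in> S \<Longrightarrow> (g has_derivative g' x) (at x)" "\<And>h. continuous_on S (\<lambda>x. g' x h)"
    using assms unfolding C1_on_def by blast
  have "((\<lambda>x. f x *\<^sub>R g x) has_derivative (\<lambda>h. f x *\<^sub>R g' x h + f' x h *\<^sub>R g x)) (at x)" if "x \<in> S" for x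
    using f(1)[OF that] g(1)[OF that] by (auto intro!: derivative_eq_intros)
  then show ?thesis
    using f(2) g(2) C1_on_continuous[OF assms(1)] C1_on_continuous[OF assms(2)]
    by (intro C1_onI[where f' = "\<lambda>x h. f x *\<^sub>R g' x h + f' x h *\<^sub>R g x"]) (auto intro!: continuous_intros)
qed

lemma C1_on_inner:
  assumes "C1_on S f"
  shows "C1_on S (\<lambda>x. f x \<bullet> b)"
proof -
  obtain f' where
    f: "\<And>x. x \<in> S \<Longrightarrow> (f has_derivative f' x) (at x)" "\<And>h. continuous_on S (\<lambda>x. f' x h)"
    using assms unfolding C1_on_def by blast
  then show ?thesis
    by (intro C1_onI[where f' = "\<lambda>x h. f' x h \<bullet> b"]) (auto intro!: derivative_intros continuous_intros)
qed

lemma linear_eq_sum_Basis: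
  fixes F :: "'a::euclidean_space \<Rightarrow> 'b::real_vector"
  assumes "linear F"
  shows "F x = (\<Sum>b\<in>Basis. (x \<bullet> b) *\<^sub>R F b)"
proof -
  interpret linear F by fact
  have "F x = F (\<Sum>b\<in>Basis. (x \<bullet> b) *\<^sub>R b)" by (simp add: euclidean_representation)
  then show ?thesis by (simp add: sum scaleR)
qed

lemma C1_on_compose:
  fixes f :: "'a::real_normed_vector \<Rightarrow> 'b::euclidean_space"
  assumes "C1_on S f" "C1_on T g" "f ` S \<subseteq> T"
  shows "C1_on S (\<lambda>x. g (f x))"
proof -
  obtain f' g' where
    f: "\<And>x. x \<in> S \<Longrightarrow> (f has_derivative f' x) (at x)" "\<And>h. continuous_on S (\<lambda>x. f' x h)" and
    g: "\<And>x. x \<in> T \<Longrightarrow> (g has_derivative g' x) (at x)" "\<And>h. continuous_on T (\<lambda>x. g' x h)"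
    using assms unfolding C1_on_def by blast
  have "((\<lambda>x. g (f x)) has_derivative (\<lambda>h. g' (f x) (f' x h))) (at x)" if "x \<in> S" for x
  proof -
    have "(g has_derivative g' (f x)) (at (f x))" using that assms(3) g(1) by blast
    from diff_chain_at[OF f(1)[OF that] this] show ?thesis by (simp add: o_def)
  qed
  moreover have "continuous_on S (\<lambda>x. g' (f x) (f' x h))" for h
  proof -
    have "continuous_on S (\<lambda>x. \<Sum>b\<in>Basis. (f' x h \<bullet> b) *\<^sub>R g' (f x) b)"
      using f(2) continuous_on_compose2[OF g(2) C1_on_continuous[OF assms(1)] assms(3)]
      by (intro continuous_intros) auto
    moreover have "(\<Sum>b\<in>Basis. (f' x h \<bullet> b) *\<^sub>R g' (f x) b) = g' (f x) (f' x h)" if "x \<in> S" for x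
      using that assms(3) g(1)[of "f x"] by (subst linear_eq_sum_Basis[of "g' (f x)"]) (auto dest: has_derivative_linear)
    ultimately show ?thesis by (simp cong: continuous_on_cong)
  qed
  ultimately show ?thesis by (intro C1_onI)
qed

text \<open>Expanding \<open>m x\<close> in the Euclidean basis turns the family into a finite sum
  of products, so regularity of \<open>F\<close> at fixed vectors is enough.\<close>

lemma C1_on_linear_family:
  fixes F :: "'a::real_normed_vector \<Rightarrow> 'b::euclidean_space \<Rightarrow> 'c::real_normed_vector"
  assumes "open S" "\<And>x. x \<in> S \<Longrightarrow> linear (F x)" "\<And>b. C1_on S (\<lambda>x. F x b)" "C1_on S m"
  shows "C1_on S (\<lambda>x. F x (m x))"
proof (rule C1_on_cong[OF assms(1)])
  show "C1_on S (\<lambda>x. \<Sum>b\<in>Basis. (m x \<bullet> b) *\<^sub>R F x b)"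
    by (intro C1_on_sum C1_on_scaleR C1_on_inner assms) auto
qed (auto simp: linear_eq_sum_Basis[symmetric] assms)

lemma linear_frechet_derivative_family:
  fixes F :: "'a::real_normed_vector \<Rightarrow> 'b::real_vector \<Rightarrow> 'c::real_normed_vector"
  assumes "open S" "x \<in> S" "\<And>y. y \<in> S \<Longrightarrow> linear (F y)"
    and "\<And>v. (\<lambda>y. F y v) differentiable (at x)"
  shows "linear (\<lambda>v. frechet_derivative (\<lambda>y. F y v) (at x) h)"
proof
  have d: "((\<lambda>y. F y v) has_derivative frechet_derivative (\<lambda>y. F y v) (at x)) (at x)" for v
    using assms(4) frechet_derivative_works by blast
  fix v w :: 'b and r :: real
  have "((\<lambda>y. F y (v + w)) has_derivative
      (\<lambda>h. frechet_derivative (\<lambda>y. F y v) (at x) h + frechet_derivative (\<lambda>y. F y w) (at x) h)) (at x)"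
    by (rule has_derivative_transform_within_open[OF has_derivative_add[OF d d] assms(1,2)])
       (simp add: assms(3) linear_add)
  then show "frechet_derivative (\<lambda>y. F y (v + w)) (at x) h =
      frechet_derivative (\<lambda>y. F y v) (at x) h + frechet_derivative (\<lambda>y. F y w) (at x) h"
    by (rule fun_cong[OF frechet_derivative_at[symmetric]])
  have "((\<lambda>y. F y (r *\<^sub>R v)) has_derivative
      (\<lambda>h. r *\<^sub>R frechet_derivative (\<lambda>y. F y v) (at x) h)) (at x)"
    by (rule has_derivative_transform_within_open[OF has_derivative_scaleR_right[OF d] assms(1,2)])
       (simp add: assms(3) linear_scale)
  then show "frechet_derivative (\<lambda>y. F y (r *\<^sub>R v)) (at x) h =
      r *\<^sub>R frechet_derivative (\<lambda>y. F y v) (at x) h"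
    by (rule fun_cong[OF frechet_derivative_at[symmetric]])
qed

text \<open>Product rule for a matrix times a vector. The regularity of \<open>F\<close> is known
  entry by entry, so the basis expansion is differentiated and then reassembled; this works because
  the derivative of \<open>F y v\<close> is again linear in \<open>v\<close>.\<close>

lemma has_derivative_linear_family:
  fixes F :: "'a::real_normed_vector \<Rightarrow> 'b::euclidean_space \<Rightarrow> 'c::real_normed_vector"
  assumes "open S" "x \<in> S" "\<And>y. y \<in> S \<Longrightarrow> linear (F y)"
    and F: "\<And>v. (\<lambda>y. F y v) differentiable (at x)"
    and m: "(m has_derivative m') (at x)"
  shows "((\<lambda>y. F y (m y)) has_derivative
           (\<lambda>h. frechet_derivative (\<lambda>y. F y (m x)) (at x) h + F x (m' h))) (at x)"
proof -
  have d: "((\<lambda>y. F y v) has_derivative frechet_derivative (\<lambda>y. F y v) (at x)) (at x)" for v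
    using F frechet_derivative_works by blast
  have "((\<lambda>y. \<Sum>b\<in>Basis. (m y \<bullet> b) *\<^sub>R F y b) has_derivative
     (\<lambda>h. \<Sum>b\<in>Basis. (m x \<bullet> b) *\<^sub>R frechet_derivative (\<lambda>y. F y b) (at x) h + (m' h \<bullet> b) *\<^sub>R F x b)) (at x)"
    by (auto intro!: derivative_eq_intros d m)
  also have "(\<lambda>h. \<Sum>b\<in>Basis. (m x \<bullet> b) *\<^sub>R frechet_derivative (\<lambda>y. F y b) (at x) h + (m' h \<bullet> b) *\<^sub>R F x b)
     = (\<lambda>h. frechet_derivative (\<lambda>y. F y (m x)) (at x) h + F x (m' h))"
  proof -
    have 1: "frechet_derivative (\<lambda>y. F y (m x)) (at x) h
        = (\<Sum>b\<in>Basis. (m x \<bullet> b) *\<^sub>R frechet_derivative (\<lambda>y. F y b) (at x) h)" for h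
      by (rule linear_eq_sum_Basis[OF linear_frechet_derivative_family[OF assms(1-4)]])
    have 2: "F x (m' h) = (\<Sum>b\<in>Basis. (m' h \<bullet> b) *\<^sub>R F x b)" for h
      by (rule linear_eq_sum_Basis[OF assms(3)[OF assms(2)]])
    show ?thesis
      by (rule ext, subst 1, subst 2, rule sum.distrib)
  qed
  finally show ?thesis
    by (rule has_derivative_transform_within_open[OF _ assms(1,2)])
       (simp add: linear_eq_sum_Basis[symmetric] assms(3))
qed

lemma has_derivative_bilinear_family:
  fixes F :: "'a::real_normed_vector \<Rightarrow> 'b::euclidean_space \<Rightarrow> 'c::euclidean_space \<Rightarrow> 'd::real_normed_vector"
  assumes "open S" "x \<in> S" "\<And>y. y \<in> S \<Longrightarrow> bilinear (F y)"
    and F: "\<And>v w. (\<lambda>y. F y v w) differentiable (at x)"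
    and m: "(m has_derivative m') (at x)" and n: "(n has_derivative n') (at x)"
  shows "((\<lambda>y. F y (m y) (n y)) has_derivative
      (\<lambda>h. frechet_derivative (\<lambda>y. F y (m x) (n x)) (at x) h + F x (m x) (n' h) + F x (m' h) (n x))) (at x)"
proof -
  have 1: "((\<lambda>y. F y v (n y)) has_derivative
      (\<lambda>h. frechet_derivative (\<lambda>y. F y v (n x)) (at x) h + F x v (n' h))) (at x)" for v
    using assms(3) by (intro has_derivative_linear_family[OF assms(1,2) _ F n]) (auto simp: bilinear_def)
  then have 2: "frechet_derivative (\<lambda>y. F y v (n y)) (at x)
      = (\<lambda>h. frechet_derivative (\<lambda>y. F y v (n x)) (at x) h + F x v (n' h))" for v
    by (rule frechet_derivative_at[symmetric])
  have "((\<lambda>y. F y (m y) (n y)) has_derivative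
      (\<lambda>h. frechet_derivative (\<lambda>y. F y (m x) (n y)) (at x) h + F x (m' h) (n x))) (at x)"
    using 1 assms(3)
    by (intro has_derivative_linear_family[OF assms(1,2) _ _ m, where F = "\<lambda>y v. F y v (n y)"])
       (auto simp: bilinear_def differentiable_def)
  then show ?thesis by (simp add: 2)
qed

subsection \<open>Symmetry of the second derivative\<close>

text \<open>Two mean value theorems: the first in direction \<open>v\<close> for the increment in
  direction \<open>w\<close>, the second in direction \<open>w\<close> for the derivative along
  \<open>v\<close>. The bound on \<open>dist x p\<close> makes \<open>p\<close> tend to
  \<open>x\<close> with \<open>t\<close>.\<close>

lemma second_difference_eq:
  fixes f :: "'a::real_normed_vector \<Rightarrow> real"
  assumes f: "\<And>y. y \<in> ball x r \<Longrightarrow> f differentiable (at y)"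
    and f2: "\<And>y. y \<in> ball x r \<Longrightarrow> (\<lambda>z. frechet_derivative f (at z) v) differentiable (at y)"
    and t: "t > 0" "t * (norm v + norm w) < r"
  shows "\<exists>p. dist x p \<le> t * (norm v + norm w) \<and>
    f (x + t *\<^sub>R v + t *\<^sub>R w) - f (x + t *\<^sub>R v) - (f (x + t *\<^sub>R w) - f x)
      = t * (t * frechet_derivative (\<lambda>z. frechet_derivative f (at z) v) (at p) w)"
proof -
  have near: "dist x (x + a *\<^sub>R v + b *\<^sub>R w) \<le> t * (norm v + norm w)" if "0 \<le> a" "a \<le> t" "0 \<le> b" "b \<le> t" for a b
  proof -
    have "norm (a *\<^sub>R v + b *\<^sub>R w) \<le> a * norm v + b * norm w"
      using that norm_triangle_ineq[of "a *\<^sub>R v" "b *\<^sub>R w"] by simp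
    also have "\<dots> \<le> t * norm v + t * norm w" using that by (intro add_mono mult_right_mono) auto
    finally have "norm (a *\<^sub>R v + b *\<^sub>R w) \<le> t * (norm v + norm w)" by (simp add: distrib_left)
    then show ?thesis by (metis add.assoc add_diff_cancel_left' dist_commute dist_norm)
  qed
  have inb: "x + a *\<^sub>R v + b *\<^sub>R w \<in> ball x r" if "0 \<le> a" "a \<le> t" "0 \<le> b" "b \<le> t" for a b
    using near[OF that] t by simp
  let ?D = "\<lambda>z. frechet_derivative f (at z) v"
  have d1: "((\<lambda>s. f (x + s *\<^sub>R v + b *\<^sub>R w)) has_real_derivative ?D (x + a *\<^sub>R v + b *\<^sub>R w)) (at a)"
    if "0 \<le> a" "a \<le> t" "0 \<le> b" "b \<le> t" for a b
  proof -
    have *: "((\<lambda>s. x + s *\<^sub>R v + b *\<^sub>R w) has_derivative (\<lambda>h. h *\<^sub>R v)) (at a)"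
      by (auto intro!: derivative_eq_intros)
    have **: "(f has_derivative frechet_derivative f (at (x + a *\<^sub>R v + b *\<^sub>R w))) (at (x + a *\<^sub>R v + b *\<^sub>R w))"
      using f[OF inb[OF that]] frechet_derivative_works by blast
    from diff_chain_at[OF * **] show ?thesis
      unfolding has_field_derivative_def o_def
      by (rule back_subst[where P = "\<lambda>D. (_ has_derivative D) _"])
         (auto simp: linear_frechet_derivative linear_scale f[OF inb[OF that]])
  qed
  have d2: "((\<lambda>s. ?D (x + a *\<^sub>R v + s *\<^sub>R w)) has_real_derivative
      frechet_derivative ?D (at (x + a *\<^sub>R v + b *\<^sub>R w)) w) (at b)"
    if "0 \<le> a" "a \<le> t" "0 \<le> b" "b \<le> t" for a b
  proof -
    have *: "((\<lambda>s. x + a *\<^sub>R v + s *\<^sub>R w) has_derivative (\<lambda>h. h *\<^sub>R w)) (at b)"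
      by (auto intro!: derivative_eq_intros)
    have **: "(?D has_derivative frechet_derivative ?D (at (x + a *\<^sub>R v + b *\<^sub>R w))) (at (x + a *\<^sub>R v + b *\<^sub>R w))"
      using f2[OF inb[OF that]] frechet_derivative_works by blast
    from diff_chain_at[OF * **] show ?thesis
      unfolding has_field_derivative_def o_def
      by (rule back_subst[where P = "\<lambda>D. (_ has_derivative D) _"])
         (auto simp: linear_frechet_derivative linear_scale f2[OF inb[OF that]])
  qed
  have "\<exists>a>0. a < t \<and> (f (x + t *\<^sub>R v + t *\<^sub>R w) - f (x + t *\<^sub>R v + 0 *\<^sub>R w))
        - (f (x + 0 *\<^sub>R v + t *\<^sub>R w) - f (x + 0 *\<^sub>R v + 0 *\<^sub>R w))
      = (t - 0) * (?D (x + a *\<^sub>R v + t *\<^sub>R w) - ?D (x + a *\<^sub>R v + 0 *\<^sub>R w))"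
    using t(1) d1[of _ 0] d1[of _ t] by (intro MVT2[where f = "\<lambda>s. f (x + s *\<^sub>R v + t *\<^sub>R w) - f (x + s *\<^sub>R v + 0 *\<^sub>R w)"] DERIV_diff) auto
  then obtain a where a: "0 < a" "a < t" "f (x + t *\<^sub>R v + t *\<^sub>R w) - f (x + t *\<^sub>R v) - (f (x + t *\<^sub>R w) - f x)
      = t * (?D (x + a *\<^sub>R v + t *\<^sub>R w) - ?D (x + a *\<^sub>R v))"
    by auto
  have "\<exists>b>0. b < t \<and> ?D (x + a *\<^sub>R v + t *\<^sub>R w) - ?D (x + a *\<^sub>R v + 0 *\<^sub>R w)
      = (t - 0) * frechet_derivative ?D (at (x + a *\<^sub>R v + b *\<^sub>R w)) w"
    using t(1) a d2 by (intro MVT2) auto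
  then obtain b where b: "0 < b" "b < t" "?D (x + a *\<^sub>R v + t *\<^sub>R w) - ?D (x + a *\<^sub>R v)
      = t * frechet_derivative ?D (at (x + a *\<^sub>R v + b *\<^sub>R w)) w" by auto
  show ?thesis
    using a b near[of a b] by (intro exI[of _ "x + a *\<^sub>R v + b *\<^sub>R w"]) auto
qed

text \<open>The second difference is symmetric in \<open>v\<close> and \<open>w\<close>. Hence one
  mixed derivative at some \<open>p\<close> equals the other at some \<open>q\<close>, with both
  points as close to \<open>x\<close> as desired, and continuity carries this to
  \<open>x\<close>.\<close>

lemma second_derivative_symmetric_real:
  fixes f :: "'a::real_normed_vector \<Rightarrow> real"
  assumes S: "open S" "x \<in> S" and f: "smooth_on S f"
  shows "frechet_derivative (\<lambda>y. frechet_derivative f (at y) v) (at x) w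
       = frechet_derivative (\<lambda>y. frechet_derivative f (at y) w) (at x) v"
proof (rule ccontr)
  define P where "P = (\<lambda>z. frechet_derivative (\<lambda>y. frechet_derivative f (at y) v) (at z) w)"
  define Q where "Q = (\<lambda>z. frechet_derivative (\<lambda>y. frechet_derivative f (at y) w) (at z) v)"
  assume "\<not> ?thesis"
  then have ne: "P x \<noteq> Q x" by (simp add: P_def Q_def)
  \<comment> \<open>Half the gap: a common value cannot be within \<open>e\<close> of both
    \<open>P x\<close> and \<open>Q x\<close>.\<close>
  define e where "e = \<bar>P x - Q x\<bar> / 2"
  have e: "e > 0" using ne by (simp add: e_def)
  have c: "continuous_on S P" "continuous_on S Q"
    unfolding P_def Q_def by (intro smooth_on_continuous smooth_on_frechet_derivative f)+
  obtain r0 where r0: "r0 > 0" "ball x r0 \<subseteq> S" using S openE by blast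
  obtain r1 where r1: "r1 > 0" "\<And>y. y \<in> S \<Longrightarrow> dist y x < r1 \<Longrightarrow> dist (P y) (P x) < e"
    using c(1) S(2) e unfolding continuous_on_iff by metis
  obtain r2 where r2: "r2 > 0" "\<And>y. y \<in> S \<Longrightarrow> dist y x < r2 \<Longrightarrow> dist (Q y) (Q x) < e"
    using c(2) S(2) e unfolding continuous_on_iff by metis
  define r where "r = min r0 (min r1 r2)"
  have r: "r > 0" "r \<le> r0" "r \<le> r1" "r \<le> r2" using r0 r1 r2 by (auto simp: r_def)
  \<comment> \<open>The added 1 keeps the denominator positive when \<open>v\<close> and
    \<open>w\<close> both vanish.\<close>
  define t where "t = r / 2 * inverse (norm v + norm w + 1)"
  have t: "t > 0" "t * (norm v + norm w) < r"
  proof -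
    have "norm v + norm w + 1 > 0" by (simp add: add_nonneg_pos)
    then show "t > 0" using r by (simp add: t_def)
    have "t * (norm v + norm w) \<le> t * (norm v + norm w + 1)" using \<open>t > 0\<close> by simp
    also have "\<dots> = r / 2" using \<open>norm v + norm w + 1 > 0\<close> unfolding t_def mult.assoc by (subst left_inverse) auto
    finally show "t * (norm v + norm w) < r" using r by simp
  qed
  have sub: "y \<in> S" if "y \<in> ball x r" for y using that r r0 by auto
  note f' = smooth_on_differentiable[OF f sub]
    smooth_on_differentiable[OF smooth_on_frechet_derivative[OF f] sub]
  obtain p where p: "dist x p \<le> t * (norm v + norm w)"
    "f (x + t *\<^sub>R v + t *\<^sub>R w) - f (x + t *\<^sub>R v) - (f (x + t *\<^sub>R w) - f x) = t * (t * P p)"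
    using second_difference_eq[of x r f v t w, OF f' t] unfolding P_def by blast
  obtain q where q: "dist x q \<le> t * (norm w + norm v)"
    "f (x + t *\<^sub>R w + t *\<^sub>R v) - f (x + t *\<^sub>R w) - (f (x + t *\<^sub>R v) - f x) = t * (t * Q q)"
    using second_difference_eq[of x r f w t v, OF f'] t unfolding Q_def by (auto simp: add.commute)
  have "t * (t * P p) = t * (t * Q q)" using p(2) q(2) by (simp add: algebra_simps)
  then have "P p = Q q" using t by simp
  moreover have "dist (P p) (P x) < e" "dist (Q q) (Q x) < e"
    using p(1) q(1) t(2) r r1(2)[of p] r2(2)[of q] sub[of p] sub[of q] by (auto simp: dist_commute add.commute)
  ultimately show False using e_def by (auto simp: dist_real_def abs_if split: if_splits)
qed

lemma frechet_derivative_inner: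
  assumes "f differentiable (at x)"
  shows "frechet_derivative (\<lambda>y. f y \<bullet> b) (at x) h = frechet_derivative f (at x) h \<bullet> b"
proof -
  have "(f has_derivative frechet_derivative f (at x)) (at x)" using assms frechet_derivative_works by blast
  from frechet_derivative_at[OF has_derivative_inner_left[OF this, of b]] show ?thesis by metis
qed

lemma Ck_on_cong:
  assumes "open S" "\<And>x. x \<in> S \<Longrightarrow> f x = g x" "Ck_on k S f"
  shows "Ck_on k S g"
  using assms(2,3)
proof (induction k arbitrary: f g)
  case 0
  then show ?case by (simp cong: continuous_on_cong)
next
  case (Suc k)
  have d: "(g has_derivative frechet_derivative f (at x)) (at x)" if "x \<in> S" for x
  proof -
    have "f differentiable (at x)" using Suc.prems(2) that by simp
    then have "(f has_derivative frechet_derivative f (at x)) (at x)"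
      using frechet_derivative_works by blast
    from has_derivative_transform_within_open[OF this assms(1) that Suc.prems(1)] show ?thesis .
  qed
  have eq: "frechet_derivative f (at x) = frechet_derivative g (at x)" if "x \<in> S" for x
    by (rule frechet_derivative_at[OF d[OF that]])
  have "Ck_on k S (\<lambda>x. frechet_derivative g (at x) v)" for v
  proof (rule Suc.IH)
    show "Ck_on k S (\<lambda>x. frechet_derivative f (at x) v)" using Suc.prems(2) by simp
  qed (simp only: eq)
  with d show ?case unfolding Ck_on.simps by (blast intro: differentiableI)
qed

lemma smooth_on_inner:
  assumes "open S" "smooth_on S f"
  shows "smooth_on S (\<lambda>x. f x \<bullet> b)"
proof -
  have "Ck_on k S f \<Longrightarrow> Ck_on k S (\<lambda>x. f x \<bullet> b)" for k
  proof (induction k arbitrary: f)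
    case 0
    then show ?case by (auto intro: continuous_intros)
  next
    case (Suc k)
    have "Ck_on k S (\<lambda>x. frechet_derivative (\<lambda>y. f y \<bullet> b) (at x) v)" for v
    proof (rule Ck_on_cong[OF assms(1)])
      show "Ck_on k S (\<lambda>x. frechet_derivative f (at x) v \<bullet> b)" using Suc by simp
    qed (use Suc.prems in \<open>auto simp: frechet_derivative_inner\<close>)
    with Suc.prems show ?case by auto
  qed
  with assms show ?thesis by (simp add: smooth_on_def)
qed

lemma second_derivative_symmetric:
  fixes f :: "'a::real_normed_vector \<Rightarrow> 'b::euclidean_space"
  assumes S: "open S" "x \<in> S" and f: "smooth_on S f"
  shows "frechet_derivative (\<lambda>y. frechet_derivative f (at y) v) (at x) w
       = frechet_derivative (\<lambda>y. frechet_derivative f (at y) w) (at x) v"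
proof (rule euclidean_eqI)
  fix b :: 'b
  have eq: "frechet_derivative (\<lambda>y. frechet_derivative f (at y) v) (at x) w \<bullet> b
     = frechet_derivative (\<lambda>y. frechet_derivative (\<lambda>z. f z \<bullet> b) (at y) v) (at x) w" for v w
  proof -
    have "((\<lambda>y. frechet_derivative f (at y) v \<bullet> b) has_derivative
        (\<lambda>h. frechet_derivative (\<lambda>y. frechet_derivative f (at y) v) (at x) h \<bullet> b)) (at x)"
      by (intro has_derivative_inner_left smooth_on_has_derivative[OF smooth_on_frechet_derivative[OF f] S(2)])
    then have "((\<lambda>y. frechet_derivative (\<lambda>z. f z \<bullet> b) (at y) v) has_derivative
        (\<lambda>h. frechet_derivative (\<lambda>y. frechet_derivative f (at y) v) (at x) h \<bullet> b)) (at x)"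
      by (rule has_derivative_transform_within_open[OF _ S])
         (simp add: frechet_derivative_inner smooth_on_differentiable[OF f])
    from frechet_derivative_at[OF this] show ?thesis by metis
  qed
  show "frechet_derivative (\<lambda>y. frechet_derivative f (at y) v) (at x) w \<bullet> b
     = frechet_derivative (\<lambda>y. frechet_derivative f (at y) w) (at x) v \<bullet> b"
    unfolding eq by (rule second_derivative_symmetric_real[OF S smooth_on_inner[OF S(1) f]])
qed

lemma C1_on_has_derivative:
  "C1_on S f \<Longrightarrow> x \<in> S \<Longrightarrow> (f has_derivative frechet_derivative f (at x)) (at x)"
  using C1_on_differentiable frechet_derivative_works by blast

lemma C1_on_frechet_derivative_continuous:
  assumes "C1_on S f"
  shows "continuous_on S (\<lambda>x. frechet_derivative f (at x) h)"
proof -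
  obtain f' where f': "\<And>x. x \<in> S \<Longrightarrow> (f has_derivative f' x) (at x)" "\<And>h. continuous_on S (\<lambda>x. f' x h)"
    using assms by (rule C1_onE) blast
  have "f' x = frechet_derivative f (at x)" if "x \<in> S" for x
    using frechet_derivative_at[OF f'(1)[OF that]] .
  with f'(2)[of h] show ?thesis by (simp cong: continuous_on_cong)
qed

subsection \<open>Regularity of solutions of linear equations\<close>

text \<open>An injective linear map is bounded below, and a small perturbation keeps half of the
  bound. The map \<open>K x\<close> may fail to be square, so equations \<open>df u y = w\<close>
  with \<open>w\<close> in the range of \<open>df u\<close> are covered.\<close>

lemma continuous_on_linear_solution:
  fixes K :: "'a::real_normed_vector \<Rightarrow> 'b::euclidean_space \<Rightarrow> 'c::euclidean_space"
  assumes K: "\<And>x. x \<in> S \<Longrightarrow> linear (K x)" "\<And>x. x \<in> S \<Longrightarrow> inj (K x)"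
    and cont: "\<And>b. continuous_on S (\<lambda>x. K x b)" "continuous_on S z"
    and eq: "\<And>x. x \<in> S \<Longrightarrow> K x (y x) = z x"
  shows "continuous_on S y"
  unfolding continuous_on_def
proof
  fix x0 assume x0: "x0 \<in> S"
  obtain c where c: "c > 0" "\<And>v. c * norm v \<le> norm (K x0 v)"
    using linear_inj_bounded_below_pos[OF K(1,2)[OF x0]] by blast
  \<comment> \<open>A bound for the operator norm of \<open>K x - K x0\<close> through its values on
    the basis.\<close>
  define \<kappa> where "\<kappa> x = (\<Sum>b\<in>Basis. norm (K x b - K x0 b))" for x
  have "((\<lambda>x. K x b - K x0 b) \<longlongrightarrow> 0) (at x0 within S)" for b
    using cont(1) x0 by (intro LIM_zero) (auto simp: continuous_on_def)
  then have "(\<kappa> \<longlongrightarrow> (\<Sum>b\<in>(Basis::'b set). 0)) (at x0 within S)"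
    unfolding \<kappa>_def by (intro tendsto_sum tendsto_norm_zero)
  then have \<kappa>0: "(\<kappa> \<longlongrightarrow> 0) (at x0 within S)" by simp
  have \<kappa>: "norm (K x v - K x0 v) \<le> \<kappa> x * norm v" if "x \<in> S" for x v
  proof -
    have l: "linear (\<lambda>v. K x v - K x0 v)" using K(1) x0 that by (intro linear_compose_sub) auto
    have "norm (K x v - K x0 v) = norm (\<Sum>b\<in>Basis. (v \<bullet> b) *\<^sub>R (K x b - K x0 b))"
      by (rule arg_cong[where f = norm, OF linear_eq_sum_Basis[OF l]])
    also have "\<dots> \<le> (\<Sum>b\<in>Basis. norm v * norm (K x b - K x0 b))"
      by (intro sum_norm_le) (auto intro!: mult_right_mono simp: Basis_le_norm)
    finally show ?thesis by (simp add: \<kappa>_def sum_distrib_left mult.commute)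
  qed
  have ineq: "norm (y x - y x0) \<le> (2 / c) * (norm (z x - z x0) + \<kappa> x * norm (y x0))" if "x \<in> S" "\<kappa> x < c / 2" for x
  proof -
    let ?r = "y x - y x0"
    \<comment> \<open>Of the three terms on the right, the one with \<open>?r\<close> is at most
      \<open>c / 2\<close> times \<open>norm ?r\<close> and is absorbed on the left.\<close>
    have "K x0 ?r = (z x - z x0) - (K x ?r - K x0 ?r) - (K x (y x0) - K x0 (y x0))"
      using K(1)[OF that(1)] K(1)[OF x0] eq[OF that(1)] eq[OF x0] by (simp add: linear_diff)
    then have "norm (K x0 ?r) \<le> norm (z x - z x0) + norm (K x ?r - K x0 ?r) + norm (K x (y x0) - K x0 (y x0))"
      by (rule ord_eq_le_trans[OF arg_cong[where f = norm]
            order_trans[OF norm_triangle_ineq4 add_right_mono[OF norm_triangle_ineq4]]])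
    also have "\<dots> \<le> norm (z x - z x0) + \<kappa> x * norm ?r + \<kappa> x * norm (y x0)"
      using \<kappa>[OF that(1)] by (intro add_mono) auto
    also have "\<dots> \<le> norm (z x - z x0) + (c / 2) * norm ?r + \<kappa> x * norm (y x0)"
      using that(2) by (intro add_mono mult_right_mono) auto
    finally have "(c / 2) * norm ?r \<le> norm (z x - z x0) + \<kappa> x * norm (y x0)"
      using c(2)[of ?r] by simp
    then show ?thesis using c(1) by (simp add: field_simps)
  qed
  have ev: "eventually (\<lambda>x. \<kappa> x < c / 2) (at x0 within S)"
    using order_tendstoD(2)[OF \<kappa>0, of "c / 2"] c(1) by simp
  have "((\<lambda>x. y x - y x0) \<longlongrightarrow> 0) (at x0 within S)"
  proof (rule Lim_null_comparison)
    show "\<forall>\<^sub>F x in at x0 within S. norm (y x - y x0) \<le> (2 / c) * (norm (z x - z x0) + \<kappa> x * norm (y x0))"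
      using ev unfolding eventually_at_filter by (rule eventually_mono) (use ineq in auto)
    have "((\<lambda>x. z x - z x0) \<longlongrightarrow> 0) (at x0 within S)"
      using cont(2) x0 by (intro LIM_zero) (auto simp: continuous_on_def)
    then have "((\<lambda>x. (2 / c) * (norm (z x - z x0) + \<kappa> x * norm (y x0))) \<longlongrightarrow> (2 / c) * (norm (0::'c) + 0 * norm (y x0))) (at x0 within S)"
      by (intro tendsto_intros \<kappa>0)
    then show "((\<lambda>x. (2 / c) * (norm (z x - z x0) + \<kappa> x * norm (y x0))) \<longlongrightarrow> 0) (at x0 within S)" by simp
  qed
  then show "(y \<longlongrightarrow> y x0) (at x0 within S)" by (rule LIM_zero_cancel)
qed

text \<open>Near its zero, \<open>k\<close> is O(|x - x0|), and a factor that merely tends to 0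
  makes this o(|x - x0|). In the application \<open>\<rho>\<close> is a component of a solution
  known to be continuous only.\<close>

lemma has_derivative_scaleR_vanishing:
  fixes k :: "'a::real_normed_vector \<Rightarrow> 'b::real_normed_vector"
  assumes \<rho>: "(\<rho> \<longlongrightarrow> 0) (at x0)" "\<rho> x0 = 0" and k: "(k has_derivative k') (at x0)" "k x0 = 0"
  shows "((\<lambda>x. \<rho> x *\<^sub>R k x) has_derivative (\<lambda>h. 0)) (at x0)"
  unfolding has_derivative_within
proof (intro conjI bounded_linear_zero)
  let ?q = "\<lambda>x. (1 / norm (x - x0)) *\<^sub>R (k x - (k x0 + k' (x - x0)))"
  have q: "(?q \<longlongrightarrow> 0) (at x0)" and bl: "bounded_linear k'"
    using k(1) unfolding has_derivative_within by auto
  obtain C where C: "\<And>h. norm (k' h) \<le> norm h * C" using bounded_linear.bounded[OF bl] by blast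
  have "((\<lambda>x. \<rho> x *\<^sub>R ?q x) \<longlongrightarrow> 0 *\<^sub>R 0) (at x0)"
    by (intro tendsto_scaleR \<rho> q)
  moreover have "((\<lambda>x. \<rho> x *\<^sub>R (1 / norm (x - x0)) *\<^sub>R k' (x - x0)) \<longlongrightarrow> 0) (at x0)"
  proof (rule Lim_null_comparison)
    have "norm (\<rho> x *\<^sub>R (1 / norm (x - x0)) *\<^sub>R k' (x - x0)) \<le> \<bar>\<rho> x\<bar> * C" if "x \<noteq> x0" for x
      using mult_left_mono[OF C[of "x - x0"], of "\<bar>\<rho> x\<bar>"] that
      by (simp add: field_simps)
    then show "\<forall>\<^sub>F x in at x0. norm (\<rho> x *\<^sub>R (1 / norm (x - x0)) *\<^sub>R k' (x - x0)) \<le> \<bar>\<rho> x\<bar> * C"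
      by (auto simp: eventually_at_filter)
    show "((\<lambda>x. \<bar>\<rho> x\<bar> * C) \<longlongrightarrow> 0) (at x0)"
      using \<rho>(1) by (intro tendsto_mult_left_zero tendsto_rabs_zero)
  qed
  ultimately have "((\<lambda>x. \<rho> x *\<^sub>R ?q x + \<rho> x *\<^sub>R (1 / norm (x - x0)) *\<^sub>R k' (x - x0)) \<longlongrightarrow> 0) (at x0)"
    using tendsto_add by fastforce
  then show "((\<lambda>y. (1 / norm (y - x0)) *\<^sub>R (\<rho> y *\<^sub>R k y - (\<rho> x0 *\<^sub>R k x0 + 0))) \<longlongrightarrow> 0) (at x0)"
    by (simp add: \<rho>(2) k(2) algebra_simps)
qed

text \<open>With a left inverse \<open>L\<close> of \<open>K x0\<close>, the solution becomes an
  explicit expression in \<open>z x\<close> and \<open>K x (y x0)\<close> plus error terms. Each of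
  these is a component of \<open>y x - y x0\<close> times a differentiable function vanishing at
  \<open>x0\<close>, hence has derivative 0.\<close>

lemma has_derivative_linear_solution:
  fixes K :: "'a::real_normed_vector \<Rightarrow> 'b::euclidean_space \<Rightarrow> 'c::euclidean_space"
  assumes S: "open S" "x0 \<in> S" and K: "\<And>x. x \<in> S \<Longrightarrow> linear (K x)" "inj (K x0)"
    and d: "\<And>b. (\<lambda>x. K x b) differentiable (at x0)" "z differentiable (at x0)"
    and y: "continuous_on S y" and eq: "\<And>x. x \<in> S \<Longrightarrow> K x (y x) = z x"
  shows "y differentiable (at x0)"
proof -
  obtain L where L: "linear L" "L \<circ> K x0 = id"
    using linear_injective_left_inverse[OF K(1)[OF S(2)] K(2)] by blast
  have LK: "L (K x0 v) = v" for v using L(2) by (metis comp_apply id_apply)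
  define r where "r x = y x - y x0" for x
  have "(y \<longlongrightarrow> y x0) (at x0)"
    using continuous_on_eq_continuous_at[OF S(1)] y S(2) unfolding isCont_def by blast
  then have rlim: "(r \<longlongrightarrow> 0) (at x0)" unfolding r_def by (rule LIM_zero)
  have dL: "(\<lambda>x. L (f x)) differentiable (at x0)" if "f differentiable (at x0)" for f
    using differentiable_compose[OF linear_imp_differentiable[OF L(1)] that] .
  have rb: "((\<lambda>x. r x \<bullet> b) \<longlongrightarrow> 0) (at x0)" for b
    using tendsto_inner[OF rlim tendsto_const, of b] by simp
  have d2: "(\<lambda>x. L (K x b - K x0 b)) differentiable (at x0)" for b
    using d(1) by (intro dL differentiable_diff) auto
  have "(\<lambda>x. (r x \<bullet> b) *\<^sub>R L (K x b - K x0 b)) differentiable (at x0)" for b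
  proof -
    obtain k' where "((\<lambda>x. L (K x b - K x0 b)) has_derivative k') (at x0)"
      using d2 unfolding differentiable_def by blast
    from has_derivative_scaleR_vanishing[OF rb _ this]
    have "((\<lambda>x. (r x \<bullet> b) *\<^sub>R L (K x b - K x0 b)) has_derivative (\<lambda>h. 0)) (at x0)"
      using L(1) by (simp add: r_def linear_0)
    then show ?thesis unfolding differentiable_def by blast
  qed
  then have "(\<lambda>x. y x0 + L (z x - K x (y x0)) - (\<Sum>b\<in>Basis. (r x \<bullet> b) *\<^sub>R L (K x b - K x0 b)))
      differentiable (at x0)"
    using d by (intro differentiable_add differentiable_diff differentiable_sum dL) auto
  then obtain D where D: "((\<lambda>x. y x0 + L (z x - K x (y x0)) - (\<Sum>b\<in>Basis. (r x \<bullet> b) *\<^sub>R L (K x b - K x0 b)))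
      has_derivative D) (at x0)" unfolding differentiable_def by blast
  have e: "y x0 + L (z x - K x (y x0)) - (\<Sum>b\<in>Basis. (r x \<bullet> b) *\<^sub>R L (K x b - K x0 b)) = y x" if x: "x \<in> S" for x
  proof -
    have l: "linear (\<lambda>v. L (K x v - K x0 v))"
      using linear_compose[OF linear_compose_sub[OF K(1)[OF x] K(1)[OF S(2)]] L(1)] by (simp add: o_def)
    have "(\<Sum>b\<in>Basis. (r x \<bullet> b) *\<^sub>R L (K x b - K x0 b)) = L (K x (r x) - K x0 (r x))"
      by (rule linear_eq_sum_Basis[OF l, symmetric])
    also have "\<dots> = L (z x - K x (y x0)) - (y x - y x0)"
      using eq[OF x] K(1)[OF x] LK by (simp add: r_def linear_diff[OF L(1)] linear_diff[OF K(1)[OF x]])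
    finally show ?thesis by simp
  qed
  from has_derivative_transform_within_open[OF D S e] show ?thesis
    unfolding differentiable_def by blast
qed

text \<open>Differentiating \<open>K x (y x) = z x\<close> shows that each directional derivative of
  \<open>y\<close> solves a linear equation with the same \<open>K\<close> and a continuous
  right-hand side, so the continuity lemma applies a second time.\<close>

lemma C1_on_linear_solution:
  fixes K :: "'a::real_normed_vector \<Rightarrow> 'b::euclidean_space \<Rightarrow> 'c::euclidean_space"
  assumes S: "open S" and K: "\<And>x. x \<in> S \<Longrightarrow> linear (K x)" "\<And>x. x \<in> S \<Longrightarrow> inj (K x)"
    and C1: "\<And>b. C1_on S (\<lambda>x. K x b)" "C1_on S z"
    and eq: "\<And>x. x \<in> S \<Longrightarrow> K x (y x) = z x"
  shows "C1_on S y"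
proof -
  have y: "continuous_on S y"
    by (rule continuous_on_linear_solution[OF K _ _ eq]) (auto intro: C1_on_continuous C1)
  have "y differentiable (at x)" if "x \<in> S" for x
    by (rule has_derivative_linear_solution[OF S that K(1) K(2)[OF that] _ _ y eq])
       (auto intro: C1_on_differentiable[OF C1(1) that] C1_on_differentiable[OF C1(2) that])
  then have y': "(y has_derivative frechet_derivative y (at x)) (at x)" if "x \<in> S" for x
    using that frechet_derivative_works by blast
  have "continuous_on S (\<lambda>x. frechet_derivative y (at x) h)" for h
  proof (rule continuous_on_linear_solution[OF K])
    have lin: "linear (\<lambda>v. frechet_derivative (\<lambda>x. K x v) (at x) h)" if "x \<in> S" for x
      by (rule linear_frechet_derivative_family[OF S that K(1)]) (auto intro: C1_on_differentiable[OF C1(1) that])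
    have "continuous_on S (\<lambda>x. frechet_derivative z (at x) h
       - (\<Sum>b\<in>Basis. (y x \<bullet> b) *\<^sub>R frechet_derivative (\<lambda>x. K x b) (at x) h))"
      by (intro continuous_intros y C1_on_frechet_derivative_continuous C1)
    then show "continuous_on S (\<lambda>x. frechet_derivative z (at x) h
       - frechet_derivative (\<lambda>x'. K x' (y x)) (at x) h)"
      by (rule back_subst[where P = "\<lambda>b. b"], intro continuous_on_cong refl arg_cong2[where f = minus])
         (erule linear_eq_sum_Basis[OF lin, symmetric])
    fix x assume x: "x \<in> S"
    have "((\<lambda>x. K x (y x)) has_derivative
        (\<lambda>h. frechet_derivative (\<lambda>x'. K x' (y x)) (at x) h + K x (frechet_derivative y (at x) h))) (at x)"
      by (rule has_derivative_linear_family[OF S x K(1) C1_on_differentiable[OF C1(1) x] y'[OF x]])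
    then have "(z has_derivative
        (\<lambda>h. frechet_derivative (\<lambda>x'. K x' (y x)) (at x) h + K x (frechet_derivative y (at x) h))) (at x)"
      by (rule has_derivative_transform_within_open[OF _ S x eq])
    from frechet_derivative_at[OF this, symmetric]
    show "K x (frechet_derivative y (at x) h)
        = frechet_derivative z (at x) h - frechet_derivative (\<lambda>x'. K x' (y x)) (at x) h"
      by (auto simp: fun_eq_iff)
  qed (auto intro: C1_on_continuous C1)
  with y' show ?thesis by (intro C1_onI)
qed

subsection \<open>Local integral curves\<close>

lemma C1_on_lipschitz_on_cball:
  fixes X :: "'a::euclidean_space \<Rightarrow> 'b::euclidean_space"
  assumes "C1_on S X" "cball u r \<subseteq> S"
  shows "\<exists>L>0. \<forall>x\<in>cball u r. \<forall>y\<in>cball u r. norm (X x - X y) \<le> L * norm (x - y)"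
proof -
  let ?D = "\<lambda>x. frechet_derivative X (at x)"
  have "continuous_on (cball u r) (\<lambda>x. \<Sum>b\<in>Basis. norm (?D x b))"
    by (intro continuous_intros continuous_on_subset[OF C1_on_frechet_derivative_continuous[OF assms(1)] assms(2)])
  then have "bounded ((\<lambda>x. \<Sum>b\<in>Basis. norm (?D x b)) ` cball u r)"
    by (intro compact_imp_bounded compact_continuous_image) auto
  then obtain L where L: "L > 0" "\<And>x. x \<in> cball u r \<Longrightarrow> norm (\<Sum>b\<in>Basis. norm (?D x b)) \<le> L"
    unfolding bounded_pos by auto
  have "norm (X x - X y) \<le> L * norm (x - y)" if "x \<in> cball u r" "y \<in> cball u r" for x y
  proof (rule differentiable_bound[OF convex_cball _ _ that])
    fix z assume z: "z \<in> cball u r"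
    then have d: "(X has_derivative ?D z) (at z)" using C1_on_has_derivative assms by blast
    then show "(X has_derivative ?D z) (at z within cball u r)" by (rule has_derivative_at_withinI)
    have "onorm (?D z) \<le> (\<Sum>b\<in>Basis. norm (?D z b))"
      using d by (intro onorm_componentwise) (rule has_derivative_bounded_linear)
    then show "onorm (?D z) \<le> L" using L(2)[OF z] by simp
  qed
  with L(1) show ?thesis by blast
qed

text \<open>Picard iteration as a contraction of the bounded continuous curves on the whole real
  line. To define it globally, the field is composed with the projection to a closed ball and time
  is clamped to an interval; the fixed point is an integral curve of \<open>X\<close> as long as it
  stays in the ball.\<close>

lemma integral_curve_exists:
  fixes X :: "'a::euclidean_space \<Rightarrow> 'a"
  assumes S: "open S" "u \<in> S" and X: "C1_on S X"
  shows "\<exists>\<delta>>0. \<exists>\<gamma>. \<gamma> 0 = u \<and> (\<forall>t\<in>{-\<delta><..<\<delta>}. \<gamma> t \<in> S \<and> (\<gamma> has_vector_derivative X (\<gamma> t)) (at t))"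
proof -
  obtain r where r: "r > 0" "cball u r \<subseteq> S" using S open_contains_cball by blast
  obtain L where L: "L > 0" "\<And>x y. x \<in> cball u r \<Longrightarrow> y \<in> cball u r \<Longrightarrow> norm (X x - X y) \<le> L * norm (x - y)"
    using C1_on_lipschitz_on_cball[OF X r(2)] by blast
  \<comment> \<open>Nearest-point projection does not increase distances, so composing with it keeps
    the Lipschitz constant \<open>L\<close> and makes the field total.\<close>
  define c where "c = closest_point (cball u r)"
  have ne: "cball u r \<noteq> {}" using r(1) by simp
  have c_in: "c x \<in> cball u r" for x
    unfolding c_def by (rule closest_point_in_set[OF closed_cball ne])
  define Y where "Y x = X (c x)" for x
  have Y_lip: "norm (Y x - Y y) \<le> L * norm (x - y)" for x y
  proof -
    have "norm (c x - c y) \<le> norm (x - y)"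
      using closest_point_lipschitz[OF convex_cball closed_cball ne, of x y] by (simp add: c_def dist_norm)
    then show ?thesis
      using L(2)[OF c_in c_in, of x y] L(1) unfolding Y_def by (meson mult_left_mono order_trans less_imp_le)
  qed
  have Y_cont: "continuous_on UNIV Y"
    by (rule lipschitz_on_continuous_on[of L]) (use L(1) Y_lip in \<open>auto simp: lipschitz_on_def dist_norm\<close>)
  \<comment> \<open>Integrals over lengths at most 2 m and m occur below, so the contraction factor
    is 3 L m = 1/2.\<close>
  define m where "m = 1 / (6 * L)"
  have m: "m > 0" using L(1) by (simp add: m_def)
  define ct where "ct t = max 0 (min t (2 * m))" for t
  have ct: "ct t \<in> {0..2*m}" for t using m by (auto simp: ct_def)
  have ct_cont: "continuous_on UNIV ct" unfolding ct_def by (intro continuous_intros)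
  have Yc: "continuous_on T (\<lambda>t. Y (apply_bcontfun \<gamma> t))" for T and \<gamma> :: "real \<Rightarrow>\<^sub>C 'a"
    by (rule continuous_on_compose2[OF Y_cont]) auto
  have Yi: "(\<lambda>t. Y (apply_bcontfun \<gamma> t)) integrable_on {0..b}" for b and \<gamma> :: "real \<Rightarrow>\<^sub>C 'a"
    by (intro integrable_continuous_real Yc)
  \<comment> \<open>The initial value is prescribed at the interior time \<open>m\<close>, so that
    the curve extends to both sides; the integral from \<open>m\<close> is written as a difference
    of integrals from 0 to avoid reversed limits.\<close>
  define J where "J \<gamma> t = u + integral {0..ct t} (\<lambda>t. Y (apply_bcontfun \<gamma> t))
      - integral {0..m} (\<lambda>t. Y (apply_bcontfun \<gamma> t))" for \<gamma> t
  have J_cont: "J \<gamma> \<in> bcontfun" for \<gamma>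
  proof -
    define I where "I s = u + integral {0..s} (\<lambda>t. Y (apply_bcontfun \<gamma> t))
      - integral {0..m} (\<lambda>t. Y (apply_bcontfun \<gamma> t))" for s
    have I: "continuous_on {0..2*m} I" unfolding I_def
      by (intro continuous_intros indefinite_integral_continuous_1 Yi)
    have JI: "J \<gamma> = (\<lambda>t. I (ct t))" by (auto simp: J_def I_def)
    have "continuous_on UNIV (\<lambda>t. I (ct t))"
      by (rule continuous_on_compose2[OF I ct_cont]) (use ct in auto)
    moreover have "bounded (range (\<lambda>t. I (ct t)))"
      by (rule bounded_subset[OF compact_imp_bounded[OF compact_continuous_image[OF I]]]) (use ct in auto)
    ultimately show ?thesis by (simp add: bcontfun_def JI)
  qed
  define T where "T \<gamma> = Bcontfun (J \<gamma>)" for \<gamma>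
  have T: "apply_bcontfun (T \<gamma>) = J \<gamma>" for \<gamma>
    unfolding T_def by (rule Bcontfun_inverse[OF J_cont])
  have "dist (T \<gamma>) (T \<eta>) \<le> (1/2) * dist \<gamma> \<eta>" for \<gamma> \<eta>
  proof (rule dist_bound)
    fix t
    have b: "norm (integral {0..s} (\<lambda>t. Y (\<gamma> t)) - integral {0..s} (\<lambda>t. Y (\<eta> t))) \<le> L * dist \<gamma> \<eta> * s" if "0 \<le> s" for s
    proof -
      have "norm (integral {0..s} (\<lambda>t. Y (\<gamma> t) - Y (\<eta> t))) \<le> L * dist \<gamma> \<eta> * (s - 0)"
      proof (rule integral_bound[OF that])
        show "continuous_on {0..s} (\<lambda>t. Y (\<gamma> t) - Y (\<eta> t))" by (intro continuous_intros Yc)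
        fix t
        have "norm (Y (\<gamma> t) - Y (\<eta> t)) \<le> L * dist (\<gamma> t) (\<eta> t)" using Y_lip by (simp add: dist_norm)
        also have "\<dots> \<le> L * dist \<gamma> \<eta>" using L(1) by (intro mult_left_mono dist_bounded) auto
        finally show "norm (Y (\<gamma> t) - Y (\<eta> t)) \<le> L * dist \<gamma> \<eta>" .
      qed
      then show ?thesis by (simp add: integral_diff[OF Yi Yi])
    qed
    let ?d = "\<lambda>s. integral {0..s} (\<lambda>t. Y (\<gamma> t)) - integral {0..s} (\<lambda>t. Y (\<eta> t))"
    have "dist (T \<gamma> t) (T \<eta> t) = norm (?d (ct t) - ?d m)"
      by (simp add: T J_def dist_norm algebra_simps)
    also have "\<dots> \<le> L * dist \<gamma> \<eta> * ct t + L * dist \<gamma> \<eta> * m"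
      using b[of "ct t"] b[of m] ct[of t] m by (intro order_trans[OF norm_triangle_ineq4 add_mono]) auto
    also have "\<dots> \<le> L * dist \<gamma> \<eta> * (2 * m) + L * dist \<gamma> \<eta> * m"
      using ct[of t] L(1) by (intro add_mono mult_left_mono) auto
    also have "\<dots> = (1/2) * dist \<gamma> \<eta>" using L(1) by (simp add: m_def field_simps)
    finally show "dist (T \<gamma> t) (T \<eta> t) \<le> (1/2) * dist \<gamma> \<eta>" .
  qed
  then obtain \<gamma> where "T \<gamma> = \<gamma>"
    using banach_fix_type[of "1/2" T] by auto
  then have \<gamma>: "\<gamma> t = J \<gamma> t" for t using T by metis
  have "\<gamma> m = u" using \<gamma>[of m] m by (simp add: J_def ct_def)
  have deriv: "(\<gamma> has_vector_derivative Y (\<gamma> t)) (at t)" if "t \<in> {0<..<2*m}" for t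
  proof -
    have "((\<lambda>s. integral {0..s} (\<lambda>t. Y (\<gamma> t))) has_vector_derivative Y (\<gamma> t)) (at t within {0..2*m})"
      using that by (intro integral_has_vector_derivative Yc) auto
    then have "((\<lambda>s. integral {0..s} (\<lambda>t. Y (\<gamma> t))) has_vector_derivative Y (\<gamma> t)) (at t)"
      using that by (simp add: at_within_Icc_at)
    then have "((\<lambda>s. u + integral {0..s} (\<lambda>t. Y (\<gamma> t)) - integral {0..m} (\<lambda>t. Y (\<gamma> t)))
        has_vector_derivative Y (\<gamma> t)) (at t)"
      by (auto intro!: derivative_eq_intros)
    then show ?thesis
    proof (rule has_vector_derivative_transform_within_open[OF _ open_greaterThanLessThan that])
      fix s assume "s \<in> {0<..<2*m}"
      then show "u + integral {0..s} (\<lambda>t. Y (\<gamma> t)) - integral {0..m} (\<lambda>t. Y (\<gamma> t)) = \<gamma> s"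
        using \<gamma>[of s] by (simp add: J_def ct_def)
    qed
  qed
  have "continuous_on UNIV \<gamma>" by simp
  then obtain d where d: "d > 0" "\<And>t. dist t m < d \<Longrightarrow> dist (\<gamma> t) (\<gamma> m) < r"
    using r(1) unfolding continuous_on_iff by (metis UNIV_I)
  \<comment> \<open>Within \<open>d\<close> of time \<open>m\<close> the curve stays in the ball,
    where \<open>Y\<close> is \<open>X\<close>; within \<open>m\<close> of it the clamping has no
    effect.\<close>
  define \<delta> where "\<delta> = min d m"
  have in_ball: "\<gamma> (t + m) \<in> cball u r" if "t \<in> {-\<delta><..<\<delta>}" for t
  proof -
    have "\<bar>t\<bar> < d" using that by (auto simp: \<delta>_def abs_less_iff)
    then show ?thesis using d(2)[of "t + m"] \<open>\<gamma> m = u\<close> by (simp add: dist_real_def dist_commute)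
  qed
  show ?thesis
  proof (intro exI[of _ \<delta>] conjI exI[of _ "\<lambda>t. \<gamma> (t + m)"] ballI)
    show "\<delta> > 0" using d(1) m by (simp add: \<delta>_def)
    show "\<gamma> (0 + m) = u" using \<open>\<gamma> m = u\<close> by simp
    fix t assume t: "t \<in> {-\<delta><..<\<delta>}"
    show "\<gamma> (t + m) \<in> S" using in_ball[OF t] r(2) by blast
    have "Y (\<gamma> (t + m)) = X (\<gamma> (t + m))"
      unfolding Y_def c_def using in_ball[OF t] by (simp add: closest_point_self)
    moreover have "((\<lambda>t. \<gamma> (t + m)) has_vector_derivative Y (\<gamma> (t + m))) (at t)"
    proof -
      have 1: "((\<lambda>t. t + m) has_vector_derivative 1) (at t)" by (auto intro!: derivative_eq_intros)
      have "t + m \<in> {0<..<2*m}" using t by (auto simp: \<delta>_def)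
      from vector_diff_chain_at[OF 1 deriv[OF this]] show ?thesis by (simp add: o_def)
    qed
    ultimately show "((\<lambda>t. \<gamma> (t + m)) has_vector_derivative X (\<gamma> (t + m))) (at t)" by simp
  qed
qed

subsection \<open>Orthonormal bases and traces\<close>

text \<open>A predicate on a bare function, since the Euclidean type used for tangent vectors
  already carries an inner product, unrelated to the metric.\<close>

definition inner_form :: "('a::real_vector \<Rightarrow> 'a \<Rightarrow> real) \<Rightarrow> bool" where
  "inner_form g \<longleftrightarrow> bilinear g \<and> (\<forall>v w. g v w = g w v) \<and> (\<forall>v. v \<noteq> 0 \<longrightarrow> g v v > 0)"

definition orthonormal_frame :: "('a::real_vector \<Rightarrow> 'a \<Rightarrow> real) \<Rightarrow> 'a set \<Rightarrow> bool" where
  "orthonormal_frame g E \<longleftrightarrow> finite E \<and> (\<forall>x\<in>E. \<forall>y\<in>E. g x y = (if x = y then 1 else 0))"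

lemma inner_form_linear:
  assumes "inner_form g"
  shows "linear (g v)" "linear (\<lambda>w. g w v)"
  using assms by (auto simp: inner_form_def bilinear_def)

lemma inner_form_simps:
  assumes "inner_form g"
  shows "g (v + v') w = g v w + g v' w" "g w (v + v') = g w v + g w v'"
    "g (v - v') w = g v w - g v' w" "g w (v - v') = g w v - g w v'"
    "g (- v) w = - g v w" "g w (- v) = - g w v"
    "g (r *\<^sub>R v) w = r * g v w" "g w (r *\<^sub>R v) = r * g w v"
    "g 0 w = 0" "g w 0 = 0"
    "g (sum f S) w = (\<Sum>x\<in>S. g (f x) w)" "g w (sum f S) = (\<Sum>x\<in>S. g w (f x))"
  using inner_form_linear[OF assms]
  by (simp_all add: linear_add[of "g w"] linear_add[of "\<lambda>v. g v w"] linear_diff[of "g w"] linear_diff[of "\<lambda>v. g v w"]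
      linear_neg[of "g w"] linear_neg[of "\<lambda>v. g v w"] linear_scale[of "g w"] linear_scale[of "\<lambda>v. g v w"]
      linear_0[of "g w"] linear_0[of "\<lambda>v. g v w"] linear_sum[of "g w"] linear_sum[of "\<lambda>v. g v w"])

lemma inner_form_commute: "inner_form g \<Longrightarrow> g v w = g w v"
  by (simp add: inner_form_def)

lemma inner_form_eq_0: "inner_form g \<Longrightarrow> g v v = 0 \<Longrightarrow> v = 0"
  by (force simp: inner_form_def)

lemma orthonormal_frame_coeff:
  assumes g: "inner_form g" and E: "orthonormal_frame g E" "F \<subseteq> E" "x \<in> F"
  shows "g (\<Sum>e\<in>F. r e *\<^sub>R e) x = r x"
proof -
  have F: "finite F" using E finite_subset by (auto simp: orthonormal_frame_def)
  have "g (\<Sum>e\<in>F. r e *\<^sub>R e) x = (\<Sum>e\<in>F. r e * g e x)"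
    by (simp add: inner_form_simps[OF g])
  also have "\<dots> = (\<Sum>e\<in>F. if e = x then r e else 0)"
    using E by (intro sum.cong) (auto simp: orthonormal_frame_def subset_iff)
  finally show ?thesis using F E by simp
qed

lemma orthonormal_frame_independent:
  assumes g: "inner_form g" and E: "orthonormal_frame g E"
  shows "independent E"
proof -
  have "finite E" using E by (simp add: orthonormal_frame_def)
  have "r x = 0" if "(\<Sum>e\<in>E. r e *\<^sub>R e) = 0" "x \<in> E" for r x
    using orthonormal_frame_coeff[OF g E order_refl that(2), of r] that(1) by (simp add: inner_form_simps[OF g])
  with \<open>finite E\<close> show ?thesis by (auto simp: dependent_finite)
qed

lemma orthonormal_residual:
  assumes g: "inner_form g" and E: "orthonormal_frame g E" "x \<in> E"
  shows "g (v - (\<Sum>e\<in>E. g v e *\<^sub>R e)) x = 0"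
  using orthonormal_frame_coeff[OF g E(1) order_refl E(2)] by (simp add: inner_form_simps[OF g])

lemma orthonormal_expansion:
  assumes g: "inner_form g" and E: "orthonormal_frame g E" "span E = UNIV"
  shows "(\<Sum>e\<in>E. g v e *\<^sub>R e) = v"
proof -
  let ?w = "v - (\<Sum>e\<in>E. g v e *\<^sub>R e)"
  have "g ?w x = 0" if "x \<in> span E" for x
    using that
  proof (induction rule: span_induct_alt)
    case base
    show ?case by (simp add: inner_form_simps[OF g])
  next
    case (step c x y)
    then show ?case
      using orthonormal_residual[OF g E(1), of x v] by (simp add: inner_form_simps[OF g])
  qed
  then have "?w = 0" using inner_form_eq_0[OF g] E(2) by blast
  then show ?thesis by simp
qed

text \<open>Independence bounds the cardinality of frames, and a frame of maximal cardinality spans: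
  otherwise the normalised residual of a vector outside its span could be added.\<close>

lemma orthonormal_frame_exists:
  fixes g :: "'a::euclidean_space \<Rightarrow> 'a \<Rightarrow> real"
  assumes g: "inner_form g"
  obtains E where "orthonormal_frame g E" "span E = UNIV"
proof -
  have bound: "card E < Suc DIM('a)" if "orthonormal_frame g E" for E
    using independent_bound[OF orthonormal_frame_independent[OF g that]] by simp
  have "orthonormal_frame g {}" by (simp add: orthonormal_frame_def)
  from ex_has_greatest_nat[where P = "orthonormal_frame g" and f = card, OF this]
  obtain E where E: "orthonormal_frame g E" and max: "\<And>F. orthonormal_frame g F \<Longrightarrow> card F \<le> card E"
    using bound by (metis less_imp_le)
  have "v \<in> span E" for v
  proof (rule ccontr)
    assume v: "v \<notin> span E"
    define w where "w = v - (\<Sum>e\<in>E. g v e *\<^sub>R e)"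
    have "(\<Sum>e\<in>E. g v e *\<^sub>R e) \<in> span E" by (intro span_sum span_scale span_base)
    then have "w \<noteq> 0" using v by (auto simp: w_def)
    then have pos: "g w w > 0" using g by (simp add: inner_form_def)
    define u where "u = (1 / sqrt (g w w)) *\<^sub>R w"
    note scale = inner_form_simps(7,8)[OF g]
    have u1: "g u u = 1" using pos by (simp add: u_def scale real_sqrt_mult_self)
    have ux: "g u x = 0" "g x u = 0" if "x \<in> E" for x
      using orthonormal_residual[OF g E that, of v] inner_form_commute[OF g, of x u] by (auto simp: u_def scale w_def)
    have "u \<notin> E" using u1 ux(1) by auto
    have "orthonormal_frame g (insert u E)"
      using E u1 ux by (auto simp: orthonormal_frame_def)
    from max[OF this] show False using \<open>u \<notin> E\<close> E by (simp add: orthonormal_frame_def)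
  qed
  then show ?thesis using that E by auto
qed

text \<open>Expand one \<open>\<psi> e\<close> in the frame, exchange the two sums, and use skewness
  to move \<open>\<psi>\<close> to the other entry of the coefficients.\<close>

lemma trace_skew:
  assumes g: "inner_form g" and E: "orthonormal_frame g E" "span E = UNIV"
    and B: "bilinear B" and \<psi>: "linear \<psi>" and skew: "\<And>v w. g (\<psi> v) w = - g v (\<psi> w)"
  shows "(\<Sum>e\<in>E. B (\<psi> e) (\<psi> e)) = - (\<Sum>e\<in>E. B (\<psi> (\<psi> e)) e :: real)"
proof -
  have B2: "linear (B v)" and B1: "linear (\<lambda>v. B v w)" for v w using B by (auto simp: bilinear_def)
  have "(\<Sum>e\<in>E. B (\<psi> e) (\<psi> e)) = (\<Sum>e\<in>E. B (\<psi> e) (\<Sum>f\<in>E. g (\<psi> e) f *\<^sub>R f))"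
    by (simp add: orthonormal_expansion[OF g E])
  also have "\<dots> = (\<Sum>e\<in>E. \<Sum>f\<in>E. g (\<psi> e) f * B (\<psi> e) f)"
    by (simp add: linear_sum[OF B2] linear_scale[OF B2])
  also have "\<dots> = (\<Sum>f\<in>E. \<Sum>e\<in>E. g (\<psi> e) f * B (\<psi> e) f)" by (rule sum.swap)
  also have "\<dots> = - (\<Sum>f\<in>E. \<Sum>e\<in>E. g (\<psi> f) e * B (\<psi> e) f)"
  proof -
    have "- g (\<psi> f) e = g (\<psi> e) f" for e f
      using skew[of e f] inner_form_commute[OF g, of e "\<psi> f"] by simp
    then show ?thesis by (simp only: sum_negf[symmetric] mult_minus_left[symmetric])
  qed
  also have "\<dots> = - (\<Sum>f\<in>E. B (\<psi> (\<Sum>e\<in>E. g (\<psi> f) e *\<^sub>R e)) f)"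
    by (simp add: linear_sum[OF B1] linear_scale[OF B1] linear_sum[OF \<psi>] linear_scale[OF \<psi>])
  finally show ?thesis by (simp add: orthonormal_expansion[OF g E])
qed

text \<open>Here \<open>\<psi>\<close> is an almost contact structure with kernel spanned by \<open>X\<close>, and the last assumption
  says that \<open>B\<close> has no \<open>\<psi>\<close>-invariant part on the image of \<open>\<psi>\<close>.\<close>

lemma trace_anti_invariant:
  assumes g: "inner_form g" and E: "orthonormal_frame g E" "span E = UNIV"
    and B: "bilinear B" and \<psi>: "linear \<psi>" and skew: "\<And>v w. g (\<psi> v) w = - g v (\<psi> w)"
    and \<psi>2: "\<And>v. \<psi> (\<psi> v) = - v + (g v X / a) *\<^sub>R X" and X: "\<psi> X = 0"
    and anti: "\<And>v. B (\<psi> v) (\<psi> v) + B (\<psi> (\<psi> v)) (\<psi> (\<psi> v)) = (0::real)"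
  shows "(\<Sum>e\<in>E. B e e) = B X X / a"
proof -
  have B2: "linear (B v)" and B1: "linear (\<lambda>v. B v w)" for v w using B by (auto simp: bilinear_def)
  have tr: "(\<Sum>e\<in>E. B' (\<psi> e) (\<psi> e)) = (\<Sum>e\<in>E. B' e e) - B' X X / a" if B': "bilinear B'" for B'
  proof -
    have B2: "linear (B' v)" and B1: "linear (\<lambda>v. B' v w)" for v w using B' by (auto simp: bilinear_def)
    have "(\<Sum>e\<in>E. B' (\<psi> e) (\<psi> e)) = - (\<Sum>e\<in>E. B' (\<psi> (\<psi> e)) e)"
      by (rule trace_skew[OF g E B' \<psi> skew])
    also have "\<dots> = (\<Sum>e\<in>E. B' e e) - (\<Sum>e\<in>E. g X e * B' X e) / a"
      by (simp add: \<psi>2 linear_add[OF B1] linear_neg[OF B1] linear_diff[OF B1] linear_scale[OF B1] sum.distrib sum_negf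
            sum_subtractf sum_divide_distrib inner_form_commute[OF g])
    also have "(\<Sum>e\<in>E. g X e * B' X e) = B' X (\<Sum>e\<in>E. g X e *\<^sub>R e)"
      by (simp add: linear_sum[OF B2] linear_scale[OF B2])
    finally show ?thesis by (simp add: orthonormal_expansion[OF g E])
  qed
  \<comment> \<open>The formula \<open>tr\<close> is used for \<open>B\<close> and for
    \<open>B\<close> composed with \<open>\<psi>\<close> in both arguments. In the second case the
    correction vanishes because \<open>\<psi> X = 0\<close>, so the traces over
    \<open>\<psi> e\<close> and \<open>\<psi> (\<psi> e)\<close> agree; by \<open>anti\<close> they
    are also opposite, hence zero.\<close>
  have "bilinear (\<lambda>v w. B (\<psi> v) (\<psi> w))"
    using linear_compose[OF \<psi> B1] linear_compose[OF \<psi> B2] by (auto simp: bilinear_def o_def)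
  from tr[OF this] have "(\<Sum>e\<in>E. B (\<psi> (\<psi> e)) (\<psi> (\<psi> e))) = (\<Sum>e\<in>E. B (\<psi> e) (\<psi> e))"
    using X linear_0[OF B2] by simp
  moreover have "(\<Sum>e\<in>E. B (\<psi> e) (\<psi> e)) + (\<Sum>e\<in>E. B (\<psi> (\<psi> e)) (\<psi> (\<psi> e))) = 0"
    by (simp add: sum.distrib[symmetric] anti)
  ultimately show ?thesis using tr[OF B] by simp
qed

subsection \<open>Orthogonal projections and invariant subspaces\<close>

lemma inner_form_pullback:
  assumes "inner_form g" "linear D" "inj D"
  shows "inner_form (\<lambda>v w. g (D v) (D w))"
proof -
  have "linear (\<lambda>w. g (D v) (D w))" "linear (\<lambda>w. g (D w) (D v))" for v
    using linear_compose[OF assms(2) inner_form_linear(1)[OF assms(1)]]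
      linear_compose[OF assms(2) inner_form_linear(2)[OF assms(1)]] by (auto simp: o_def)
  moreover have "D v \<noteq> 0" if "v \<noteq> 0" for v
    using that assms(3) linear_0[OF assms(2)] by (metis injD)
  ultimately show ?thesis using assms(1) by (auto simp: inner_form_def bilinear_def)
qed

text \<open>The projection is given by the Fourier coefficients for a frame of the form pulled back
  by \<open>D\<close>. Unique existence gives meaning to the \<open>THE\<close> in
  \<open>tan_part\<close>.\<close>

lemma orthogonal_projection_ex1:
  fixes D :: "'f::euclidean_space \<Rightarrow> 'e::real_vector"
  assumes g: "inner_form g" and D: "linear D" "inj D"
  shows "\<exists>!t. t \<in> range D \<and> (\<forall>s\<in>range D. g (x - t) s = 0)"
proof (rule ex_ex1I)
  let ?h = "\<lambda>v w. g (D v) (D w)"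
  have h: "inner_form ?h" by (rule inner_form_pullback[OF g D])
  obtain E where E: "orthonormal_frame ?h E" "span E = UNIV" using orthonormal_frame_exists[OF h] by blast
  define t where "t = (\<Sum>e\<in>E. g x (D e) *\<^sub>R e)"
  have "g (D t) (D s) = g x (D s)" for s
  proof -
    have "g (D t) (D s) = (\<Sum>e\<in>E. g x (D e) * g (D e) (D s))"
      by (simp add: t_def linear_sum[OF D(1)] linear_scale[OF D(1)] inner_form_simps[OF g])
    also have "\<dots> = g x (D (\<Sum>e\<in>E. ?h s e *\<^sub>R e))"
      by (simp add: linear_sum[OF D(1)] linear_scale[OF D(1)] inner_form_simps[OF g]
          inner_form_commute[OF g, of "D s"] mult.commute)
    finally show ?thesis by (simp add: orthonormal_expansion[OF h E])
  qed
  then show "\<exists>t. t \<in> range D \<and> (\<forall>s\<in>range D. g (x - t) s = 0)"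
    by (intro exI[of _ "D t"]) (auto simp: inner_form_simps[OF g])
next
  fix t t' assume t: "t \<in> range D \<and> (\<forall>s\<in>range D. g (x - t) s = 0)" "t' \<in> range D \<and> (\<forall>s\<in>range D. g (x - t') s = 0)"
  then obtain v w where vw: "t = D v" "t' = D w" by auto
  have "t - t' \<in> range D" unfolding vw linear_diff[OF D(1), symmetric] by blast
  then have "g (x - t') (t - t') = 0" "g (x - t) (t - t') = 0" using t by blast+
  then have "g (t - t') (t - t') = 0"
    by (simp add: inner_form_simps[OF g])
  then show "t = t'" using inner_form_eq_0[OF g] by force
qed

text \<open>The structure of a metric contact pair on a single tangent space, a \<open>\<phi>\<close>-invariant subspace \<open>T\<close>,
  and the component \<open>t\<close> of \<open>Z1\<close> in \<open>T\<close>.\<close>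

locale invariant_subspace =
  fixes g :: "'e::real_vector \<Rightarrow> 'e \<Rightarrow> real" and \<phi> :: "'e \<Rightarrow> 'e" and a1 a2 :: "'e \<Rightarrow> real" and Z1 Z2 t :: 'e
    and T :: "'e set"
  assumes g: "inner_form g" and \<phi>: "linear \<phi>"
    and skew: "g v (\<phi> w) = - g (\<phi> v) w"
    and \<phi>2: "\<phi> (\<phi> v) = - v + a1 v *\<^sub>R Z1 + a2 v *\<^sub>R Z2"
    and \<phi>Z: "\<phi> Z1 = 0" "\<phi> Z2 = 0"
    and gZ: "g v Z1 = a1 v" "g v Z2 = a2 v"
    and T: "subspace T" "v \<in> T \<Longrightarrow> \<phi> v \<in> T"
    and t: "t \<in> T" "s \<in> T \<Longrightarrow> g (Z1 - t) s = 0"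
    and not_tangent: "Z1 \<notin> T" and not_orthogonal: "\<exists>s\<in>T. g Z1 s \<noteq> 0"
begin

lemma g_tangent: "s \<in> T \<Longrightarrow> g s t = a1 s"
  using t(2)[of s] gZ(1)[of s] inner_form_commute[OF g, of s] by (simp add: inner_form_simps[OF g])

text \<open>As \<open>\<phi> (\<phi> t)\<close> lies in \<open>T\<close>, pairing it with
  \<open>t\<close> is the same as pairing it with \<open>Z1\<close>, where skewness and
  \<open>\<phi> Z1 = 0\<close> give 0. So \<open>\<phi> t\<close> has length 0.\<close>

lemma \<phi>_t: "\<phi> t = 0"
proof -
  have "g (\<phi> t) (\<phi> t) = - g (\<phi> (\<phi> t)) t" using skew[of "\<phi> t" t] by simp
  also have "\<dots> = - a1 (\<phi> (\<phi> t))" using g_tangent T(2) t(1) by simp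
  also have "\<dots> = g (\<phi> t) (\<phi> Z1)" using gZ(1)[of "\<phi> (\<phi> t)"] skew[of "\<phi> t" Z1] by simp
  also have "\<dots> = 0" using \<phi>Z by (simp add: inner_form_simps[OF g])
  finally show ?thesis by (rule inner_form_eq_0[OF g])
qed

lemma t_eq: "t = a1 t *\<^sub>R Z1 + a2 t *\<^sub>R Z2"
  using \<phi>2[of t] \<phi>_t linear_0[OF \<phi>] by (simp add: algebra_simps)

lemma g_t_t: "g t t = a1 t" using g_tangent t(1) by simp

lemma a1_t_eq: "a1 t = (a1 t)\<^sup>2 + (a2 t)\<^sup>2"
proof -
  have "a1 t = g t (a1 t *\<^sub>R Z1 + a2 t *\<^sub>R Z2)" using g_t_t t_eq by simp
  also have "\<dots> = a1 t * a1 t + a2 t * a2 t"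
    by (simp only: inner_form_simps[OF g] gZ)
  finally show ?thesis by (simp add: power2_eq_square)
qed

lemma t_nonzero: "t \<noteq> 0"
  using t(2) not_orthogonal by auto

lemma a1_t_pos: "a1 t > 0"
  using g_t_t t_nonzero g unfolding inner_form_def by metis

lemma a2_t_nonzero: "a2 t \<noteq> 0"
proof
  assume "a2 t = 0"
  then have "Z1 = (1 / a1 t) *\<^sub>R t" using t_eq a1_t_pos
    by (metis add.right_neutral divide_self_if less_irrefl mult.commute scaleR_one scaleR_scaleR scaleR_zero_left times_divide_eq_right mult.right_neutral)
  then show False using not_tangent T(1) t(1) by (metis subspace_scale)
qed

text \<open>\<open>T\<close> meets the span of \<open>Z1\<close> and \<open>Z2\<close> only in
  multiples of \<open>t\<close>, for otherwise it would contain \<open>Z1\<close>. The Reeb part of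
  \<open>\<phi> (\<phi> v)\<close> lies in this intersection.\<close>

lemma \<phi>2_tangent:
  assumes "v \<in> T"
  shows "\<phi> (\<phi> v) = - v + (g v t / a1 t) *\<^sub>R t"
proof -
  define w where "w = a1 v *\<^sub>R Z1 + a2 v *\<^sub>R Z2"
  have w: "w \<in> T" using subspace_add[OF T(1) T(2)[OF T(2)[OF assms]] assms] by (simp add: \<phi>2 w_def add.assoc)
  \<comment> \<open>The combination in which \<open>Z2\<close> cancels.\<close>
  have "a2 v *\<^sub>R t - a2 t *\<^sub>R w \<in> T" using w t(1) T(1) by (simp add: subspace_diff subspace_scale)
  also have "a2 v *\<^sub>R t - a2 t *\<^sub>R w = (a2 v * a1 t - a2 t * a1 v) *\<^sub>R Z1"
    by (subst t_eq) (simp add: w_def algebra_simps)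
  finally have mem: "(a2 v * a1 t - a2 t * a1 v) *\<^sub>R Z1 \<in> T" .
  have "a2 v * a1 t - a2 t * a1 v = 0"
  proof (rule ccontr)
    assume "a2 v * a1 t - a2 t * a1 v \<noteq> 0"
    then have "Z1 \<in> T" using subspace_scale[OF T(1) mem, of "1 / (a2 v * a1 t - a2 t * a1 v)"] by simp
    then show False using not_tangent by blast
  qed
  then have a2: "a2 v = a1 v / a1 t * a2 t" using a1_t_pos by (simp add: field_simps)
  have "w = (a1 v / a1 t) *\<^sub>R (a1 t *\<^sub>R Z1 + a2 t *\<^sub>R Z2)"
    using a1_t_pos by (simp add: w_def a2 scaleR_add_right)
  then have "w = (a1 v / a1 t) *\<^sub>R t" using t_eq by simp
  then show ?thesis using \<phi>2[of v] g_tangent[OF assms] by (simp add: w_def add.assoc)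
qed

lemma horizontal_\<phi>: "a1 (\<phi> v) = 0" "a2 (\<phi> v) = 0"
  using skew[of v Z1] skew[of v Z2] gZ[of "\<phi> v"] \<phi>Z by (simp_all add: inner_form_simps[OF g])

end

subsection \<open>Changes of charts\<close>

text \<open>Both \<open>to_chart\<close> and \<open>of_chart\<close> are instances, with
  \<open>chart_at A p\<close> at one end, so their rules all come from the chain rule for
  \<open>jac\<close>.\<close>

definition jac :: "('m, 'e::euclidean_space) chart \<Rightarrow> ('m, 'e) chart \<Rightarrow> 'm \<Rightarrow> 'e \<Rightarrow> 'e" where
  "jac c d p = frechet_derivative (cmap d \<circ> cinv c) (at (cmap c p))"

lemma to_chart_jac: "to_chart A c p = jac (chart_at A p) c p"
  by (auto simp: to_chart_def jac_def)

lemma of_chart_jac: "of_chart A c p = jac c (chart_at A p) p"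
  by (auto simp: of_chart_def jac_def)

text \<open>The coordinate formula behind \<open>ext_deriv\<close>, but in one fixed chart, so that
  it may be differentiated in the base point.\<close>

definition ext_deriv_rep :: "('e::euclidean_space \<Rightarrow> 'e \<Rightarrow> real) \<Rightarrow> 'e \<Rightarrow> 'e \<Rightarrow> 'e \<Rightarrow> real" where
  "ext_deriv_rep a x v w = (frechet_derivative (\<lambda>y. a y w) (at x) v - frechet_derivative (\<lambda>y. a y v) (at x) w) / 2"

locale smooth_manifold =
  fixes A :: "('m::{t2_space, second_countable_topology}, 'e::euclidean_space) chart set"
  assumes atlas: "smooth_atlas A"
begin

lemma chart_at: "chart_at A p \<in> A" "p \<in> cdom (chart_at A p)"
proof -
  have "\<exists>c. c \<in> A \<and> p \<in> cdom c" using atlas unfolding smooth_atlas_def by blast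
  from someI_ex[OF this] show "chart_at A p \<in> A" "p \<in> cdom (chart_at A p)"
    unfolding chart_at_def by auto
qed

context
  fixes c assumes c: "c \<in> A"
begin

lemma chart: "is_chart c"
  using atlas c by (auto simp: smooth_atlas_def)

lemma open_cdom: "open (cdom c)" and open_cimg: "open (cimg c)"
  using chart by (auto simp: is_chart_def)

lemma cinv_cmap: "p \<in> cdom c \<Longrightarrow> cinv c (cmap c p) = p"
  using chart by (auto simp: is_chart_def homeomorphism_def)

lemma cmap_cinv: "x \<in> cimg c \<Longrightarrow> cmap c (cinv c x) = x"
  using chart by (auto simp: is_chart_def homeomorphism_def)

lemma cmap_in: "p \<in> cdom c \<Longrightarrow> cmap c p \<in> cimg c"
  by (auto simp: cimg_def)

lemma cinv_in: "x \<in> cimg c \<Longrightarrow> cinv c x \<in> cdom c"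
  using chart by (auto simp: is_chart_def homeomorphism_def)

lemma continuous_cinv: "continuous_on (cimg c) (cinv c)"
  using chart by (auto simp: is_chart_def homeomorphism_def)

lemma open_cmap_image:
  assumes "open W" "W \<subseteq> cdom c"
  shows "open (cmap c ` W)"
proof -
  have "cmap c ` W = cimg c \<inter> cinv c -` W"
    using assms(2) by (force simp: cinv_cmap cmap_cinv cmap_in image_iff)
  then show ?thesis using continuous_open_preimage[OF continuous_cinv open_cimg assms(1)] by simp
qed

end

lemma transition_smooth:
  "c \<in> A \<Longrightarrow> d \<in> A \<Longrightarrow> smooth_on (cmap c ` (cdom c \<inter> cdom d)) (cmap d \<circ> cinv c)"
  using atlas by (auto simp: smooth_atlas_def smooth_transition_def)

lemma open_overlap: "c \<in> A \<Longrightarrow> d \<in> A \<Longrightarrow> open (cmap c ` (cdom c \<inter> cdom d))"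
  by (intro open_cmap_image open_Int open_cdom) auto

lemma jac_has_derivative:
  assumes "c \<in> A" "d \<in> A" "p \<in> cdom c" "p \<in> cdom d"
  shows "(cmap d \<circ> cinv c has_derivative jac c d p) (at (cmap c p))"
  unfolding jac_def using assms by (intro smooth_on_has_derivative[OF transition_smooth[OF assms(1,2)]]) auto

lemma jac_linear:
  assumes "c \<in> A" "d \<in> A" "p \<in> cdom c" "p \<in> cdom d"
  shows "linear (jac c d p)"
  using jac_has_derivative[OF assms] by (rule has_derivative_linear)

lemma has_derivative_change_chart:
  assumes c: "c \<in> A" "c' \<in> A" and S: "open S" "x \<in> S" "\<And>y. y \<in> S \<Longrightarrow> h y \<in> cdom c'" "h x \<in> cdom c"
    and d: "((\<lambda>y. cmap c' (h y)) has_derivative D) (at x)"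
  shows "((\<lambda>y. cmap c (h y)) has_derivative (\<lambda>v. jac c' c (h x) (D v))) (at x)"
proof -
  have "(cmap c \<circ> cinv c' has_derivative jac c' c (h x)) (at (cmap c' (h x)))"
    using c S by (intro jac_has_derivative) auto
  from diff_chain_at[OF d this]
  have "((\<lambda>y. cmap c (cinv c' (cmap c' (h y)))) has_derivative (\<lambda>v. jac c' c (h x) (D v))) (at x)"
    by (simp add: o_def)
  then show ?thesis
    by (rule has_derivative_transform_within_open[OF _ S(1,2)]) (simp add: cinv_cmap c S)
qed

lemma jac_self:
  assumes "c \<in> A" "p \<in> cdom c"
  shows "jac c c p v = v"
proof -
  have "((\<lambda>x. x) has_derivative (\<lambda>v. v)) (at (cmap c p))" by (rule has_derivative_ident)
  then have "(cmap c \<circ> cinv c has_derivative (\<lambda>v. v)) (at (cmap c p))"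
    by (rule has_derivative_transform_within_open[OF _ open_cimg cmap_in]) (use assms in \<open>auto simp: cmap_cinv\<close>)
  from frechet_derivative_at[OF this] show ?thesis unfolding jac_def by metis
qed

lemma jac_chain:
  assumes "c \<in> A" "d \<in> A" "e \<in> A" "p \<in> cdom c" "p \<in> cdom d" "p \<in> cdom e"
  shows "jac d e p (jac c d p v) = jac c e p v"
proof -
  let ?S = "cmap c ` (cdom c \<inter> cdom d)"
  have d: "((\<lambda>x. cmap d (cinv c x)) has_derivative jac c d p) (at (cmap c p))"
    using jac_has_derivative[OF assms(1,2,4,5)] by (simp add: o_def)
  have "((\<lambda>x. cmap e (cinv c x)) has_derivative (\<lambda>v. jac d e (cinv c (cmap c p)) (jac c d p v))) (at (cmap c p))"
    by (rule has_derivative_change_chart[OF assms(3,2) open_overlap[OF assms(1,2)] _ _ _ d])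
       (use assms in \<open>auto simp: cinv_cmap\<close>)
  then have "((\<lambda>x. cmap e (cinv c x)) has_derivative (\<lambda>v. jac d e p (jac c d p v))) (at (cmap c p))"
    using assms by (simp add: cinv_cmap)
  moreover have "((\<lambda>x. cmap e (cinv c x)) has_derivative jac c e p) (at (cmap c p))"
    using jac_has_derivative[OF assms(1,3,4,6)] by (simp add: o_def)
  ultimately have "(\<lambda>v. jac d e p (jac c d p v)) = jac c e p" by (rule has_derivative_unique)
  then show ?thesis by (rule fun_cong)
qed

context
  fixes c p assumes c: "c \<in> A" "p \<in> cdom c"
begin

lemma to_of_chart: "to_chart A c p (of_chart A c p v) = v"
  using jac_chain[of c "chart_at A p" c p v] jac_self[of c p v] c chart_at by (simp add: to_chart_jac of_chart_jac)

lemma of_to_chart: "of_chart A c p (to_chart A c p v) = v"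
  using jac_chain[of "chart_at A p" c "chart_at A p" p v] jac_self[of "chart_at A p" p v] c chart_at
  by (simp add: to_chart_jac of_chart_jac)

lemma to_chart_linear: "linear (to_chart A c p)" and of_chart_linear: "linear (of_chart A c p)"
  using c chart_at by (auto simp: to_chart_jac of_chart_jac intro: jac_linear)

lemma jac_of_chart:
  assumes "c' \<in> A" "p \<in> cdom c'"
  shows "of_chart A c' p (jac c c' p v) = of_chart A c p v"
  using assms c chart_at[of p] by (simp add: of_chart_jac jac_chain)

lemma form_rep_cmap: "form_rep A c \<alpha> (cmap c p) v = \<alpha> p (of_chart A c p v)"
  using c by (simp add: form_rep_def cinv_cmap)

lemma bil_rep_cmap: "bil_rep A c b (cmap c p) v w = b p (of_chart A c p v) (of_chart A c p w)"
  using c by (simp add: bil_rep_def cinv_cmap)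

lemma endo_rep_cmap: "endo_rep A c \<phi> (cmap c p) v = to_chart A c p (\<phi> p (of_chart A c p v))"
  using c by (simp add: endo_rep_def cinv_cmap)

lemma vec_rep_cmap: "vec_rep A c X (cmap c p) = to_chart A c p (X p)"
  using c by (simp add: vec_rep_def cinv_cmap)

end

lemma to_chart_self: "to_chart A (chart_at A p) p v = v" and of_chart_self: "of_chart A (chart_at A p) p v = v"
  using chart_at by (auto simp: to_chart_jac of_chart_jac jac_self)

subsection \<open>The exterior derivative in a chart\<close>

lemma form_rep_linear:
  assumes "one_form A \<alpha>" "c \<in> A" "x \<in> cimg c"
  shows "linear (form_rep A c \<alpha> x)"
proof -
  have "linear (\<lambda>v. \<alpha> (cinv c x) (of_chart A c (cinv c x) v))"
    using linear_compose[OF of_chart_linear[OF assms(2) cinv_in[OF assms(2,3)]], of "\<alpha> (cinv c x)"] assms(1)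
    by (simp add: one_form_def o_def)
  then show ?thesis by (simp add: form_rep_def[abs_def])
qed

lemma form_rep_smooth: "one_form A \<alpha> \<Longrightarrow> c \<in> A \<Longrightarrow> smooth_on (cimg c) (\<lambda>x. form_rep A c \<alpha> x v)"
  by (simp add: one_form_def)

text \<open>Pulling the components back by the transition map \<open>\<tau>\<close> produces second
  derivatives of \<open>\<tau>\<close>; by their symmetry they cancel in the antisymmetrised
  expression.\<close>

lemma ext_deriv_chart:
  assumes \<alpha>: "one_form A \<alpha>" and c: "c \<in> A" "p \<in> cdom c"
  shows "ext_deriv A \<alpha> p (of_chart A c p v) (of_chart A c p w) = ext_deriv_rep (form_rep A c \<alpha>) (cmap c p) v w"
proof -
  define c' where "c' = chart_at A p"
  have c': "c' \<in> A" "p \<in> cdom c'" using chart_at by (auto simp: c'_def)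
  define \<tau> where "\<tau> = cmap c' \<circ> cinv c"
  define S where "S = cmap c ` (cdom c \<inter> cdom c')"
  define F where "F = form_rep A c' \<alpha>"
  have S: "open S" "cmap c p \<in> S" using c c' open_overlap by (auto simp: S_def)
  have \<tau>S: "\<tau> x \<in> cimg c'" if "x \<in> S" for x
    using that c c' by (auto simp: S_def \<tau>_def cinv_cmap cmap_in)
  have \<tau>: "smooth_on S \<tau>" unfolding \<tau>_def S_def using transition_smooth c c' by blast
  let ?D = "\<lambda>x. frechet_derivative \<tau> (at x)"
  have \<tau>p: "\<tau> (cmap c p) = cmap c' p" using c by (simp add: \<tau>_def cinv_cmap)
  have D\<tau>: "(\<tau> has_derivative ?D (cmap c p)) (at (cmap c p))"
    using smooth_on_has_derivative[OF \<tau> S(2)] .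
  have of_c: "of_chart A c p v = ?D (cmap c p) v" for v
    by (simp add: of_chart_jac jac_def \<tau>_def c'_def)
  have rep: "F (\<tau> x) (?D x w) = form_rep A c \<alpha> x w" if x: "x \<in> S" for x w
  proof -
    obtain q where q: "q \<in> cdom c" "q \<in> cdom c'" "x = cmap c q" using x by (auto simp: S_def)
    have "F (\<tau> x) (?D x w) = \<alpha> q (of_chart A c' q (jac c c' q w))"
      using form_rep_cmap[OF c'(1) q(2)] q c by (simp add: F_def \<tau>_def cinv_cmap jac_def)
    then show ?thesis by (simp add: form_rep_cmap[OF c(1) q(1)] jac_of_chart[OF c(1) q(1) c'(1) q(2)] q(3))
  qed
  have F: "((\<lambda>y. F y v) has_derivative frechet_derivative (\<lambda>y. F y v) (at (cmap c' p))) (at (\<tau> (cmap c p)))" for v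
    unfolding \<tau>p F_def using smooth_on_has_derivative[OF form_rep_smooth[OF \<alpha> c'(1)] cmap_in[OF c'(1,2)]] .
  have F\<tau>: "((\<lambda>x. F (\<tau> x) v) has_derivative (\<lambda>h. frechet_derivative (\<lambda>y. F y v) (at (cmap c' p)) (?D (cmap c p) h)))
      (at (cmap c p))" for v
    using diff_chain_at[OF D\<tau> F] by (simp add: o_def)
  have "((\<lambda>x. F (\<tau> x) (?D x w)) has_derivative
     (\<lambda>h. frechet_derivative (\<lambda>x. F (\<tau> x) (?D (cmap c p) w)) (at (cmap c p)) h
        + F (\<tau> (cmap c p)) (frechet_derivative (\<lambda>x. ?D x w) (at (cmap c p)) h))) (at (cmap c p))" for w
  proof (rule has_derivative_linear_family[OF S])
    show "linear (F (\<tau> x))" if "x \<in> S" for x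
      unfolding F_def using form_rep_linear[OF \<alpha> c'(1)] \<tau>S that by blast
    show "(\<lambda>x. F (\<tau> x) v) differentiable (at (cmap c p))" for v using F\<tau> by (rule differentiableI)
    show "((\<lambda>x. ?D x w) has_derivative frechet_derivative (\<lambda>x. ?D x w) (at (cmap c p))) (at (cmap c p))"
      by (rule smooth_on_has_derivative[OF smooth_on_frechet_derivative[OF \<tau>] S(2)])
  qed
  then have "((\<lambda>x. form_rep A c \<alpha> x w) has_derivative
     (\<lambda>h. frechet_derivative (\<lambda>x. F (\<tau> x) (?D (cmap c p) w)) (at (cmap c p)) h
        + F (\<tau> (cmap c p)) (frechet_derivative (\<lambda>x. ?D x w) (at (cmap c p)) h))) (at (cmap c p))" for w
    by (rule has_derivative_transform_within_open[OF _ S]) (simp add: rep)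
  from frechet_derivative_at[OF this, symmetric] frechet_derivative_at[OF F\<tau>, symmetric]
  have "frechet_derivative (\<lambda>x. form_rep A c \<alpha> x w) (at (cmap c p)) h =
      frechet_derivative (\<lambda>y. F y (?D (cmap c p) w)) (at (cmap c' p)) (?D (cmap c p) h)
        + F (\<tau> (cmap c p)) (frechet_derivative (\<lambda>x. ?D x w) (at (cmap c p)) h)" for w h
    by simp
  then show ?thesis
    using second_derivative_symmetric[OF S \<tau>, of v w]
    by (simp add: ext_deriv_rep_def ext_deriv_def of_c Let_def c'_def[symmetric] F_def)
qed

end

subsection \<open>Immersions in charts\<close>

locale smooth_submanifold = M: smooth_manifold A + N: smooth_manifold B
  for A :: "('m::{t2_space, second_countable_topology}, 'e::euclidean_space) chart set"
    and B :: "('n::{t2_space, second_countable_topology}, 'f::euclidean_space) chart set" +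
  fixes \<iota> :: "'n \<Rightarrow> 'm"
  assumes sub: "submanifold B A \<iota>"
begin

context
  fixes c d assumes c: "c \<in> A" and d: "d \<in> B"
begin

definition "U = cmap d ` (cdom d \<inter> \<iota> -` cdom c)"
definition "f = cmap c \<circ> \<iota> \<circ> cinv d"

lemma continuous_\<iota>: "continuous_on UNIV \<iota>"
  using sub by (auto simp: submanifold_def smooth_map_def)

lemma open_preimage: "open (\<iota> -` cdom c)"
  using continuous_open_vimage[OF M.open_cdom[OF c]] continuous_\<iota> by (auto simp: continuous_on_eq_continuous_at)

lemma open_U: "open U"
  unfolding U_def using open_preimage N.open_cdom[OF d] by (intro N.open_cmap_image[OF d]) auto

lemma f_smooth: "smooth_on U f"
  using sub c d by (auto simp: submanifold_def smooth_map_def U_def f_def)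

lemma cmap_in_U: "q \<in> cdom d \<Longrightarrow> \<iota> q \<in> cdom c \<Longrightarrow> cmap d q \<in> U"
  by (auto simp: U_def)

lemma U_cases:
  assumes "u \<in> U" obtains q where "q \<in> cdom d" "\<iota> q \<in> cdom c" "u = cmap d q" "cinv d u = q" "f u = cmap c (\<iota> q)"
  using assms N.cinv_cmap[OF d] by (auto simp: U_def f_def)

lemma f_has_derivative: "u \<in> U \<Longrightarrow> (f has_derivative frechet_derivative f (at u)) (at u)"
  by (rule smooth_on_has_derivative[OF f_smooth])

text \<open>The charts in the definition of \<open>tangent_map\<close> are those chosen at
  \<open>q\<close>. The second fundamental form differentiates it as \<open>q\<close> varies, which
  calls for an expression in charts that do not move.\<close>

lemma tangent_map_rep:
  assumes q: "q \<in> cdom d" "\<iota> q \<in> cdom c"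
  shows "tangent_map B A \<iota> q v = of_chart A c (\<iota> q) (frechet_derivative f (at (cmap d q)) (to_chart B d q v))"
proof -
  define d' where "d' = chart_at B q"
  have d': "d' \<in> B" "q \<in> cdom d'" using N.chart_at by (auto simp: d'_def)
  define S where "S = cmap d' ` (cdom d' \<inter> cdom d \<inter> \<iota> -` cdom c)"
  have S: "open S" unfolding S_def
    using open_preimage N.open_cdom[OF d] N.open_cdom[OF d'(1)] by (intro N.open_cmap_image[OF d'(1)]) auto
  have Sq: "cmap d' q \<in> S" using q d' by (auto simp: S_def)
  have "(cmap d \<circ> cinv d' has_derivative to_chart B d q) (at (cmap d' q))"
    using N.jac_has_derivative[OF d'(1) d d'(2) q(1)] by (simp add: to_chart_jac d'_def)
  moreover have "(f has_derivative frechet_derivative f (at (cmap d q))) (at ((cmap d \<circ> cinv d') (cmap d' q)))"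
    using f_has_derivative[OF cmap_in_U[OF q]] d' by (simp add: N.cinv_cmap)
  ultimately have "(f \<circ> (cmap d \<circ> cinv d') has_derivative
      frechet_derivative f (at (cmap d q)) \<circ> to_chart B d q) (at (cmap d' q))"
    by (rule diff_chain_at)
  then have "((\<lambda>y. cmap c (\<iota> (cinv d' y))) has_derivative
      (\<lambda>v. frechet_derivative f (at (cmap d q)) (to_chart B d q v))) (at (cmap d' q))"
    unfolding o_def
    by (rule has_derivative_transform_within_open[OF _ S Sq])
       (auto simp: S_def f_def N.cinv_cmap[OF d] N.cinv_cmap[OF d'(1)])
  moreover have "\<iota> (cinv d' y) \<in> cdom c" if "y \<in> S" for y
    using that by (auto simp: S_def N.cinv_cmap[OF d'(1)])
  moreover have "cinv d' (cmap d' q) = q" using d' by (simp add: N.cinv_cmap)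
  ultimately have "((\<lambda>y. cmap (chart_at A (\<iota> q)) (\<iota> (cinv d' y))) has_derivative
      (\<lambda>v. jac c (chart_at A (\<iota> q)) (\<iota> q) (frechet_derivative f (at (cmap d q)) (to_chart B d q v)))) (at (cmap d' q))"
    using M.has_derivative_change_chart[OF M.chart_at(1) c S Sq, of "\<lambda>y. \<iota> (cinv d' y)" "\<iota> q"] M.chart_at(2) by simp
  from frechet_derivative_at[OF this, symmetric] show ?thesis
    by (simp add: tangent_map_def of_chart_jac d'_def o_def)
qed

lemma tangent_map_of_chart:
  assumes q: "q \<in> cdom d" "\<iota> q \<in> cdom c"
  shows "tangent_map B A \<iota> q (of_chart B d q v) = of_chart A c (\<iota> q) (frechet_derivative f (at (cmap d q)) v)"
  using tangent_map_rep[OF q] N.to_of_chart[OF d q(1)] by simp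

lemma inj_df:
  assumes "u \<in> U"
  shows "inj (frechet_derivative f (at u))"
proof -
  obtain q where q: "q \<in> cdom d" "\<iota> q \<in> cdom c" "u = cmap d q" using assms by (rule U_cases)
  have "inj (tangent_map B A \<iota> q)" using sub by (auto simp: submanifold_def)
  then show ?thesis
    using tangent_map_of_chart[OF q(1,2)] N.to_of_chart[OF d q(1)] unfolding q(3)
    by (metis injI injD)
qed

end

lemma tangent_map_linear: "linear (tangent_map B A \<iota> q)"
proof -
  let ?c = "chart_at A (\<iota> q)" and ?d = "chart_at B q"
  have "tangent_map B A \<iota> q = frechet_derivative (f ?c ?d) (at (cmap ?d q))"
    using tangent_map_rep[OF M.chart_at(1) N.chart_at(1) N.chart_at(2) M.chart_at(2)]
    by (auto simp: M.of_chart_self N.to_chart_self)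
  with has_derivative_linear[OF f_has_derivative[OF M.chart_at(1) N.chart_at(1)
      cmap_in_U[OF M.chart_at(1) N.chart_at(1) N.chart_at(2) M.chart_at(2)]]]
  show ?thesis by simp
qed

end

subsection \<open>Metric contact pairs in a chart\<close>

lemma ext_deriv_rep_antisym: "ext_deriv_rep a x v w = - ext_deriv_rep a x w v"
  by (simp add: ext_deriv_rep_def diff_divide_distrib)

lemma ext_deriv_rep_has_derivative:
  fixes a :: "'e::euclidean_space \<Rightarrow> 'e \<Rightarrow> real"
  assumes V: "open V" "x \<in> V" and a: "\<And>v. smooth_on V (\<lambda>y. a y v)"
  shows "((\<lambda>y. ext_deriv_rep a y v w) has_derivative
      (\<lambda>h. (frechet_derivative (\<lambda>y. frechet_derivative (\<lambda>z. a z w) (at y) v) (at x) h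
         - frechet_derivative (\<lambda>y. frechet_derivative (\<lambda>z. a z v) (at y) w) (at x) h) / 2)) (at x)"
proof -
  have "((\<lambda>y. frechet_derivative (\<lambda>z. a z w) (at y) v) has_derivative
      frechet_derivative (\<lambda>y. frechet_derivative (\<lambda>z. a z w) (at y) v) (at x)) (at x)" for v w
    by (intro smooth_on_has_derivative[OF _ V(2)] smooth_on_frechet_derivative a)
  note * = has_derivative_diff[OF this this]
  have "bounded_linear (\<lambda>r::real. r / 2)" by (rule bounded_linear_divide)
  from bounded_linear.has_derivative[OF this *] show ?thesis by (simp add: ext_deriv_rep_def)
qed

text \<open>This is d(d\<alpha>) = 0: the six second derivatives cancel in pairs by
  symmetry.\<close>

lemma ext_deriv_rep_closed:
  fixes a :: "'e::euclidean_space \<Rightarrow> 'e \<Rightarrow> real"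
  assumes V: "open V" "x \<in> V" and a: "\<And>v. smooth_on V (\<lambda>y. a y v)"
  shows "frechet_derivative (\<lambda>y. ext_deriv_rep a y v w) (at x) h
      + frechet_derivative (\<lambda>y. ext_deriv_rep a y w h) (at x) v
      + frechet_derivative (\<lambda>y. ext_deriv_rep a y h v) (at x) w = 0"
proof -
  have fd: "frechet_derivative (\<lambda>y. ext_deriv_rep a y v w) (at x) h =
      (frechet_derivative (\<lambda>y. frechet_derivative (\<lambda>z. a z w) (at y) v) (at x) h
         - frechet_derivative (\<lambda>y. frechet_derivative (\<lambda>z. a z v) (at y) w) (at x) h) / 2" for v w h
    using frechet_derivative_at[OF ext_deriv_rep_has_derivative[OF V a], symmetric] by simp
  show ?thesis
    unfolding fd
    using second_derivative_symmetric[OF V a, of w v h] second_derivative_symmetric[OF V a, of v w h]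
      second_derivative_symmetric[OF V a, of h v w]
    by (simp add: field_simps)
qed

text \<open>The components of a metric contact pair on the image \<open>V\<close> of a chart; \<open>christoffel_form\<close> is
  \<open>G(\<Gamma>(v,w), n)\<close> by the Koszul formula.\<close>

locale mcp_chart =
  fixes V :: "'e::euclidean_space set" and G :: "'e \<Rightarrow> 'e \<Rightarrow> 'e \<Rightarrow> real" and \<Phi> :: "'e \<Rightarrow> 'e \<Rightarrow> 'e"
    and \<alpha>1 \<alpha>2 :: "'e \<Rightarrow> 'e \<Rightarrow> real" and \<zeta>1 \<zeta>2 :: "'e \<Rightarrow> 'e"
  assumes V: "open V"
    and G: "x \<in> V \<Longrightarrow> inner_form (G x)" and G_smooth: "smooth_on V (\<lambda>x. G x v w)"
    and \<Phi>: "x \<in> V \<Longrightarrow> linear (\<Phi> x)" and \<Phi>_smooth: "smooth_on V (\<lambda>x. \<Phi> x v)"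
    and \<alpha>: "x \<in> V \<Longrightarrow> linear (\<alpha>1 x)" "x \<in> V \<Longrightarrow> linear (\<alpha>2 x)"
    and \<alpha>_smooth: "smooth_on V (\<lambda>x. \<alpha>1 x v)" "smooth_on V (\<lambda>x. \<alpha>2 x v)"
    and \<zeta>_smooth: "smooth_on V \<zeta>1" "smooth_on V \<zeta>2"
    and \<Phi>2: "x \<in> V \<Longrightarrow> \<Phi> x (\<Phi> x v) = - v + \<alpha>1 x v *\<^sub>R \<zeta>1 x + \<alpha>2 x v *\<^sub>R \<zeta>2 x"
    and \<Phi>\<zeta>: "x \<in> V \<Longrightarrow> \<Phi> x (\<zeta>1 x) = 0" "x \<in> V \<Longrightarrow> \<Phi> x (\<zeta>2 x) = 0"
    and G\<zeta>: "x \<in> V \<Longrightarrow> G x v (\<zeta>1 x) = \<alpha>1 x v" "x \<in> V \<Longrightarrow> G x v (\<zeta>2 x) = \<alpha>2 x v"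
    and \<alpha>\<zeta>: "x \<in> V \<Longrightarrow> \<alpha>1 x (\<zeta>1 x) = 1" "x \<in> V \<Longrightarrow> \<alpha>1 x (\<zeta>2 x) = 0"
      "x \<in> V \<Longrightarrow> \<alpha>2 x (\<zeta>1 x) = 0" "x \<in> V \<Longrightarrow> \<alpha>2 x (\<zeta>2 x) = 1"
    and G\<Phi>: "x \<in> V \<Longrightarrow> G x v (\<Phi> x w) = ext_deriv_rep \<alpha>1 x v w + ext_deriv_rep \<alpha>2 x v w"
    and reeb: "x \<in> V \<Longrightarrow> ext_deriv_rep \<alpha>1 x (\<zeta>1 x) v = 0" "x \<in> V \<Longrightarrow> ext_deriv_rep \<alpha>1 x (\<zeta>2 x) v = 0"
      "x \<in> V \<Longrightarrow> ext_deriv_rep \<alpha>2 x (\<zeta>1 x) v = 0" "x \<in> V \<Longrightarrow> ext_deriv_rep \<alpha>2 x (\<zeta>2 x) v = 0"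
begin

abbreviation "dG x h v w \<equiv> frechet_derivative (\<lambda>y. G y v w) (at x) h"
abbreviation "d\<Phi> x h v \<equiv> frechet_derivative (\<lambda>y. \<Phi> y v) (at x) h"

definition "christoffel_form x v w n = (dG x v w n + dG x w v n - dG x n v w) / 2"

lemma \<Phi>_skew: "x \<in> V \<Longrightarrow> G x v (\<Phi> x w) = - G x (\<Phi> x v) w"
  using G\<Phi>[of x v w] G\<Phi>[of x w v] inner_form_commute[OF G, of x "\<Phi> x v" w]
    ext_deriv_rep_antisym[of \<alpha>1 x v w] ext_deriv_rep_antisym[of \<alpha>2 x v w] by simp

lemma G_bilinear: "x \<in> V \<Longrightarrow> bilinear (G x)"
  using G by (auto simp: inner_form_def)

lemma dG_sym: "x \<in> V \<Longrightarrow> dG x h v w = dG x h w v"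
proof -
  assume x: "x \<in> V"
  have "((\<lambda>y. G y w v) has_derivative frechet_derivative (\<lambda>y. G y v w) (at x)) (at x)"
    by (rule has_derivative_transform_within_open[OF smooth_on_has_derivative[OF G_smooth x] V x])
       (rule inner_form_commute[OF G])
  from frechet_derivative_at[OF this] show ?thesis by simp
qed

lemma dG_bilinear: "x \<in> V \<Longrightarrow> bilinear (dG x h)"
  unfolding bilinear_def
  by (intro conjI allI linear_frechet_derivative_family[OF V] smooth_on_differentiable[OF G_smooth])
     (auto simp: inner_form_linear[OF G])

lemma dG_linear: "x \<in> V \<Longrightarrow> linear (\<lambda>h. dG x h v w)"
  by (intro linear_frechet_derivative smooth_on_differentiable[OF G_smooth])

lemma christoffel_form_linear:
  assumes "x \<in> V"
  shows "linear (\<lambda>v. christoffel_form x v w n)" "linear (\<lambda>w. christoffel_form x v w n)"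
    "linear (\<lambda>n. christoffel_form x v w n)"
proof -
  note l = dG_bilinear[OF assms, unfolded bilinear_def] dG_linear[OF assms]
  show "linear (\<lambda>v. christoffel_form x v w n)" "linear (\<lambda>w. christoffel_form x v w n)"
    "linear (\<lambda>n. christoffel_form x v w n)"
    unfolding christoffel_form_def linear_iff
    using l by (auto simp: linear_add[of "dG x _ _"] linear_add[of "\<lambda>v. dG x _ v _"] linear_add[of "\<lambda>h. dG x h _ _"]
        linear_scale[of "dG x _ _"] linear_scale[of "\<lambda>v. dG x _ v _"] linear_scale[of "\<lambda>h. dG x h _ _"] field_simps)
qed

section \<open>The derivative of the fundamental form at a point\<close>

context
  fixes x assumes x: "x \<in> V"
begin

text \<open>The derivative along \<open>h\<close> of the single component \<Omega>(v,w) = G(v,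
  \<Phi> w), with \<open>v\<close> and \<open>w\<close> constant, by the product rule. The exterior
  derivative of \<Omega> is, up to a factor, the cyclic sum of these.\<close>

definition "d\<Omega> h v w = dG x h v (\<Phi> x w) + G x v (d\<Phi> x h w)"

lemma fundamental_form_has_derivative:
  "((\<lambda>y. ext_deriv_rep \<alpha>1 y v w + ext_deriv_rep \<alpha>2 y v w) has_derivative (\<lambda>h. d\<Omega> h v w)) (at x)"
proof -
  have "((\<lambda>y. G y v (\<Phi> y w)) has_derivative (\<lambda>h. dG x h v (\<Phi> x w) + G x v (d\<Phi> x h w) + G x 0 (\<Phi> x w))) (at x)"
    by (intro has_derivative_bilinear_family[OF V x] G_bilinear smooth_on_differentiable[OF G_smooth x]
        smooth_on_has_derivative[OF \<Phi>_smooth x] has_derivative_const)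
  then have "((\<lambda>y. G y v (\<Phi> y w)) has_derivative (\<lambda>h. d\<Omega> h v w)) (at x)"
    by (simp add: d\<Omega>_def inner_form_simps[OF G[OF x]])
  then show ?thesis
    by (rule has_derivative_transform_within_open[OF _ V x]) (rule G\<Phi>)
qed

text \<open>The same derivative computed from the contact forms. The comparison turns d(d\<alpha>) =
  0 into an identity between derivatives of \<open>G\<close> and \<open>\<Phi>\<close>.\<close>

lemma d\<Omega>_eq: "d\<Omega> h v w = frechet_derivative (\<lambda>y. ext_deriv_rep \<alpha>1 y v w) (at x) h
    + frechet_derivative (\<lambda>y. ext_deriv_rep \<alpha>2 y v w) (at x) h"
proof -
  have "((\<lambda>y. ext_deriv_rep a y v w) has_derivative frechet_derivative (\<lambda>y. ext_deriv_rep a y v w) (at x)) (at x)"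
    if "\<And>v. smooth_on V (\<lambda>y. a y v)" for a
    by (rule iffD1[OF frechet_derivative_works differentiableI[OF ext_deriv_rep_has_derivative[OF V x that]]])
  from has_derivative_unique[OF fundamental_form_has_derivative
      has_derivative_add[OF this[OF \<alpha>_smooth(1)] this[OF \<alpha>_smooth(2)]]]
  show ?thesis by (rule fun_cong)
qed

lemma d\<Omega>_cyclic: "d\<Omega> h v w + d\<Omega> v w h + d\<Omega> w h v = 0"
  using ext_deriv_rep_closed[where a = \<alpha>1, OF V x \<alpha>_smooth(1), where v = v and w = w and h = h]
    ext_deriv_rep_closed[where a = \<alpha>2, OF V x \<alpha>_smooth(2), where v = v and w = w and h = h]
  by (simp add: d\<Omega>_eq)

lemma d\<Omega>_antisym: "d\<Omega> h v w = - d\<Omega> h w v"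
proof -
  have "((\<lambda>y. ext_deriv_rep \<alpha>1 y v w + ext_deriv_rep \<alpha>2 y v w) has_derivative (\<lambda>h. - d\<Omega> h w v)) (at x)"
    using has_derivative_minus[OF fundamental_form_has_derivative[of w v]]
    by (simp add: ext_deriv_rep_antisym[of _ _ w v] add.commute)
  from has_derivative_unique[OF fundamental_form_has_derivative this] show ?thesis by (rule fun_cong)
qed

text \<open>Differentiate G(\<Phi> E, \<Phi> E) = G(E, E) - \<alpha>1(E)^2 - \<alpha>2(E)^2 with
  constant components \<open>E\<close>. Such a field is horizontal at \<open>x\<close> only, but
  this suffices for the squares to have derivative 0 there.\<close>

lemma dG_horizontal:
  assumes E: "\<alpha>1 x E = 0" "\<alpha>2 x E = 0"
  shows "dG x n (\<Phi> x E) (\<Phi> x E) + 2 * G x (d\<Phi> x n E) (\<Phi> x E) = dG x n E E"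
proof -
  have eq: "G y (\<Phi> y E) (\<Phi> y E) = G y E E - \<alpha>1 y E * \<alpha>1 y E - \<alpha>2 y E * \<alpha>2 y E" if y: "y \<in> V" for y
  proof -
    have "G y (\<Phi> y E) (\<Phi> y E) = - G y E (\<Phi> y (\<Phi> y E))" using \<Phi>_skew[OF y, of E "\<Phi> y E"] by simp
    then show ?thesis by (simp add: \<Phi>2[OF y] G\<zeta>[OF y] inner_form_simps[OF G[OF y]])
  qed
  have "((\<lambda>y. G y (\<Phi> y E) (\<Phi> y E)) has_derivative (\<lambda>h. dG x h (\<Phi> x E) (\<Phi> x E) + G x (\<Phi> x E) (d\<Phi> x h E)
      + G x (d\<Phi> x h E) (\<Phi> x E))) (at x)"
    by (intro has_derivative_bilinear_family[OF V x] G_bilinear smooth_on_differentiable[OF G_smooth x]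
        smooth_on_has_derivative[OF \<Phi>_smooth x])
  then have 1: "((\<lambda>y. G y E E - \<alpha>1 y E * \<alpha>1 y E - \<alpha>2 y E * \<alpha>2 y E) has_derivative
      (\<lambda>h. dG x h (\<Phi> x E) (\<Phi> x E) + G x (\<Phi> x E) (d\<Phi> x h E) + G x (d\<Phi> x h E) (\<Phi> x E))) (at x)"
    by (rule has_derivative_transform_within_open[OF _ V x eq])
  have 2: "((\<lambda>y. G y E E - \<alpha>1 y E * \<alpha>1 y E - \<alpha>2 y E * \<alpha>2 y E) has_derivative (\<lambda>h. dG x h E E)) (at x)"
    using E by (auto intro!: derivative_eq_intros smooth_on_has_derivative[OF G_smooth x]
        smooth_on_has_derivative[OF \<alpha>_smooth(1) x] smooth_on_has_derivative[OF \<alpha>_smooth(2) x])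
  show ?thesis
    using fun_cong[OF has_derivative_unique[OF 1 2], of n] inner_form_commute[OF G[OF x], of "\<Phi> x E" "d\<Phi> x n E"] by simp
qed

text \<open>The closedness of the fundamental form, evaluated on \<open>E\<close>, \<open>\<Phi> E\<close>, \<open>n\<close>. In a Kaehler manifold it is
  the normal component of \<open>\<nabla>\<^sub>E E + \<nabla>\<^sub>J\<^sub>E J E\<close>.\<close>

lemma horizontal_identity:
  assumes E: "\<alpha>1 x E = 0" "\<alpha>2 x E = 0"
  shows "christoffel_form x E E n + christoffel_form x (\<Phi> x E) (\<Phi> x E) n
    + G x n (d\<Phi> x (\<Phi> x E) E) - G x n (d\<Phi> x E (\<Phi> x E)) = 0"
proof -
  let ?F = "\<Phi> x E"
  have FF: "\<Phi> x ?F = - E" using \<Phi>2[OF x] E by simp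
  have neg: "dG x h v (- w) = - dG x h v w" for h v w
    using dG_bilinear[OF x, of h] by (simp add: bilinear_def linear_neg[of "\<lambda>w. dG x h v w"])
  have 1: "d\<Omega> E ?F n = dG x E n E - G x n (d\<Phi> x E ?F)"
    using d\<Omega>_antisym[of E ?F n] by (simp add: d\<Omega>_def FF neg)
  have 2: "d\<Omega> ?F n E = dG x ?F n ?F + G x n (d\<Phi> x ?F E)" by (simp add: d\<Omega>_def)
  \<comment> \<open>Antisymmetry and \<open>dG_horizontal\<close> eliminate the derivative of
    \<open>\<Phi>\<close> along \<open>n\<close>. What remains are the derivatives of the metric
    along \<open>n\<close> in the two Koszul formulas.\<close>
  have 3: "d\<Omega> n E ?F = - (dG x n E E + dG x n ?F ?F) / 2"
    using d\<Omega>_antisym[of n E ?F] dG_horizontal[OF E, of n] inner_form_commute[OF G[OF x], of ?F "d\<Phi> x n E"]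
    by (simp add: d\<Omega>_def)
  show ?thesis using d\<Omega>_cyclic[of E ?F n] dG_sym[OF x, of E n E] dG_sym[OF x, of ?F n ?F]
    unfolding 1 2 3 christoffel_form_def by (simp add: field_simps)
qed

text \<open>A combination \<open>W\<close> of the Reeb fields with constant coefficients has constant length and is dual to
  a form \<open>\<beta>\<close> with \<open>d\<beta>(W, \<cdot>) = 0\<close>; hence \<open>\<nabla>\<^sub>W W = 0\<close>.\<close>

lemma reeb_geodesic:
  fixes a b :: real
  defines "W \<equiv> a *\<^sub>R \<zeta>1 x + b *\<^sub>R \<zeta>2 x"
    and "dW \<equiv> \<lambda>h. a *\<^sub>R frechet_derivative \<zeta>1 (at x) h + b *\<^sub>R frechet_derivative \<zeta>2 (at x) h"
  shows "G x n (dW W) + christoffel_form x W W n = 0"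
proof -
  define w where "w y = a *\<^sub>R \<zeta>1 y + b *\<^sub>R \<zeta>2 y" for y
  define \<beta> where "\<beta> y v = a * \<alpha>1 y v + b * \<alpha>2 y v" for y v
  define d\<beta> where "d\<beta> h v = a * frechet_derivative (\<lambda>y. \<alpha>1 y v) (at x) h + b * frechet_derivative (\<lambda>y. \<alpha>2 y v) (at x) h" for h v
  have w: "(w has_derivative dW) (at x)" unfolding w_def[abs_def] dW_def
    by (intro has_derivative_add has_derivative_scaleR_right smooth_on_has_derivative[OF \<zeta>_smooth(1) x]
        smooth_on_has_derivative[OF \<zeta>_smooth(2) x])
  have wx: "w x = W" by (simp add: w_def W_def)
  have \<beta>: "((\<lambda>y. \<beta> y v) has_derivative (\<lambda>h. d\<beta> h v)) (at x)" for v unfolding \<beta>_def d\<beta>_def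
    by (intro has_derivative_add has_derivative_mult_right smooth_on_has_derivative[OF \<alpha>_smooth(1) x]
        smooth_on_has_derivative[OF \<alpha>_smooth(2) x])
  have \<beta>_lin: "linear (\<beta> y)" if "y \<in> V" for y
    using \<alpha>[OF that] unfolding \<beta>_def linear_iff by (simp add: algebra_simps)
  have Gw: "G y v (w y) = \<beta> y v" if "y \<in> V" for y v
    using that by (simp add: w_def \<beta>_def inner_form_simps[OF G] G\<zeta>)
  have 1: "dG x h v W + G x v (dW h) = d\<beta> h v" for h v
  proof -
    have "((\<lambda>y. G y v (w y)) has_derivative (\<lambda>h. dG x h v (w x) + G x v (dW h) + G x 0 (w x))) (at x)"
      by (intro has_derivative_bilinear_family[OF V x] G_bilinear smooth_on_differentiable[OF G_smooth x] w has_derivative_const)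
    then have "((\<lambda>y. \<beta> y v) has_derivative (\<lambda>h. dG x h v (w x) + G x v (dW h) + G x 0 (w x))) (at x)"
      by (rule has_derivative_transform_within_open[OF _ V x Gw])
    from fun_cong[OF has_derivative_unique[OF this \<beta>], of h] show ?thesis
      by (simp add: wx inner_form_simps[OF G[OF x]])
  qed
  \<comment> \<open>From the constancy of \<beta>(w) = a^2 + b^2.\<close>
  have 2: "d\<beta> h W + \<beta> x (dW h) = 0" for h
  proof -
    have fr: "frechet_derivative (\<lambda>y. \<beta> y v) (at x) h = d\<beta> h v" for h v
      using frechet_derivative_at[OF \<beta>, symmetric] by (rule fun_cong)
    have "((\<lambda>y. \<beta> y (w y)) has_derivative
        (\<lambda>h. frechet_derivative (\<lambda>y. \<beta> y (w x)) (at x) h + \<beta> x (dW h))) (at x)"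
      by (intro has_derivative_linear_family[OF V x] \<beta>_lin w) (auto intro: differentiableI[OF \<beta>])
    then have "((\<lambda>y. a * a + b * b) has_derivative (\<lambda>h. d\<beta> h W + \<beta> x (dW h))) (at x)"
      unfolding fr wx
      by (rule has_derivative_transform_within_open[OF _ V x])
         (simp add: \<beta>_def w_def linear_add[OF \<alpha>(1)] linear_add[OF \<alpha>(2)] linear_scale[OF \<alpha>(1)] linear_scale[OF \<alpha>(2)] \<alpha>\<zeta>)
    from fun_cong[OF has_derivative_unique[OF this has_derivative_const]] show ?thesis by simp
  qed
  \<comment> \<open>The Reeb conditions place \<open>W\<close> in the kernel of the exterior
    derivative of \<open>\<beta>\<close>.\<close>
  have 3: "d\<beta> W n = d\<beta> n W"
  proof -
    have r: "frechet_derivative (\<lambda>y. a y n) (at x) W = frechet_derivative (\<lambda>y. a y W) (at x) n"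
      if lin: "\<And>y. y \<in> V \<Longrightarrow> linear (a y)" and sm: "\<And>v. smooth_on V (\<lambda>y. a y v)"
        and z: "ext_deriv_rep a x (\<zeta>1 x) n = 0" "ext_deriv_rep a x (\<zeta>2 x) n = 0" for a
    proof -
      note l1 = linear_frechet_derivative[OF smooth_on_differentiable[OF sm x]]
      have l2: "linear (\<lambda>v. frechet_derivative (\<lambda>y. a y v) (at x) n)"
        by (rule linear_frechet_derivative_family[OF V x lin smooth_on_differentiable[OF sm x]])
      show ?thesis
        using z by (simp add: W_def ext_deriv_rep_def linear_add[OF l1] linear_scale[OF l1] linear_add[OF l2] linear_scale[OF l2])
    qed
    show ?thesis
      using r[OF \<alpha>(1) \<alpha>_smooth(1) reeb(1,2)[OF x]] r[OF \<alpha>(2) \<alpha>_smooth(2) reeb(3,4)[OF x]] by (simp add: d\<beta>_def)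
  qed
  have "\<beta> x (dW n) = G x W (dW n)"
    using Gw[OF x, of "dW n"] inner_form_commute[OF G[OF x], of W] by (simp add: wx)
  then show ?thesis
    using 1[of W n] 1[of n W] 2[of n] 3 dG_sym[OF x, of W n W] by (simp add: christoffel_form_def field_simps)
qed

end

end

subsection \<open>Invariant immersions in a chart\<close>

text \<open>\<open>A\<close> and \<open>B\<close> stand for the functions \<open>a\<close> and
  \<open>b\<close>, primes for their derivatives along \<open>X\<close>, and \<open>p\<close>,
  \<open>q\<close> for \<alpha>1(n), \<alpha>2(n). The first two assumptions eliminate
  \<open>q\<close> and \<open>B'\<close>; the factor 2 B^2 keeps \<open>B\<close> out of the
  denominators.\<close>

lemma curvature_algebra:
  fixes A B p q A' B' :: real
  assumes "A * p + B * q = 0" "A' = 2 * A * A' + 2 * B * B'" "A = A\<^sup>2 + B\<^sup>2" "A > 0"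
  shows "(A' * p + B' * q) / A * (2 * B\<^sup>2) = p * A'"
proof -
  have "(A' * p + B' * q) * (2 * B\<^sup>2) = 2 * B\<^sup>2 * A' * p + (2 * B * B') * (B * q)"
    by (simp add: power2_eq_square algebra_simps)
  also have "\<dots> = 2 * B\<^sup>2 * A' * p + (A' - 2 * A * A') * (- (A * p))"
    using assms(1,2) by (metis add.commute add_diff_cancel_left' eq_neg_iff_add_eq_0)
  also have "\<dots> = p * A' * (2 * (A\<^sup>2 + B\<^sup>2) - A)" by (simp add: power2_eq_square algebra_simps)
  also have "\<dots> = p * A' * A" using assms(3) by simp
  finally show ?thesis using assms(4) by (simp add: field_simps)
qed

text \<open>The submanifold in one pair of charts, \<open>f\<close> being the inclusion in
  coordinates. In \<open>not_orthogonal\<close> the form \<open>\<alpha>1\<close> stands for the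
  inner product with \<open>\<zeta>1\<close>.\<close>

locale invariant_immersion = mcp_chart V G \<Phi> \<alpha>1 \<alpha>2 \<zeta>1 \<zeta>2
  for V :: "'e::euclidean_space set" and G :: "'e \<Rightarrow> 'e \<Rightarrow> 'e \<Rightarrow> real" and \<Phi> :: "'e \<Rightarrow> 'e \<Rightarrow> 'e"
    and \<alpha>1 \<alpha>2 :: "'e \<Rightarrow> 'e \<Rightarrow> real" and \<zeta>1 \<zeta>2 :: "'e \<Rightarrow> 'e" +
  fixes U :: "'f::euclidean_space set" and f :: "'f \<Rightarrow> 'e"
  assumes U: "open U" and f_smooth: "smooth_on U f" and f_in: "u \<in> U \<Longrightarrow> f u \<in> V"
    and inj_df: "u \<in> U \<Longrightarrow> inj (frechet_derivative f (at u))"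
    and invariant: "u \<in> U \<Longrightarrow> \<Phi> (f u) (frechet_derivative f (at u) v) \<in> range (frechet_derivative f (at u))"
    and not_tangent: "u \<in> U \<Longrightarrow> \<zeta>1 (f u) \<notin> range (frechet_derivative f (at u))"
    and not_orthogonal: "u \<in> U \<Longrightarrow> \<exists>s. \<alpha>1 (f u) (frechet_derivative f (at u) s) \<noteq> 0"
begin

abbreviation "df u v \<equiv> frechet_derivative f (at u) v"
abbreviation "ddf u v w \<equiv> frechet_derivative (\<lambda>u. df u w) (at u) v"

text \<open>\<open>X\<close> takes values in the parameter space: it is Z1T in a chart of N, where
  it can be differentiated and integrated, and \<open>df u (X u)\<close> is the tangential part of
  \<open>\<zeta>1\<close>.\<close>

definition "X u = (THE y. \<forall>s. G (f u) (\<zeta>1 (f u) - df u y) (df u s) = 0)"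
definition "a u = \<alpha>1 (f u) (df u (X u))"
definition "b u = \<alpha>2 (f u) (df u (X u))"

lemma df_linear: "u \<in> U \<Longrightarrow> linear (df u)"
  by (intro linear_frechet_derivative smooth_on_differentiable[OF f_smooth])

lemma X: "u \<in> U \<Longrightarrow> G (f u) (\<zeta>1 (f u) - df u (X u)) (df u s) = 0"
proof -
  assume u: "u \<in> U"
  obtain t where t: "t \<in> range (df u)" "\<forall>s\<in>range (df u). G (f u) (\<zeta>1 (f u) - t) s = 0"
    and uniq: "\<And>t'. t' \<in> range (df u) \<and> (\<forall>s\<in>range (df u). G (f u) (\<zeta>1 (f u) - t') s = 0) \<Longrightarrow> t' = t"
    using orthogonal_projection_ex1[OF G[OF f_in[OF u]] df_linear[OF u] inj_df[OF u], of "\<zeta>1 (f u)"] by blast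
  obtain y where y: "t = df u y" using t by auto
  have "\<forall>s. G (f u) (\<zeta>1 (f u) - df u (X u)) (df u s) = 0"
    unfolding X_def
  proof (rule theI)
    show "\<forall>s. G (f u) (\<zeta>1 (f u) - df u y) (df u s) = 0" using t y by auto
    fix y' assume "\<forall>s. G (f u) (\<zeta>1 (f u) - df u y') (df u s) = 0"
    then have "df u y' = df u y" using uniq[of "df u y'"] y by auto
    then show "y' = y" using inj_df[OF u] by (auto dest: injD)
  qed
  then show ?thesis by blast
qed

lemma point:
  assumes u: "u \<in> U"
  shows "invariant_subspace (G (f u)) (\<Phi> (f u)) (\<alpha>1 (f u)) (\<alpha>2 (f u)) (\<zeta>1 (f u)) (\<zeta>2 (f u))
    (df u (X u)) (range (df u))"
proof -
  note x = f_in[OF u]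
  obtain s where s: "\<alpha>1 (f u) (df u s) \<noteq> 0" using not_orthogonal[OF u] by blast
  have "\<exists>s\<in>range (df u). G (f u) (\<zeta>1 (f u)) s \<noteq> 0"
    using s by (auto simp: inner_form_commute[OF G[OF x], of "\<zeta>1 (f u)"] G\<zeta>[OF x])
  then show ?thesis
    using not_tangent[OF u] X[OF u] invariant[OF u]
    by (unfold_locales)
       (auto simp: G linear_add[OF \<Phi>[OF x]] linear_scale[OF \<Phi>[OF x]] \<Phi>2 \<Phi>\<zeta> G\<zeta> \<alpha>\<zeta> x intro!: \<Phi>_skew linear_subspace_image[OF df_linear[OF u] subspace_UNIV])
qed

lemma df_X: "u \<in> U \<Longrightarrow> df u (X u) = a u *\<^sub>R \<zeta>1 (f u) + b u *\<^sub>R \<zeta>2 (f u)"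
  unfolding a_def b_def by (rule invariant_subspace.t_eq[OF point])

lemma a_eq: "u \<in> U \<Longrightarrow> a u = (a u)\<^sup>2 + (b u)\<^sup>2"
  unfolding a_def b_def by (rule invariant_subspace.a1_t_eq[OF point])

lemma a_pos: "u \<in> U \<Longrightarrow> a u > 0"
  unfolding a_def by (rule invariant_subspace.a1_t_pos[OF point])

lemma b_nonzero: "u \<in> U \<Longrightarrow> b u \<noteq> 0"
  unfolding b_def by (rule invariant_subspace.a2_t_nonzero[OF point])

lemma f_C1: "C1_on U f" and df_C1: "C1_on U (\<lambda>u. df u v)"
  by (auto intro: smooth_on_C1 smooth_on_frechet_derivative f_smooth)

lemma C1_pullback: "smooth_on V h \<Longrightarrow> C1_on U (\<lambda>u. h (f u))"
  using f_in by (intro C1_on_compose[OF f_C1 smooth_on_C1]) auto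

lemma C1_G_df: "C1_on U (\<lambda>u. G (f u) (df u v) (df u w))"
proof -
  have "C1_on U (\<lambda>u. G (f u) e (df u w))" for e
    by (rule C1_on_linear_family[where F = "\<lambda>u. G (f u) e", OF U _ C1_pullback[OF G_smooth] df_C1])
       (simp add: inner_form_linear G f_in)
  then show ?thesis
    by (rule C1_on_linear_family[where F = "\<lambda>u e. G (f u) e (df u w)", OF U _ _ df_C1, rotated])
       (simp add: inner_form_linear G f_in)
qed

lemma C1_\<alpha>_df:
  assumes "C1_on U m"
  shows "C1_on U (\<lambda>u. \<alpha>1 (f u) (df u (m u)))" "C1_on U (\<lambda>u. \<alpha>2 (f u) (df u (m u)))"
proof -
  have m: "C1_on U (\<lambda>u. df u (m u))" by (rule C1_on_linear_family[OF U df_linear df_C1 assms])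
  show "C1_on U (\<lambda>u. \<alpha>1 (f u) (df u (m u)))"
    by (rule C1_on_linear_family[where F = "\<lambda>u. \<alpha>1 (f u)", OF U _ C1_pullback[OF \<alpha>_smooth(1)] m]) (simp add: \<alpha> f_in)
  show "C1_on U (\<lambda>u. \<alpha>2 (f u) (df u (m u)))"
    by (rule C1_on_linear_family[where F = "\<lambda>u. \<alpha>2 (f u)", OF U _ C1_pullback[OF \<alpha>_smooth(2)] m]) (simp add: \<alpha> f_in)
qed

text \<open>\<open>?K\<close> is the Gram matrix of the images of the Euclidean basis under
  \<open>df u\<close>, and \<open>?z\<close> pairs \<open>\<zeta>1\<close> with these images. The
  matrix is injective: if it kills \<open>y\<close>, then \<open>df u y\<close> is orthogonal to
  itself.\<close>

lemma X_C1: "C1_on U X"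
proof (rule C1_on_linear_solution[OF U])
  let ?K = "\<lambda>u y. \<Sum>e\<in>Basis. G (f u) (df u y) (df u e) *\<^sub>R e"
  let ?z = "\<lambda>u. \<Sum>e\<in>Basis. \<alpha>1 (f u) (df u e) *\<^sub>R e"
  show lin: "linear (?K u)" if u: "u \<in> U" for u
    using df_linear[OF u]
    by (auto simp: linear_iff inner_form_simps[OF G[OF f_in[OF u]]] scaleR_add_left sum.distrib scaleR_sum_right)
  show "inj (?K u)" if u: "u \<in> U" for u
  proof (rule linear_injective_0[OF lin[OF u], THEN iffD2], intro allI impI)
    fix y assume "?K u y = 0"
    then have "G (f u) (df u y) (df u e) = 0" if "e \<in> Basis" for e
      using that inner_sum_left_Basis[of e "\<lambda>e. G (f u) (df u y) (df u e)"] by simp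
    then have "(\<Sum>e\<in>Basis. (y \<bullet> e) * G (f u) (df u y) (df u e)) = 0" by simp
    moreover have "G (f u) (df u y) (df u y) = (\<Sum>e\<in>Basis. (y \<bullet> e) *\<^sub>R G (f u) (df u y) (df u e))"
      using linear_eq_sum_Basis[OF linear_compose[OF df_linear[OF u] inner_form_linear(1)[OF G[OF f_in[OF u]], of "df u y"]], of y]
      by (simp add: o_def)
    ultimately have "df u y = 0" using inner_form_eq_0[OF G[OF f_in[OF u]]] by simp
    then show "y = 0" using inj_df[OF u] linear_0[OF df_linear[OF u]] by (metis injD)
  qed
  show "C1_on U (\<lambda>u. ?K u y)" for y
    by (intro C1_on_sum C1_on_scaleR C1_G_df C1_on_const) auto
  show "C1_on U ?z"
    by (intro C1_on_sum C1_on_scaleR C1_\<alpha>_df C1_on_const) auto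
  fix u assume u: "u \<in> U"
  note x = f_in[OF u]
  show "?K u (X u) = ?z u"
    using X[OF u] G\<zeta>(1)[OF x] inner_form_commute[OF G[OF x], of "\<zeta>1 (f u)"]
    by (intro sum.cong) (auto simp: inner_form_simps[OF G[OF x]])
qed

lemma a_C1: "C1_on U a" and b_C1: "C1_on U b"
  unfolding a_def[abs_def] b_def[abs_def] by (rule C1_\<alpha>_df[OF X_C1])+

text \<open>\<open>sff_form u v w n\<close> is \<open>G(II(v,w), n)\<close> for normal vectors \<open>n\<close>.\<close>

definition "sff_form u v w n = G (f u) n (ddf u v w) + christoffel_form (f u) (df u v) (df u w) n"

section \<open>The second fundamental form tested against a normal vector\<close>

context
  fixes u n assumes u: "u \<in> U" and n: "\<And>v. G (f u) n (df u v) = 0"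
begin

interpretation linear "df u" by (rule df_linear[OF u])

lemma fu_in: "f u \<in> V" by (rule f_in[OF u])

lemma ddf_linear: "linear (\<lambda>v. ddf u v w)" "linear (\<lambda>w. ddf u v w)"
  by (auto intro!: linear_frechet_derivative linear_frechet_derivative_family[OF U u] df_linear
      smooth_on_differentiable[OF smooth_on_frechet_derivative[OF f_smooth] u])

lemma sff_form_bilinear: "bilinear (\<lambda>v w. sff_form u v w n)"
proof -
  have "linear (\<lambda>v. G (f u) n (ddf u v w) + christoffel_form (f u) (df u v) (df u w) n)" for w
    using linear_compose[OF ddf_linear(1) inner_form_linear(1)[OF G[OF fu_in]]]
      linear_compose[OF df_linear[OF u] christoffel_form_linear(1)[OF fu_in]]
    by (intro linear_compose_add) (simp_all add: o_def)
  moreover have "linear (\<lambda>w. G (f u) n (ddf u v w) + christoffel_form (f u) (df u v) (df u w) n)" for v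
    using linear_compose[OF ddf_linear(2) inner_form_linear(1)[OF G[OF fu_in]]]
      linear_compose[OF df_linear[OF u] christoffel_form_linear(2)[OF fu_in]]
    by (intro linear_compose_add) (simp_all add: o_def)
  ultimately show ?thesis by (simp add: bilinear_def sff_form_def)
qed

text \<open>Differentiate \<open>df u (y u) = \<Phi> (f u) (df u v)\<close> along \<open>w\<close>,
  where the field \<open>y\<close> has the value \<open>p\<close> at the given point. The derivative
  of \<open>y\<close> enters through a tangent vector, which \<open>n\<close> kills, so the outcome
  involves \<open>p\<close> alone.\<close>

lemma differentiate_invariance:
  assumes p: "df u p = \<Phi> (f u) (df u v)"
  shows "G (f u) n (ddf u w p) = G (f u) n (d\<Phi> (f u) (df u w) (df u v)) + G (f u) n (\<Phi> (f u) (ddf u w v))"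
proof -
  \<comment> \<open>\<open>inv\<close> merely picks the solution; its regularity comes from
    \<open>C1_on_linear_solution\<close> with the injective, non-square coefficient map
    \<open>df\<close>.\<close>
  define y where "y u = inv (df u) (\<Phi> (f u) (df u v))" for u
  have y: "df u (y u) = \<Phi> (f u) (df u v)" if "u \<in> U" for u
    unfolding y_def by (rule f_inv_into_f[OF invariant[OF that]])
  have yu: "y u = p" using y[OF u] p inj_df[OF u] by (metis injD)
  have zC: "C1_on U (\<lambda>u. \<Phi> (f u) (df u v))"
    by (rule C1_on_linear_family[OF U _ C1_pullback[OF \<Phi>_smooth] df_C1]) (simp add: \<Phi> f_in)
  have "C1_on U y" by (rule C1_on_linear_solution[OF U df_linear inj_df df_C1 zC y])
  note y' = C1_on_has_derivative[OF this u]
  have 1: "((\<lambda>u. df u (y u)) has_derivative (\<lambda>h. ddf u h (y u) + df u (frechet_derivative y (at u) h))) (at u)"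
    by (rule has_derivative_linear_family[OF U u df_linear _ y'])
       (rule smooth_on_differentiable[OF smooth_on_frechet_derivative[OF f_smooth] u] | assumption)+
  have f': "((\<lambda>u. \<Phi> (f u) e) has_derivative (\<lambda>h. d\<Phi> (f u) (df u h) e)) (at u)" for e
    using diff_chain_at[OF smooth_on_has_derivative[OF f_smooth u] smooth_on_has_derivative[OF \<Phi>_smooth fu_in]] by (simp add: o_def)
  have "((\<lambda>u. \<Phi> (f u) (df u v)) has_derivative
      (\<lambda>h. frechet_derivative (\<lambda>u'. \<Phi> (f u') (df u v)) (at u) h + \<Phi> (f u) (ddf u h v))) (at u)"
    by (rule has_derivative_linear_family[where F = "\<lambda>u. \<Phi> (f u)", OF U u \<Phi>[OF f_in] differentiableI[OF f']
          smooth_on_has_derivative[OF smooth_on_frechet_derivative[OF f_smooth] u]])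
  then have "((\<lambda>u. df u (y u)) has_derivative
      (\<lambda>h. frechet_derivative (\<lambda>u'. \<Phi> (f u') (df u v)) (at u) h + \<Phi> (f u) (ddf u h v))) (at u)"
    by (rule has_derivative_transform_within_open[OF _ U u]) (simp add: y)
  from fun_cong[OF has_derivative_unique[OF 1 this], of w]
  have "ddf u w p + df u (frechet_derivative y (at u) w)
      = d\<Phi> (f u) (df u w) (df u v) + \<Phi> (f u) (ddf u w v)"
    by (simp add: yu frechet_derivative_at[OF f', symmetric])
  from arg_cong[OF this, of "G (f u) n"] show ?thesis
    by (simp add: inner_form_simps[OF G[OF fu_in]] n)
qed

text \<open>The differentiated invariance is used twice: along \<open>p\<close> for the pair with
  image \<open>p\<close>, and along \<open>v\<close> for the pair with image \<open>- v\<close>. By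
  symmetry of second derivatives the terms with \<open>\<Phi> (f u) (ddf u p v)\<close> cancel, and
  \<open>horizontal_identity\<close> disposes of the rest.\<close>

lemma sff_form_horizontal:
  assumes v: "\<alpha>1 (f u) (df u v) = 0" "\<alpha>2 (f u) (df u v) = 0" and p: "df u p = \<Phi> (f u) (df u v)"
  shows "sff_form u v v n + sff_form u p p n = 0"
proof -
  have p2: "df u (- v) = \<Phi> (f u) (df u p)" using \<Phi>2[OF fu_in, of "df u v"] v p by (simp add: neg)
  have "ddf u v (- v) = - ddf u v v" using linear_neg[OF ddf_linear(2)] by blast
  then have "G (f u) n (ddf u v v) = - (G (f u) n (d\<Phi> (f u) (df u v) (df u p)) + G (f u) n (\<Phi> (f u) (ddf u v p)))"
    using differentiate_invariance[OF p2, of v] by (simp add: inner_form_simps[OF G[OF fu_in]])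
  moreover have "ddf u v p = ddf u p v" by (rule second_derivative_symmetric[OF U u f_smooth])
  ultimately show ?thesis
    using horizontal_identity[OF fu_in v, of n] differentiate_invariance[OF p, of p] p
    by (simp add: sff_form_def)
qed

text \<open>Differentiate df(X) = a \<zeta>1 + b \<zeta>2 along \<open>X\<close>. The part with
  \<open>a\<close> and \<open>b\<close> frozen cancels against the Christoffel term by
  \<open>reeb_geodesic\<close>; only the derivatives of \<open>a\<close> and \<open>b\<close>
  survive.\<close>

lemma sff_form_X: "sff_form u (X u) (X u) n
    = frechet_derivative a (at u) (X u) * \<alpha>1 (f u) n + frechet_derivative b (at u) (X u) * \<alpha>2 (f u) n"
proof -
  let ?h = "X u"
  let ?W = "a u *\<^sub>R \<zeta>1 (f u) + b u *\<^sub>R \<zeta>2 (f u)"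
  let ?d1 = "frechet_derivative \<zeta>1 (at (f u))" and ?d2 = "frechet_derivative \<zeta>2 (at (f u))"
  have 1: "((\<lambda>u. df u (X u)) has_derivative (\<lambda>h. ddf u h (X u) + df u (frechet_derivative X (at u) h))) (at u)"
    by (rule has_derivative_linear_family[OF U u df_linear _ C1_on_has_derivative[OF X_C1 u]])
       (rule smooth_on_differentiable[OF smooth_on_frechet_derivative[OF f_smooth] u] | assumption)+
  have z: "((\<lambda>u. \<zeta> (f u)) has_derivative (\<lambda>h. frechet_derivative \<zeta> (at (f u)) (df u h))) (at u)"
    if "smooth_on V \<zeta>" for \<zeta> :: "'e \<Rightarrow> 'e"
    using diff_chain_at[OF smooth_on_has_derivative[OF f_smooth u] smooth_on_has_derivative[OF that fu_in]] by (simp add: o_def)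
  have "((\<lambda>u. a u *\<^sub>R \<zeta>1 (f u) + b u *\<^sub>R \<zeta>2 (f u)) has_derivative
     (\<lambda>h. (a u *\<^sub>R ?d1 (df u h) + frechet_derivative a (at u) h *\<^sub>R \<zeta>1 (f u))
        + (b u *\<^sub>R ?d2 (df u h) + frechet_derivative b (at u) h *\<^sub>R \<zeta>2 (f u)))) (at u)"
    by (intro has_derivative_add has_derivative_scaleR z \<zeta>_smooth C1_on_has_derivative[OF a_C1 u] C1_on_has_derivative[OF b_C1 u])
  then have 2: "((\<lambda>u. df u (X u)) has_derivative
     (\<lambda>h. (a u *\<^sub>R ?d1 (df u h) + frechet_derivative a (at u) h *\<^sub>R \<zeta>1 (f u))
        + (b u *\<^sub>R ?d2 (df u h) + frechet_derivative b (at u) h *\<^sub>R \<zeta>2 (f u)))) (at u)"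
    by (rule has_derivative_transform_within_open[OF _ U u]) (simp add: df_X)
  from arg_cong[OF fun_cong[OF has_derivative_unique[OF 1 2], of ?h], of "G (f u) n"]
  have "G (f u) n (ddf u ?h ?h) = G (f u) n (a u *\<^sub>R ?d1 ?W + b u *\<^sub>R ?d2 ?W)
      + frechet_derivative a (at u) ?h * \<alpha>1 (f u) n + frechet_derivative b (at u) ?h * \<alpha>2 (f u) n"
    by (simp add: inner_form_simps[OF G[OF fu_in]] n G\<zeta>[OF fu_in] df_X[OF u])
  then show ?thesis
    using reeb_geodesic[OF fu_in, of n "a u" "b u"] by (simp add: sff_form_def df_X[OF u])
qed

lemma mean_curvature:
  assumes E: "orthonormal_frame (\<lambda>v w. G (f u) (df u v) (df u w)) E" "span E = UNIV"
  shows "(\<Sum>e\<in>E. sff_form u e e n) * (2 * (b u)\<^sup>2) = \<alpha>1 (f u) n * frechet_derivative a (at u) (X u)"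
proof -
  interpret I: invariant_subspace "G (f u)" "\<Phi> (f u)" "\<alpha>1 (f u)" "\<alpha>2 (f u)" "\<zeta>1 (f u)" "\<zeta>2 (f u)"
    "df u (X u)" "range (df u)" by (rule point[OF u])
  \<comment> \<open>The endomorphism induced on the tangent space, carried to the parameter space by
    the injective \<open>df u\<close>.\<close>
  define \<psi> where "\<psi> v = inv (df u) (\<Phi> (f u) (df u v))" for v
  have \<psi>: "df u (\<psi> v) = \<Phi> (f u) (df u v)" for v
    unfolding \<psi>_def by (rule f_inv_into_f[OF invariant[OF u]])
  have eqI: "v = w" if "df u v = df u w" for v w using inj_df[OF u] that by (rule injD)
  have "(\<Sum>e\<in>E. sff_form u e e n) = sff_form u (X u) (X u) n / a u"
  proof (rule trace_anti_invariant[OF inner_form_pullback[OF G[OF fu_in] df_linear[OF u] inj_df[OF u]] E sff_form_bilinear])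
    show "linear \<psi>"
      by (rule linearI; rule eqI) (simp_all add: \<psi> add scale linear_add[OF \<Phi>[OF fu_in]] linear_scale[OF \<Phi>[OF fu_in]])
    show "G (f u) (df u (\<psi> v)) (df u w) = - G (f u) (df u v) (df u (\<psi> w))" for v w
      using I.skew by (simp add: \<psi>)
    show "\<psi> (\<psi> v) = - v + (G (f u) (df u v) (df u (X u)) / a u) *\<^sub>R X u" for v
      by (rule eqI) (simp add: \<psi> add neg scale diff I.\<phi>2_tangent a_def)
    show "\<psi> (X u) = 0" by (rule eqI) (simp add: \<psi> I.\<phi>_t zero)
    \<comment> \<open>Images under \<open>\<Phi>\<close> are horizontal, as
      \<open>sff_form_horizontal\<close> requires.\<close>
    show "sff_form u (\<psi> v) (\<psi> v) n + sff_form u (\<psi> (\<psi> v)) (\<psi> (\<psi> v)) n = 0" for v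
      by (rule sff_form_horizontal) (simp_all add: \<psi> I.horizontal_\<phi>)
  qed
  moreover have "a u * \<alpha>1 (f u) n + b u * \<alpha>2 (f u) n = 0"
    using n[of "X u"] by (simp add: df_X[OF u] inner_form_simps[OF G[OF fu_in]] G\<zeta>[OF fu_in])
  moreover have "frechet_derivative a (at u) (X u) = 2 * a u * frechet_derivative a (at u) (X u)
      + 2 * b u * frechet_derivative b (at u) (X u)"
  proof -
    have "((\<lambda>u. (a u)\<^sup>2 + (b u)\<^sup>2) has_derivative
        (\<lambda>h. 2 * a u * frechet_derivative a (at u) h + 2 * b u * frechet_derivative b (at u) h)) (at u)"
      by (auto intro!: derivative_eq_intros C1_on_has_derivative[OF a_C1 u] C1_on_has_derivative[OF b_C1 u])
    then have "(a has_derivative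
        (\<lambda>h. 2 * a u * frechet_derivative a (at u) h + 2 * b u * frechet_derivative b (at u) h)) (at u)"
      by (rule has_derivative_transform_within_open[OF _ U u]) (simp add: a_eq[symmetric])
    from fun_cong[OF frechet_derivative_at[OF this], symmetric] show ?thesis by metis
  qed
  ultimately show ?thesis
    using curvature_algebra[OF _ _ a_eq[OF u] a_pos[OF u]] unfolding sff_form_X by simp
qed

end

end

text \<open>Guarantees that the \<open>THE\<close> in \<open>christoffel\<close> denotes the vector
  described by the Koszul formula.\<close>

lemma riesz_inner_form:
  fixes g :: "'a::euclidean_space \<Rightarrow> 'a \<Rightarrow> real"
  assumes g: "inner_form g" and L: "linear L"
  shows "\<exists>!t. \<forall>z. g t z = L z"
proof (rule ex_ex1I)
  obtain E where E: "orthonormal_frame g E" "span E = UNIV" using orthonormal_frame_exists[OF g] by blast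
  have "g (\<Sum>e\<in>E. L e *\<^sub>R e) z = L z" for z
  proof -
    have "L z = L (\<Sum>e\<in>E. g z e *\<^sub>R e)" by (simp add: orthonormal_expansion[OF g E])
    then show ?thesis
      by (simp add: linear_sum[OF L] linear_scale[OF L] inner_form_simps[OF g] inner_form_commute[OF g, of z] mult.commute)
  qed
  then show "\<exists>t. \<forall>z. g t z = L z" by blast
  fix t t' assume "\<forall>z. g t z = L z" "\<forall>z. g t' z = L z"
  then have "g (t - t') (t - t') = 0" by (simp add: inner_form_simps[OF g])
  then show "t = t'" using inner_form_eq_0[OF g] by force
qed

subsection \<open>Invariant submanifolds of metric contact pairs\<close>

locale mcp_submanifold = smooth_submanifold A B \<iota>
  for A :: "('m::{t2_space, second_countable_topology}, 'e::euclidean_space) chart set"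
    and B :: "('n::{t2_space, second_countable_topology}, 'f::euclidean_space) chart set"
    and \<iota> :: "'n \<Rightarrow> 'm" +
  fixes h k :: nat and \<alpha>1 \<alpha>2 :: "'m \<Rightarrow> 'e \<Rightarrow> real" and Z1 Z2 :: "'m \<Rightarrow> 'e"
    and \<phi> :: "'m \<Rightarrow> 'e \<Rightarrow> 'e" and g :: "'m \<Rightarrow> 'e \<Rightarrow> 'e \<Rightarrow> real"
  assumes mcp: "metric_contact_pair A h k \<alpha>1 \<alpha>2 Z1 Z2 \<phi> g"
    and inv_sub: "invariant_submanifold B A \<iota> \<phi>"
    and tangent: "nowhere_tangent B A \<iota> Z1" and orthogonal: "nowhere_orthogonal B A \<iota> g Z1"
begin

lemma g_inner: "inner_form (g p)"
  using mcp by (auto simp: metric_contact_pair_def riemannian_metric_def inner_form_def)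

lemma one_forms: "one_form A \<alpha>1" "one_form A \<alpha>2"
  using mcp by (auto simp: metric_contact_pair_def contact_pair_def)

lemma mcp_simps:
  "\<phi> p (\<phi> p v) = - v + \<alpha>1 p v *\<^sub>R Z1 p + \<alpha>2 p v *\<^sub>R Z2 p"
  "\<phi> p (Z1 p) = 0" "\<phi> p (Z2 p) = 0"
  "g p v (\<phi> p w) = ext_deriv A \<alpha>1 p v w + ext_deriv A \<alpha>2 p v w"
  "g p v (Z1 p) = \<alpha>1 p v" "g p v (Z2 p) = \<alpha>2 p v"
  "\<alpha>1 p (Z1 p) = 1" "\<alpha>1 p (Z2 p) = 0" "\<alpha>2 p (Z1 p) = 0" "\<alpha>2 p (Z2 p) = 1"
  "ext_deriv A \<alpha>1 p (Z1 p) v = 0" "ext_deriv A \<alpha>1 p (Z2 p) v = 0"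
  "ext_deriv A \<alpha>2 p (Z1 p) v = 0" "ext_deriv A \<alpha>2 p (Z2 p) v = 0"
  using mcp by (auto simp: metric_contact_pair_def reeb_fields_def)

text \<open>The algebraic identities transfer because \<open>to_chart\<close> and
  \<open>of_chart\<close> are mutually inverse; those involving d\<alpha> rest on
  \<open>ext_deriv_chart\<close>.\<close>

lemma chart_mcp:
  assumes c: "c \<in> A"
  shows "mcp_chart (cimg c) (bil_rep A c g) (endo_rep A c \<phi>) (form_rep A c \<alpha>1) (form_rep A c \<alpha>2)
    (vec_rep A c Z1) (vec_rep A c Z2)"
proof (rule mcp_chart.intro)
  show "open (cimg c)" by (rule M.open_cimg[OF c])
  show "smooth_on (cimg c) (\<lambda>x. bil_rep A c g x v w)" "smooth_on (cimg c) (\<lambda>x. endo_rep A c \<phi> x v)"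
    "smooth_on (cimg c) (\<lambda>x. form_rep A c \<alpha>1 x v)" "smooth_on (cimg c) (\<lambda>x. form_rep A c \<alpha>2 x v)"
    "smooth_on (cimg c) (vec_rep A c Z1)" "smooth_on (cimg c) (vec_rep A c Z2)" for v w
    using mcp c by (auto simp: metric_contact_pair_def riemannian_metric_def endomorphism_field_def
        contact_pair_def one_form_def reeb_fields_def vector_field_def)
next
  fix x assume "x \<in> cimg c"
  then obtain p where p: "p \<in> cdom c" "x = cmap c p" by (auto simp: cimg_def)
  note x = \<open>x \<in> cimg c\<close>
  note reps = p(2) M.form_rep_cmap[OF c p(1)] M.bil_rep_cmap[OF c p(1)] M.endo_rep_cmap[OF c p(1)]
    M.vec_rep_cmap[OF c p(1)] M.of_to_chart[OF c p(1)] mcp_simps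
    M.ext_deriv_chart[OF one_forms(1) c p(1), symmetric] M.ext_deriv_chart[OF one_forms(2) c p(1), symmetric]
  note tl = M.to_chart_linear[OF c p(1)] and ol = M.of_chart_linear[OF c p(1)]
  have "inj (of_chart A c p)" using M.to_of_chart[OF c p(1)] by (metis injI)
  from inner_form_pullback[OF g_inner ol this]
  show "inner_form (bil_rep A c g x)" by (simp add: M.bil_rep_cmap[OF c p(1), abs_def] p(2))
  show "linear (form_rep A c \<alpha>1 x)" "linear (form_rep A c \<alpha>2 x)"
    using M.form_rep_linear[OF _ c x] one_forms by auto
  have "linear (\<phi> p)" using mcp by (auto simp: metric_contact_pair_def endomorphism_field_def)
  from linear_compose[OF linear_compose[OF ol this] tl]
  show "linear (endo_rep A c \<phi> x)" by (simp add: M.endo_rep_cmap[OF c p(1), abs_def] p(2) o_def)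
  fix v w
  show "endo_rep A c \<phi> x (endo_rep A c \<phi> x v) = - v + form_rep A c \<alpha>1 x v *\<^sub>R vec_rep A c Z1 x
      + form_rep A c \<alpha>2 x v *\<^sub>R vec_rep A c Z2 x"
    by (simp add: reps linear_add[OF tl] linear_diff[OF tl] linear_neg[OF tl] linear_scale[OF tl] M.to_of_chart[OF c p(1)])
  show "endo_rep A c \<phi> x (vec_rep A c Z1 x) = 0" "endo_rep A c \<phi> x (vec_rep A c Z2 x) = 0"
    by (simp_all add: reps linear_0[OF tl])
  show "bil_rep A c g x v (vec_rep A c Z1 x) = form_rep A c \<alpha>1 x v" "bil_rep A c g x v (vec_rep A c Z2 x) = form_rep A c \<alpha>2 x v"
    "form_rep A c \<alpha>1 x (vec_rep A c Z1 x) = 1" "form_rep A c \<alpha>1 x (vec_rep A c Z2 x) = 0"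
    "form_rep A c \<alpha>2 x (vec_rep A c Z1 x) = 0" "form_rep A c \<alpha>2 x (vec_rep A c Z2 x) = 1"
    "bil_rep A c g x v (endo_rep A c \<phi> x w) = ext_deriv_rep (form_rep A c \<alpha>1) x v w + ext_deriv_rep (form_rep A c \<alpha>2) x v w"
    "ext_deriv_rep (form_rep A c \<alpha>1) x (vec_rep A c Z1 x) v = 0" "ext_deriv_rep (form_rep A c \<alpha>1) x (vec_rep A c Z2 x) v = 0"
    "ext_deriv_rep (form_rep A c \<alpha>2) x (vec_rep A c Z1 x) v = 0" "ext_deriv_rep (form_rep A c \<alpha>2) x (vec_rep A c Z2 x) v = 0"
    by (simp_all add: reps)
qed

lemma chart_immersion:
  assumes c: "c \<in> A" and d: "d \<in> B"
  shows "invariant_immersion (cimg c) (bil_rep A c g) (endo_rep A c \<phi>) (form_rep A c \<alpha>1) (form_rep A c \<alpha>2)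
    (vec_rep A c Z1) (vec_rep A c Z2) (U c d) (f c d)"
proof (intro invariant_immersion.intro chart_mcp[OF c] invariant_immersion_axioms.intro)
  show "open (U c d)" "smooth_on (U c d) (f c d)" by (rule open_U[OF c d], rule f_smooth[OF c d])
next
  fix u assume u: "u \<in> U c d"
  show "inj (frechet_derivative (f c d) (at u))" by (rule inj_df[OF c d u])
  obtain q where q: "q \<in> cdom d" "\<iota> q \<in> cdom c" "u = cmap d q" "f c d u = cmap c (\<iota> q)"
    using U_cases[OF c d u] by metis
  then show "f c d u \<in> cimg c" by (simp add: M.cmap_in[OF c])
  let ?D = "frechet_derivative (f c d) (at u)"
  have tm: "tangent_map B A \<iota> q (of_chart B d q v) = of_chart A c (\<iota> q) (?D v)" for v
    using tangent_map_of_chart[OF c d q(1,2)] q(3) by simp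
  have ts: "to_chart A c (\<iota> q) w \<in> range ?D" if "w \<in> tangent_space B A \<iota> q" for w
  proof -
    from that obtain v where "w = tangent_map B A \<iota> q v" by (auto simp: tangent_space_def)
    then show ?thesis
      using tangent_map_rep[OF c d q(1,2), of v] M.to_of_chart[OF c q(2)] q(3) by auto
  qed
  show "endo_rep A c \<phi> (f c d u) (?D v) \<in> range ?D" for v
  proof -
    have "of_chart A c (\<iota> q) (?D v) \<in> tangent_space B A \<iota> q"
      unfolding tm[symmetric] tangent_space_def by blast
    then have "\<phi> (\<iota> q) (of_chart A c (\<iota> q) (?D v)) \<in> tangent_space B A \<iota> q"
      using inv_sub by (auto simp: invariant_submanifold_def)
    from ts[OF this] show ?thesis by (simp add: q(4) M.endo_rep_cmap[OF c q(2)])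
  qed
  show "vec_rep A c Z1 (f c d u) \<notin> range ?D"
  proof
    assume "vec_rep A c Z1 (f c d u) \<in> range ?D"
    then obtain v where "to_chart A c (\<iota> q) (Z1 (\<iota> q)) = ?D v" by (auto simp: q(4) M.vec_rep_cmap[OF c q(2)])
    then have "Z1 (\<iota> q) = tangent_map B A \<iota> q (of_chart B d q v)"
      unfolding tm using M.of_to_chart[OF c q(2)] by metis
    then show False using tangent by (auto simp: nowhere_tangent_def tangent_space_def)
  qed
  obtain w where w: "w \<in> tangent_space B A \<iota> q" "g (\<iota> q) (Z1 (\<iota> q)) w \<noteq> 0"
    using orthogonal by (auto simp: nowhere_orthogonal_def)
  obtain v where v: "to_chart A c (\<iota> q) w = ?D v" using ts[OF w(1)] by auto
  have "form_rep A c \<alpha>1 (f c d u) (?D v) = \<alpha>1 (\<iota> q) w"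
    by (simp add: q(4) M.form_rep_cmap[OF c q(2)] v[symmetric] M.of_to_chart[OF c q(2)])
  also have "\<dots> \<noteq> 0" using w(2) mcp_simps(5)[of "\<iota> q" w] inner_form_commute[OF g_inner, of "\<iota> q" w] by simp
  finally show "\<exists>s. form_rep A c \<alpha>1 (f c d u) (?D s) \<noteq> 0" by blast
qed

section \<open>The tangential Reeb field on N and its comparison with charts\<close>

definition "Z1T q = tan_part B A \<iota> g q (Z1 (\<iota> q))"
definition "aN q = \<alpha>1 (\<iota> q) (Z1T q)"
definition "bN q = \<alpha>2 (\<iota> q) (Z1T q)"

lemma tangent_map_inj: "inj (tangent_map B A \<iota> q)"
  using sub by (auto simp: submanifold_def)

lemma tan_part:
  "tan_part B A \<iota> g q x \<in> tangent_space B A \<iota> q"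
  "s \<in> tangent_space B A \<iota> q \<Longrightarrow> g (\<iota> q) (x - tan_part B A \<iota> g q x) s = 0"
proof -
  have "\<exists>!t. t \<in> range (tangent_map B A \<iota> q) \<and> (\<forall>s\<in>range (tangent_map B A \<iota> q). g (\<iota> q) (x - t) s = 0)"
    by (rule orthogonal_projection_ex1[OF g_inner tangent_map_linear tangent_map_inj])
  from theI'[OF this] show "tan_part B A \<iota> g q x \<in> tangent_space B A \<iota> q"
    "s \<in> tangent_space B A \<iota> q \<Longrightarrow> g (\<iota> q) (x - tan_part B A \<iota> g q x) s = 0"
    unfolding tan_part_def tangent_space_def by blast+
qed

lemma tan_part_eqI:
  "t \<in> tangent_space B A \<iota> q \<Longrightarrow> (\<And>s. s \<in> tangent_space B A \<iota> q \<Longrightarrow> g (\<iota> q) (x - t) s = 0) \<Longrightarrow>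
    tan_part B A \<iota> g q x = t"
  unfolding tan_part_def tangent_space_def
  by (rule the1_equality[OF orthogonal_projection_ex1[OF g_inner tangent_map_linear tangent_map_inj]]) auto

context
  fixes c d assumes c: "c \<in> A" and d: "d \<in> B"
begin

interpretation I: invariant_immersion "cimg c" "bil_rep A c g" "endo_rep A c \<phi>" "form_rep A c \<alpha>1" "form_rep A c \<alpha>2"
    "vec_rep A c Z1" "vec_rep A c Z2" "U c d" "f c d" by (rule chart_immersion[OF c d])

abbreviation "Xc \<equiv> invariant_immersion.X (bil_rep A c g) (vec_rep A c Z1) (f c d)"
abbreviation "ac \<equiv> invariant_immersion.a (bil_rep A c g) (form_rep A c \<alpha>1) (vec_rep A c Z1) (f c d)"
abbreviation "bc \<equiv> invariant_immersion.b (bil_rep A c g) (form_rep A c \<alpha>2) (vec_rep A c Z1) (f c d)"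

text \<open>This holds for every pair of charts around the point. Along an integral curve the chosen
  charts may jump, while derivatives have to be taken in a fixed pair.\<close>

lemma Z1T_chart:
  assumes q: "q \<in> cdom d" "\<iota> q \<in> cdom c"
  shows "Z1T q = of_chart A c (\<iota> q) (frechet_derivative (f c d) (at (cmap d q)) (Xc (cmap d q)))"
    and "aN q = ac (cmap d q)" and "bN q = bc (cmap d q)"
proof -
  let ?u = "cmap d q"
  have u: "?u \<in> U c d" by (rule cmap_in_U[OF c d q])
  have fu: "f c d ?u = cmap c (\<iota> q)" using q by (simp add: f_def[OF c d] N.cinv_cmap[OF d])
  let ?D = "frechet_derivative (f c d) (at ?u)"
  have tm: "tangent_map B A \<iota> q (of_chart B d q v) = of_chart A c (\<iota> q) (?D v)" for v
    by (rule tangent_map_of_chart[OF c d q])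
  show Z: "Z1T q = of_chart A c (\<iota> q) (?D (Xc ?u))"
    unfolding Z1T_def
  proof (rule tan_part_eqI)
    show "of_chart A c (\<iota> q) (?D (Xc ?u)) \<in> tangent_space B A \<iota> q"
      unfolding tm[symmetric] tangent_space_def by blast
    fix s assume "s \<in> tangent_space B A \<iota> q"
    then obtain v where v: "s = of_chart A c (\<iota> q) (?D v)"
      using tangent_map_rep[OF c d q] by (auto simp: tangent_space_def)
    have "bil_rep A c g (f c d ?u) (vec_rep A c Z1 (f c d ?u) - ?D (Xc ?u)) (?D v) = 0"
      by (rule I.X[OF u])
    then show "g (\<iota> q) (Z1 (\<iota> q) - of_chart A c (\<iota> q) (?D (Xc ?u))) s = 0"
      by (simp add: fu v M.bil_rep_cmap[OF c q(2)] M.vec_rep_cmap[OF c q(2)] M.of_to_chart[OF c q(2)]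
          linear_diff[OF M.of_chart_linear[OF c q(2)]])
  qed
  show "aN q = ac ?u" "bN q = bc ?u"
    by (simp_all add: aN_def bN_def I.a_def I.b_def Z fu M.form_rep_cmap[OF c q(2)])
qed

end

text \<open>The derivative of \<open>aN\<close> along \<open>Z1T\<close>.\<close>

definition "daN q = (let c = chart_at A (\<iota> q); d = chart_at B q in
  frechet_derivative (ac c d) (at (cmap d q)) (Xc c d (cmap d q)))"

lemma Z1T_sums: "aN q = (aN q)\<^sup>2 + (bN q)\<^sup>2" "aN q > 0" "bN q \<noteq> 0"
  "g (\<iota> q) (Z1T q) (Z1T q) = aN q" "g (\<iota> q) (Z1T q) (Z1 (\<iota> q)) = aN q" "g (\<iota> q) (Z1T q) (Z2 (\<iota> q)) = bN q"
proof -
  note c = M.chart_at[of "\<iota> q"] and d = N.chart_at[of q]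
  interpret I: invariant_immersion "cimg (chart_at A (\<iota> q))" "bil_rep A (chart_at A (\<iota> q)) g"
    "endo_rep A (chart_at A (\<iota> q)) \<phi>" "form_rep A (chart_at A (\<iota> q)) \<alpha>1" "form_rep A (chart_at A (\<iota> q)) \<alpha>2"
    "vec_rep A (chart_at A (\<iota> q)) Z1" "vec_rep A (chart_at A (\<iota> q)) Z2"
    "U (chart_at A (\<iota> q)) (chart_at B q)" "f (chart_at A (\<iota> q)) (chart_at B q)"
    by (rule chart_immersion[OF c(1) d(1)])
  note u = cmap_in_U[OF c(1) d(1) d(2) c(2)]
  note eq = Z1T_chart[OF c(1) d(1) d(2) c(2)]
  show "aN q = (aN q)\<^sup>2 + (bN q)\<^sup>2" "aN q > 0" "bN q \<noteq> 0"
    unfolding eq by (rule I.a_eq[OF u], rule I.a_pos[OF u], rule I.b_nonzero[OF u])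
  show 1: "g (\<iota> q) (Z1T q) (Z1 (\<iota> q)) = aN q" "g (\<iota> q) (Z1T q) (Z2 (\<iota> q)) = bN q"
    by (simp_all add: mcp_simps aN_def bN_def)
  have "g (\<iota> q) (Z1 (\<iota> q) - Z1T q) (Z1T q) = 0"
    unfolding Z1T_def by (rule tan_part(2)[OF tan_part(1)])
  then show "g (\<iota> q) (Z1T q) (Z1T q) = aN q"
    using 1 inner_form_commute[OF g_inner, of "\<iota> q" "Z1T q" "Z1 (\<iota> q)"] by (simp add: inner_form_simps[OF g_inner])
qed

text \<open>At \<open>q\<close> the chosen charts make \<open>to_chart\<close> and
  \<open>of_chart\<close> the identity; near \<open>q\<close> they conjugate the tangent map to
  \<open>df\<close>, so that the derivative inside the covariant derivative is \<open>ddf\<close>.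
  Pairing with the normal vector \<open>n\<close> removes \<open>tan_part\<close>.\<close>

lemma sff_chart:
  fixes q
  defines "c \<equiv> chart_at A (\<iota> q)" and "d \<equiv> chart_at B q"
  assumes n: "\<And>s. s \<in> tangent_space B A \<iota> q \<Longrightarrow> g (\<iota> q) n s = 0"
  shows "g (\<iota> q) n (second_fundamental_form B A \<iota> g q v w) =
    invariant_immersion.sff_form (bil_rep A c g) (f c d) (cmap d q) v w n"
proof -
  have c: "c \<in> A" "\<iota> q \<in> cdom c" and d: "d \<in> B" "q \<in> cdom d"
    using M.chart_at N.chart_at by (auto simp: c_def d_def)
  interpret I: invariant_immersion "cimg c" "bil_rep A c g" "endo_rep A c \<phi>" "form_rep A c \<alpha>1" "form_rep A c \<alpha>2"
    "vec_rep A c Z1" "vec_rep A c Z2" "U c d" "f c d" by (rule chart_immersion[OF c(1) d(1)])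
  let ?u = "cmap d q" and ?x = "cmap c (\<iota> q)"
  have u: "?u \<in> U c d" by (rule cmap_in_U[OF c(1) d(1) d(2) c(2)])
  have fu: "f c d ?u = ?x" using d by (simp add: f_def[OF c(1) d(1)] N.cinv_cmap)
  have of_c: "of_chart A c (\<iota> q) v = v" for v by (simp add: c_def M.of_chart_self)
  have G: "bil_rep A c g ?x v w = g (\<iota> q) v w" for v w
    by (simp add: M.bil_rep_cmap[OF c] of_c)
  have tm: "tangent_map B A \<iota> q v = I.df ?u v" for v
    using tangent_map_rep[OF c(1) d(1) d(2) c(2), of v] by (simp add: c_def d_def M.of_chart_self N.to_chart_self)
  have of_self: "of_chart B d q w = w" by (simp add: d_def N.of_chart_self)
  let ?Y = "\<lambda>u. to_chart A c (\<iota> (cinv d u)) (tangent_map B A \<iota> (cinv d u) (of_chart B d (cinv d u) w))"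
  have "(?Y has_derivative (\<lambda>v. I.ddf ?u v w)) (at ?u)"
  proof (rule has_derivative_transform_within_open[OF _ open_U[OF c(1) d(1)] u])
    show "((\<lambda>u. I.df u w) has_derivative (\<lambda>v. I.ddf ?u v w)) (at ?u)"
      by (rule smooth_on_has_derivative[OF smooth_on_frechet_derivative[OF f_smooth[OF c(1) d(1)]] u])
    fix u assume "u \<in> U c d"
    then obtain q' where "q' \<in> cdom d" "\<iota> q' \<in> cdom c" "u = cmap d q'" "cinv d u = q'"
      by (rule U_cases[OF c(1) d(1)])
    then show "I.df u w = ?Y u"
      by (simp add: tangent_map_of_chart[OF c(1) d(1)] M.to_of_chart[OF c(1)])
  qed
  note Y = frechet_derivative_at[OF this, symmetric]
  have chr: "g (\<iota> q) (christoffel A g (\<iota> q) v w) n = I.christoffel_form ?x v w n" for v w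
  proof -
    have "\<exists>!t. \<forall>z. g (\<iota> q) t z = I.christoffel_form ?x v w z"
      using I.christoffel_form_linear(3)[OF M.cmap_in[OF c]] by (rule riesz_inner_form[OF g_inner])
    from theI'[OF this] show ?thesis
      unfolding christoffel_def Let_def I.christoffel_form_def c_def[symmetric] by blast
  qed
  define y where "y = I.ddf ?u v w + christoffel A g (\<iota> q) (I.df ?u v) (I.df ?u w)"
  have "second_fundamental_form B A \<iota> g q v w = y - tan_part B A \<iota> g q y"
    unfolding second_fundamental_form_def cov_deriv_along_def Let_def c_def[symmetric] d_def[symmetric] Y
    by (simp add: y_def tm of_self)
  then have "g (\<iota> q) n (second_fundamental_form B A \<iota> g q v w) = g (\<iota> q) n y"
    using n[OF tan_part(1)] by (simp add: inner_form_simps[OF g_inner])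
  also have "\<dots> = I.sff_form ?u v w n"
    using chr[of "I.df ?u v" "I.df ?u w"] inner_form_commute[OF g_inner, of "\<iota> q" n "christoffel A g (\<iota> q) (I.df ?u v) (I.df ?u w)"]
    by (simp add: y_def I.sff_form_def fu G inner_form_simps[OF g_inner])
  finally show ?thesis .
qed

lemma sum_sff_eq_0_iff:
  assumes E: "orthonormal_basis B A \<iota> g q E"
  shows "(\<Sum>e\<in>E. second_fundamental_form B A \<iota> g q e e) = 0 \<longleftrightarrow> daN q = 0"
proof -
  define c where "c = chart_at A (\<iota> q)"
  define d where "d = chart_at B q"
  have c: "c \<in> A" "\<iota> q \<in> cdom c" and d: "d \<in> B" "q \<in> cdom d"
    using M.chart_at N.chart_at by (auto simp: c_def d_def)
  interpret I: invariant_immersion "cimg c" "bil_rep A c g" "endo_rep A c \<phi>" "form_rep A c \<alpha>1" "form_rep A c \<alpha>2"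
    "vec_rep A c Z1" "vec_rep A c Z2" "U c d" "f c d" by (rule chart_immersion[OF c(1) d(1)])
  let ?u = "cmap d q" and ?x = "cmap c (\<iota> q)"
  have u: "?u \<in> U c d" by (rule cmap_in_U[OF c(1) d(1) d(2) c(2)])
  have fu: "f c d ?u = ?x" using d by (simp add: f_def[OF c(1) d(1)] N.cinv_cmap)
  have of_c: "of_chart A c (\<iota> q) v = v" for v by (simp add: c_def M.of_chart_self)
  have G: "bil_rep A c g ?x v w = g (\<iota> q) v w" for v w
    by (simp add: M.bil_rep_cmap[OF c] of_c)
  have al: "form_rep A c \<alpha>1 ?x v = \<alpha>1 (\<iota> q) v" for v
    by (simp add: M.form_rep_cmap[OF c] of_c)
  have tm: "tangent_map B A \<iota> q v = I.df ?u v" for v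
    using tangent_map_rep[OF c(1) d(1) d(2) c(2), of v] by (simp add: c_def d_def M.of_chart_self N.to_chart_self)
  have E': "orthonormal_frame (\<lambda>v w. bil_rep A c g (f c d ?u) (I.df ?u v) (I.df ?u w)) E" "span E = UNIV"
    using E by (auto simp: orthonormal_basis_def orthonormal_frame_def fu G tm)
  let ?H = "\<Sum>e\<in>E. second_fundamental_form B A \<iota> g q e e"
  have key: "g (\<iota> q) n ?H * (2 * (bN q)\<^sup>2) = \<alpha>1 (\<iota> q) n * daN q"
    if n: "\<And>s. s \<in> tangent_space B A \<iota> q \<Longrightarrow> g (\<iota> q) n s = 0" for n
  proof -
    have "bil_rep A c g (f c d ?u) n (I.df ?u v) = 0" for v
      using n by (auto simp: fu G tangent_space_def tm)
    from I.mean_curvature[OF u this E']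
    have "(\<Sum>e\<in>E. I.sff_form ?u e e n) * (2 * (I.b ?u)\<^sup>2) = form_rep A c \<alpha>1 (f c d ?u) n * frechet_derivative I.a (at ?u) (I.X ?u)"
      by simp
    then show ?thesis
      using sff_chart[OF n] Z1T_chart(3)[OF c(1) d(1) d(2) c(2)]
      by (simp add: inner_form_simps[OF g_inner] c_def[symmetric] d_def[symmetric] daN_def Let_def fu al)
  qed
  show ?thesis
  proof
    assume "?H = 0"
    \<comment> \<open>The test vector is the normal part of \<open>Z1\<close>. Its value under
      \<alpha>1 is 1 - a, which is not zero because a = 1 would force b = 0.\<close>
    have "g (\<iota> q) (Z1 (\<iota> q) - Z1T q) s = 0" if "s \<in> tangent_space B A \<iota> q" for s
      unfolding Z1T_def by (rule tan_part(2)[OF that])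
    from key[OF this] have "\<alpha>1 (\<iota> q) (Z1 (\<iota> q) - Z1T q) * daN q = 0"
      using \<open>?H = 0\<close> by (simp add: inner_form_simps[OF g_inner])
    moreover have "\<alpha>1 (\<iota> q) (Z1 (\<iota> q) - Z1T q) = 1 - aN q"
      using one_forms(1) by (simp add: one_form_def linear_diff mcp_simps aN_def)
    moreover have "1 - aN q \<noteq> 0" using Z1T_sums(1,3)[of q] by auto
    ultimately show "daN q = 0" by simp
  next
    assume "daN q = 0"
    \<comment> \<open>The trace is itself normal, so it may be tested against itself.\<close>
    have "g (\<iota> q) ?H s = 0" if s: "s \<in> tangent_space B A \<iota> q" for s
    proof -
      have "g (\<iota> q) (second_fundamental_form B A \<iota> g q e e) s = 0" for e
        unfolding second_fundamental_form_def Let_def by (rule tan_part(2)[OF s])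
      then show ?thesis by (simp add: inner_form_simps[OF g_inner])
    qed
    from key[OF this] have "g (\<iota> q) ?H ?H = 0" using \<open>daN q = 0\<close> Z1T_sums(3)[of q] by simp
    then show "?H = 0" by (rule inner_form_eq_0[OF g_inner])
  qed
qed

text \<open>An orthonormal basis exists at every point, so the condition in \<open>minimal\<close>
  is nowhere vacuous.\<close>

lemma minimal_iff: "minimal B A \<iota> g \<longleftrightarrow> (\<forall>q. daN q = 0)"
proof -
  have "\<exists>E. orthonormal_basis B A \<iota> g q E" for q
  proof -
    obtain E where "orthonormal_frame (\<lambda>v w. g (\<iota> q) (tangent_map B A \<iota> q v) (tangent_map B A \<iota> q w)) E" "span E = UNIV"
      using orthonormal_frame_exists[OF inner_form_pullback[OF g_inner tangent_map_linear tangent_map_inj]] by blast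
    then show ?thesis by (auto simp: orthonormal_basis_def orthonormal_frame_def)
  qed
  then show ?thesis unfolding minimal_def using sum_sff_eq_0_iff by blast
qed

end

section \<open>Integral curves of the tangential Reeb field and the two angles\<close>

context mcp_submanifold
begin

text \<open>In the chart chosen at \<open>\<gamma> t\<close> the velocity at time \<open>t\<close>
  is \<open>X\<close>, because \<open>df\<close> is injective. The continuity of \<open>bN\<close>
  along the curve serves the sign argument for the second angle.\<close>

lemma integral_curve_chart:
  fixes \<gamma> :: "real \<Rightarrow> 'n"
  assumes \<gamma>: "integral_curve B A \<iota> Z1T I \<gamma>" and t: "t \<in> I"
  shows "(aN \<circ> \<gamma> has_derivative (\<lambda>h. h * daN (\<gamma> t))) (at t)" and "isCont (bN \<circ> \<gamma>) t"
proof -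
  define q where "q = \<gamma> t"
  define c where "c = chart_at A (\<iota> q)"
  define d where "d = chart_at B q"
  have c: "c \<in> A" "\<iota> q \<in> cdom c" and d: "d \<in> B" "q \<in> cdom d"
    using M.chart_at N.chart_at by (auto simp: c_def d_def)
  interpret I: invariant_immersion "cimg c" "bil_rep A c g" "endo_rep A c \<phi>" "form_rep A c \<alpha>1" "form_rep A c \<alpha>2"
    "vec_rep A c Z1" "vec_rep A c Z2" "U c d" "f c d" by (rule chart_immersion[OF c(1) d(1)])
  have u: "cmap d q \<in> U c d" by (rule cmap_in_U[OF c(1) d(1) d(2) c(2)])
  obtain v where v: "((\<lambda>s. cmap d (\<gamma> s)) has_vector_derivative v) (at t)" "tangent_map B A \<iota> q v = Z1T q"
    using \<gamma> t by (auto simp: integral_curve_def d_def q_def)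
  have "I.df (cmap d q) v = I.df (cmap d q) (I.X (cmap d q))"
    using v(2) tangent_map_rep[OF c(1) d(1) d(2) c(2), of v] Z1T_chart(1)[OF c(1) d(1) d(2) c(2)]
    by (simp add: c_def d_def M.of_chart_self N.to_chart_self)
  then have v_eq: "v = I.X (cmap d q)" using I.inj_df[OF u] by (auto dest: injD)
  have I: "open I" and cont: "continuous_on I \<gamma>" using \<gamma> by (auto simp: integral_curve_def)
  \<comment> \<open>The times at which the curve is inside the charts chosen at time
    \<open>t\<close>.\<close>
  define S where "S = I \<inter> \<gamma> -` (cdom d \<inter> \<iota> -` cdom c)"
  have S: "open S" unfolding S_def
    using open_preimage[OF c(1) d(1)] N.open_cdom[OF d(1)] by (intro continuous_open_preimage[OF cont I]) auto
  have tS: "t \<in> S" using t c d by (simp add: S_def q_def)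
  have der: "((\<lambda>s. cmap d (\<gamma> s)) has_derivative (\<lambda>h. h *\<^sub>R I.X (cmap d q))) (at t)"
    using v(1) by (simp add: has_vector_derivative_def v_eq)
  have "(I.a has_derivative frechet_derivative I.a (at (cmap d q))) (at (cmap d (\<gamma> t)))"
    using C1_on_has_derivative[OF I.a_C1 u] by (simp add: q_def)
  from diff_chain_at[OF der this]
  have "((\<lambda>s. I.a (cmap d (\<gamma> s))) has_derivative (\<lambda>h. h * daN q)) (at t)"
    using linear_scale[OF linear_frechet_derivative[OF C1_on_differentiable[OF I.a_C1 u]]]
    by (simp add: o_def daN_def Let_def c_def[symmetric] d_def[symmetric])
  then have "(aN \<circ> \<gamma> has_derivative (\<lambda>h. h * daN q)) (at t)"
    by (rule has_derivative_transform_within_open[OF _ S tS])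
       (simp add: S_def Z1T_chart(2)[OF c(1) d(1)])
  then show "(aN \<circ> \<gamma> has_derivative (\<lambda>h. h * daN (\<gamma> t))) (at t)" by (simp only: q_def)
  have "(I.b has_derivative frechet_derivative I.b (at (cmap d q))) (at (cmap d (\<gamma> t)))"
    using C1_on_has_derivative[OF I.b_C1 u] by (simp add: q_def)
  from diff_chain_at[OF der this]
  have "((\<lambda>s. I.b (cmap d (\<gamma> s))) has_derivative (\<lambda>h. frechet_derivative I.b (at (cmap d q)) (h *\<^sub>R I.X (cmap d q)))) (at t)"
    by (simp add: o_def)
  then have "(bN \<circ> \<gamma> has_derivative (\<lambda>h. frechet_derivative I.b (at (cmap d q)) (h *\<^sub>R I.X (cmap d q)))) (at t)"
    by (rule has_derivative_transform_within_open[OF _ S tS])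
       (simp add: S_def Z1T_chart(3)[OF c(1) d(1)])
  then show "isCont (bN \<circ> \<gamma>) t" by (rule has_derivative_continuous)
qed

text \<open>Constancy along integral curves carries information at \<open>q\<close> only if one of
  them passes through \<open>q\<close>.\<close>

lemma integral_curve_through:
  obtains I \<gamma> where "integral_curve B A \<iota> Z1T I \<gamma>" "0 \<in> I" "\<gamma> 0 = q"
proof -
  define c where "c = chart_at A (\<iota> q)"
  define d where "d = chart_at B q"
  have c: "c \<in> A" "\<iota> q \<in> cdom c" and d: "d \<in> B" "q \<in> cdom d"
    using M.chart_at N.chart_at by (auto simp: c_def d_def)
  interpret I: invariant_immersion "cimg c" "bil_rep A c g" "endo_rep A c \<phi>" "form_rep A c \<alpha>1" "form_rep A c \<alpha>2"
    "vec_rep A c Z1" "vec_rep A c Z2" "U c d" "f c d" by (rule chart_immersion[OF c(1) d(1)])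
  have u: "cmap d q \<in> U c d" by (rule cmap_in_U[OF c(1) d(1) d(2) c(2)])
  obtain \<delta> \<eta> where \<delta>: "\<delta> > 0" and \<eta>: "\<eta> 0 = cmap d q"
    and \<eta>U: "\<And>t. t \<in> {-\<delta><..<\<delta>} \<Longrightarrow> \<eta> t \<in> U c d"
    and \<eta>': "\<And>t. t \<in> {-\<delta><..<\<delta>} \<Longrightarrow> (\<eta> has_vector_derivative I.X (\<eta> t)) (at t)"
    using integral_curve_exists[OF I.U u I.X_C1] by blast
  define J where "J = {-\<delta><..<\<delta>}"
  define \<gamma> where "\<gamma> t = cinv d (\<eta> t)" for t
  have \<gamma>: "\<gamma> t \<in> cdom d" "\<iota> (\<gamma> t) \<in> cdom c" "cmap d (\<gamma> t) = \<eta> t" if "t \<in> J" for t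
    using \<eta>U[of t] that U_cases[OF c(1) d(1), of "\<eta> t"] unfolding J_def \<gamma>_def by metis+
  have "continuous_on J \<eta>" unfolding continuous_on_eq_continuous_within
    using \<eta>' has_derivative_continuous[OF has_derivative_at_withinI] by (fastforce simp: has_vector_derivative_def J_def)
  moreover have "\<eta> ` J \<subseteq> cimg d" using \<gamma> N.cmap_in[OF d(1)] by force
  ultimately have cont: "continuous_on J \<gamma>"
    unfolding \<gamma>_def[abs_def] by (rule continuous_on_compose2[OF N.continuous_cinv[OF d(1)]])
  have "integral_curve B A \<iota> Z1T J \<gamma>"
    unfolding integral_curve_def
  proof (intro conjI ballI cont)
    show "open J" "is_interval J" by (auto simp: J_def)
    fix t assume t: "t \<in> J"
    \<comment> \<open>The definition measures velocity in the chart chosen at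
      \<open>\<gamma> t\<close>, which may differ from \<open>d\<close>.\<close>
    define v where "v = of_chart B d (\<gamma> t) (I.X (\<eta> t))"
    have "(\<eta> has_derivative (\<lambda>h. h *\<^sub>R I.X (\<eta> t))) (at t)"
      using \<eta>'[of t] t by (simp add: J_def has_vector_derivative_def)
    then have "((\<lambda>s. cmap d (\<gamma> s)) has_derivative (\<lambda>h. h *\<^sub>R I.X (\<eta> t))) (at t)"
      by (rule has_derivative_transform_within_open[OF _ _ t]) (auto simp: \<gamma>, simp add: J_def)
    from N.has_derivative_change_chart[OF N.chart_at(1) d(1) _ t _ N.chart_at(2) this]
    have "((\<lambda>s. cmap (chart_at B (\<gamma> t)) (\<gamma> s)) has_derivative
        (\<lambda>h. jac d (chart_at B (\<gamma> t)) (\<gamma> t) (h *\<^sub>R I.X (\<eta> t)))) (at t)"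
      using \<gamma> by (simp add: J_def)
    then have 1: "((\<lambda>s. cmap (chart_at B (\<gamma> t)) (\<gamma> s)) has_vector_derivative v) (at t)"
      using linear_scale[OF N.of_chart_linear[OF d(1) \<gamma>(1)[OF t]]]
      by (simp add: has_vector_derivative_def v_def of_chart_jac)
    have "tangent_map B A \<iota> (\<gamma> t) v = Z1T (\<gamma> t)"
      unfolding v_def tangent_map_of_chart[OF c(1) d(1) \<gamma>(1,2)[OF t]] Z1T_chart(1)[OF c(1) d(1) \<gamma>(1,2)[OF t]] \<gamma>(3)[OF t] ..
    with 1 show "\<exists>v. ((\<lambda>s. cmap (chart_at B (\<gamma> t)) (\<gamma> s)) has_vector_derivative v) (at t) \<and>
        tangent_map B A \<iota> (\<gamma> t) v = Z1T (\<gamma> t)" by blast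
  qed
  moreover have "\<gamma> 0 = q" using \<eta> d by (simp add: \<gamma>_def N.cinv_cmap)
  moreover have "0 \<in> J" using \<delta> by (simp add: J_def)
  ultimately show ?thesis using that by blast
qed

text \<open>Zero derivative gives constancy because \<open>I\<close> is an interval; conversely,
  differentiate at time 0 along a curve through the given point.\<close>

lemma daN_eq_0_iff: "(\<forall>q. daN q = 0) \<longleftrightarrow> constant_along B A \<iota> Z1T aN"
proof
  assume 0: "\<forall>q. daN q = 0"
  show "constant_along B A \<iota> Z1T aN"
    unfolding constant_along_def
  proof (intro allI impI ballI)
    fix I \<gamma> s t assume \<gamma>: "integral_curve B A \<iota> Z1T I \<gamma>" and st: "s \<in> I" "t \<in> I"
    have cv: "convex I" using \<gamma> by (auto simp: integral_curve_def is_interval_convex)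
    have "(aN \<circ> \<gamma> has_derivative (\<lambda>h. 0)) (at r within I)" if "r \<in> I" for r
      using has_derivative_at_withinI[OF integral_curve_chart(1)[OF \<gamma> that]] 0 by simp
    from has_derivative_zero_constant[OF cv this] show "aN (\<gamma> s) = aN (\<gamma> t)" using st by auto
  qed
next
  assume const: "constant_along B A \<iota> Z1T aN"
  show "\<forall>q. daN q = 0"
  proof
    fix q
    obtain I \<gamma> where \<gamma>: "integral_curve B A \<iota> Z1T I \<gamma>" "0 \<in> I" "\<gamma> 0 = q" using integral_curve_through .
    have I: "open I" using \<gamma> by (auto simp: integral_curve_def)
    have eq: "(aN \<circ> \<gamma>) s = aN q" if "s \<in> I" for s
      using const[unfolded constant_along_def, rule_format, OF \<gamma>(1) that \<gamma>(2)] \<gamma>(3) by simp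
    have "((\<lambda>s. aN q) has_derivative (\<lambda>h. h * daN (\<gamma> 0))) (at 0)"
      by (rule has_derivative_transform_within_open[OF integral_curve_chart(1)[OF \<gamma>(1,2)] I \<gamma>(2) eq])
    then have "((\<lambda>s. aN q) has_derivative (\<lambda>h. h * daN q)) (at 0)" by (simp only: \<gamma>(3))
    from fun_cong[OF has_derivative_unique[OF this has_derivative_const], of 1] show "daN q = 0" by simp
  qed
qed

lemma angles:
  "metric_angle g (\<iota> q) (Z1T q) (Z1 (\<iota> q)) = arccos (sqrt (aN q))"
  "metric_angle g (\<iota> q) (Z1T q) (Z2 (\<iota> q)) = arccos (bN q / sqrt (aN q))"
  using Z1T_sums[of q] by (simp_all add: metric_angle_def mcp_simps real_div_sqrt)

lemma aN_less_1: "aN q < 1"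
proof (rule ccontr)
  assume "\<not> aN q < 1"
  then have "aN q * 1 \<le> aN q * aN q" using Z1T_sums(2)[of q] by (intro mult_left_mono) auto
  moreover have "(bN q)\<^sup>2 > 0" using Z1T_sums(3)[of q] by simp
  ultimately show False using Z1T_sums(1)[of q] by (simp add: power2_eq_square)
qed

text \<open>Z1T lies in the plane of the orthonormal pair Z1, Z2, so the squares of the two cosines
  add up to 1.\<close>

lemma cos_angle2: "(bN q / sqrt (aN q))\<^sup>2 = 1 - aN q"
  using Z1T_sums(1,2)[of q] by (simp add: power_divide field_simps power2_eq_square)

lemma constant_angle1: "constant_along B A \<iota> Z1T (\<lambda>q. metric_angle g (\<iota> q) (Z1T q) (Z1 (\<iota> q)))
    \<longleftrightarrow> constant_along B A \<iota> Z1T aN"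
proof -
  have "arccos (sqrt (aN p)) = arccos (sqrt (aN q)) \<longleftrightarrow> aN p = aN q" for p q
    using arccos_eq_iff[of "sqrt (aN p)" "sqrt (aN q)"] Z1T_sums(2)[of p] Z1T_sums(2)[of q] aN_less_1[of p] aN_less_1[of q]
    by simp
  then show ?thesis by (simp add: constant_along_def angles)
qed

text \<open>The cosine of this angle carries the sign of \<open>bN\<close>, which \<open>aN\<close>
  does not determine. Along a curve the sign cannot change, since \<open>bN\<close> is continuous on
  a connected interval and has no zero.\<close>

lemma constant_angle2: "constant_along B A \<iota> Z1T (\<lambda>q. metric_angle g (\<iota> q) (Z1T q) (Z2 (\<iota> q)))
    \<longleftrightarrow> constant_along B A \<iota> Z1T aN"
proof -
  have "\<bar>bN p / sqrt (aN p)\<bar> \<le> 1" for p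
    using cos_angle2[of p] Z1T_sums(2)[of p] abs_square_le_1[of "bN p / sqrt (aN p)"] by simp
  then have eq: "arccos (bN p / sqrt (aN p)) = arccos (bN q / sqrt (aN q)) \<longleftrightarrow> bN p / sqrt (aN p) = bN q / sqrt (aN q)" for p q
    using arccos_eq_iff by blast
  have 1: "aN p = aN q" if "bN p / sqrt (aN p) = bN q / sqrt (aN q)" for p q
    using cos_angle2[of p] cos_angle2[of q] that by simp
  have 2: "bN (\<gamma> s) = bN (\<gamma> t)"
    if \<gamma>: "integral_curve B A \<iota> Z1T I \<gamma>" and st: "s \<in> I" "t \<in> I" and a: "aN (\<gamma> s) = aN (\<gamma> t)" for I \<gamma> s t
  proof (rule ccontr)
    assume ne: "bN (\<gamma> s) \<noteq> bN (\<gamma> t)"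
    have "(bN (\<gamma> s))\<^sup>2 = (bN (\<gamma> t))\<^sup>2" using Z1T_sums(1)[of "\<gamma> s"] Z1T_sums(1)[of "\<gamma> t"] a by simp
    then have neg: "bN (\<gamma> s) = - bN (\<gamma> t)" using ne by (auto simp: power2_eq_iff)
    have "continuous_on I (bN \<circ> \<gamma>)"
      by (intro continuous_at_imp_continuous_on ballI integral_curve_chart(2)[OF \<gamma>])
    moreover have "connected I" using \<gamma> by (auto simp: integral_curve_def is_interval_connected)
    ultimately have conn: "connected ((bN \<circ> \<gamma>) ` I)" by (rule connected_continuous_image)
    have mem: "bN (\<gamma> s) \<in> (bN \<circ> \<gamma>) ` I" "bN (\<gamma> t) \<in> (bN \<circ> \<gamma>) ` I" using st by (auto intro: imageI)
    have "0 \<in> (bN \<circ> \<gamma>) ` I"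
    proof (cases "bN (\<gamma> t) \<ge> 0")
      case True
      then show ?thesis using neg by (intro connectedD_interval[OF conn mem(1,2)]) auto
    next
      case False
      then show ?thesis using neg by (intro connectedD_interval[OF conn mem(2,1)]) auto
    qed
    then show False using Z1T_sums(3) by auto
  qed
  show ?thesis unfolding constant_along_def angles eq
  proof (intro iffI allI impI ballI)
    fix I \<gamma> s t
    assume *: "\<forall>I \<gamma>. integral_curve B A \<iota> Z1T I \<gamma> \<longrightarrow>
        (\<forall>s\<in>I. \<forall>t\<in>I. bN (\<gamma> s) / sqrt (aN (\<gamma> s)) = bN (\<gamma> t) / sqrt (aN (\<gamma> t)))"
      and "integral_curve B A \<iota> Z1T I \<gamma>" "s \<in> I" "t \<in> I"
    from *[rule_format, OF this(2-)] show "aN (\<gamma> s) = aN (\<gamma> t)" by (rule 1)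
  next
    fix I \<gamma> s t
    assume *: "\<forall>I \<gamma>. integral_curve B A \<iota> Z1T I \<gamma> \<longrightarrow> (\<forall>s\<in>I. \<forall>t\<in>I. aN (\<gamma> s) = aN (\<gamma> t))"
      and \<gamma>: "integral_curve B A \<iota> Z1T I \<gamma>" "s \<in> I" "t \<in> I"
    from *[rule_format, OF \<gamma>] 2[OF \<gamma>] show "bN (\<gamma> s) / sqrt (aN (\<gamma> s)) = bN (\<gamma> t) / sqrt (aN (\<gamma> t))" by simp
  qed
qed

end

theorem theorem24:
  fixes A :: "('m::{t2_space, second_countable_topology}, 'e::euclidean_space) chart set"
    and B :: "('n::{t2_space, second_countable_topology}, 'f::euclidean_space) chart set"
    and h k :: nat
    and \<alpha>1 \<alpha>2 :: "'m \<Rightarrow> 'e \<Rightarrow> real"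
    and Z1 Z2 :: "'m \<Rightarrow> 'e"
    and \<phi> :: "'m \<Rightarrow> 'e \<Rightarrow> 'e"
    and g :: "'m \<Rightarrow> 'e \<Rightarrow> 'e \<Rightarrow> real"
    and \<iota> :: "'n \<Rightarrow> 'm"
  defines "Z1T \<equiv> \<lambda>q. tan_part B A \<iota> g q (Z1 (\<iota> q))"
  assumes "smooth_atlas A"
    and "metric_contact_pair A h k \<alpha>1 \<alpha>2 Z1 Z2 \<phi> g"
    and "normal_pair A \<alpha>1 \<alpha>2 Z1 Z2 \<phi>"
    and "decomposable A \<alpha>1 \<alpha>2 \<phi>"
    and "submanifold B A \<iota>"
    and "invariant_submanifold B A \<iota> \<phi>"
    and "nowhere_tangent B A \<iota> Z1" and "nowhere_tangent B A \<iota> Z2"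
    and "nowhere_orthogonal B A \<iota> g Z1" and "nowhere_orthogonal B A \<iota> g Z2"
  shows "(minimal B A \<iota> g \<longleftrightarrow>
            constant_along B A \<iota> Z1T (\<lambda>q. metric_angle g (\<iota> q) (Z1T q) (Z1 (\<iota> q)))) \<and>
         (minimal B A \<iota> g \<longleftrightarrow>
            constant_along B A \<iota> Z1T (\<lambda>q. metric_angle g (\<iota> q) (Z1T q) (Z2 (\<iota> q))))"
proof -
  have "smooth_atlas B" using assms(6) by (simp add: submanifold_def)
  then interpret mcp_submanifold A B \<iota> h k \<alpha>1 \<alpha>2 Z1 Z2 \<phi> g
    using assms by unfold_locales
  have "Z1T = mcp_submanifold.Z1T A B \<iota> Z1 g"
    unfolding assms(1) by (rule ext) (simp add: Z1T_def)
  then show ?thesis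
    using minimal_iff daN_eq_0_iff constant_angle1 constant_angle2 by simp
qed

end
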